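(* Let $[\beta]: 1\to A\to G\to Q\to 1$, $[\beta]\in H^2(Q,A)$, be an extension of a finite group $Q$ by a finite abelian group $A$ such that $|A|=|Q|$. Then there is a one-to-one correspondence between the bijective classes $[\pi]\in H^1(Q,\check{A})$ such that $[\beta]\cup[\pi]=0\in H^3(Q,\mathbb{C}^* )$, and the non-degenerate classes in $\ker(\mathrm{res}^G_A)$ modulo $\mathrm{im}(\mathrm{inf}^Q_G)$ (i.e. the non-degenerate elements of the quotient $\ker(\mathrm{res}^G_A)/\mathrm{im}(\mathrm{inf}^Q_G)$).
   Context: All groups act trivially on $\mathbb{C}^*$. The extension makes $A$ a $Q$-module (by conjugation in $G$), and $\check{A}=\mathrm{Hom}(A,\mathbb{C}^* )$ is a $Q$-module via $\langle g(\chi),a\rangle=\langle\chi,g^{-1}(a)\rangle$, where $\langle\chi,a\rangle=\chi(a)$. The maps $\mathrm{res}^G_A:H^2(G,\mathbb{C}^* )\to H^2(A,\mathbb{C}^* )$ and $\mathrm{inf}^Q_G:H^2(Q,\mathbb{C}^* )\to H^2(G,\mathbb{C}^* )$ are restriction and inflation. The product $[\beta]\cup[\pi]\in H^3(Q,\mathbb{C}^* )$ is the cup product followed by the pairing of $A$ with $\check A$; it is represented by the 3-cocycle $(g_1,g_2,g_3)\mapsto\langle\pi(g_1),g_1(\beta(g_2,g_3))\rangle$. A class $[\pi]\in H^1(Q,\check A)$ is bijective if the 1-cocycle $\pi:Q\to\check A$ (satisfying $\pi(g_1g_2)=\pi(g_1)\,g_1(\pi(g_2))$) is a bijective map; this does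 not depend on the representative. A 2-cocycle $c\in Z^2(G,\mathbb{C}^* )$, or its class, is non-degenerate if the twisted group algebra $\mathbb{C}^c[G]$ (with basis $\{U_\gamma\}_{\gamma\in G}$ and $U_\sigma U_\gamma=c(\sigma,\gamma)U_{\sigma\gamma}$) is isomorphic to a full matrix algebra $M_n(\mathbb{C})$, $n=\sqrt{|G|}$. An element of $\ker(\mathrm{res}^G_A)/\mathrm{im}(\mathrm{inf}^Q_G)$ is called non-degenerate if some (equivalently, when $|A|=|Q|$, every) class in $\ker(\mathrm{res}^G_A)$ representing it is non-degenerate. *)

theory Defs
  imports Complex_Main "HOL-Algebra.Product_Groups" "HOL-Algebra.QuotRing" "Jordan_Normal_Form.Matrix"
begin

section \<open>Low-degree group cohomology\<close>

text \<open>
  A \<open>Q\<close>-module is an abelian group \<open>M\<close>, written multiplicatively, with an action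
  \<open>act :: 'q \<Rightarrow> 'm \<Rightarrow> 'm\<close>.  Cochains are inhomogeneous and not assumed to be normalized;
  they are extensional functions, so that equality of cochains is equality of functions.
\<close>

definition cochains :: "'x set \<Rightarrow> ('m, 'r) monoid_scheme \<Rightarrow> ('x \<Rightarrow> 'm) monoid" where
  "cochains S M = product_group S (\<lambda>_. M)"

abbreviation C1 :: "('q, 'r) monoid_scheme \<Rightarrow> ('m, 's) monoid_scheme \<Rightarrow> ('q \<Rightarrow> 'm) monoid" where
  "C1 Q M \<equiv> cochains (carrier Q) M"

abbreviation C2 :: "('q, 'r) monoid_scheme \<Rightarrow> ('m, 's) monoid_scheme \<Rightarrow> ('q \<times> 'q \<Rightarrow> 'm) monoid" where
  "C2 Q M \<equiv> cochains (carrier Q \<times> carrier Q) M"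

abbreviation C3 :: "('q, 'r) monoid_scheme \<Rightarrow> ('m, 's) monoid_scheme
    \<Rightarrow> ('q \<times> 'q \<times> 'q \<Rightarrow> 'm) monoid" where
  "C3 Q M \<equiv> cochains (carrier Q \<times> carrier Q \<times> carrier Q) M"

abbreviation C4 :: "('q, 'r) monoid_scheme \<Rightarrow> ('m, 's) monoid_scheme
    \<Rightarrow> ('q \<times> 'q \<times> 'q \<times> 'q \<Rightarrow> 'm) monoid" where
  "C4 Q M \<equiv> cochains (carrier Q \<times> carrier Q \<times> carrier Q \<times> carrier Q) M"

definition cobdry0 :: "('q, 'r) monoid_scheme \<Rightarrow> ('m, 's) monoid_scheme \<Rightarrow> ('q \<Rightarrow> 'm \<Rightarrow> 'm)
    \<Rightarrow> 'm \<Rightarrow> 'q \<Rightarrow> 'm" where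
  "cobdry0 Q M act m = (\<lambda>g\<in>carrier Q. act g m \<otimes>\<^bsub>M\<^esub> inv\<^bsub>M\<^esub> m)"

definition cobdry1 :: "('q, 'r) monoid_scheme \<Rightarrow> ('m, 's) monoid_scheme \<Rightarrow> ('q \<Rightarrow> 'm \<Rightarrow> 'm)
    \<Rightarrow> ('q \<Rightarrow> 'm) \<Rightarrow> 'q \<times> 'q \<Rightarrow> 'm" where
  "cobdry1 Q M act f = (\<lambda>(g, h)\<in>carrier Q \<times> carrier Q.
     act g (f h) \<otimes>\<^bsub>M\<^esub> inv\<^bsub>M\<^esub> (f (g \<otimes>\<^bsub>Q\<^esub> h)) \<otimes>\<^bsub>M\<^esub> f g)"

definition cobdry2 :: "('q, 'r) monoid_scheme \<Rightarrow> ('m, 's) monoid_scheme \<Rightarrow> ('q \<Rightarrow> 'm \<Rightarrow> 'm)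
    \<Rightarrow> ('q \<times> 'q \<Rightarrow> 'm) \<Rightarrow> 'q \<times> 'q \<times> 'q \<Rightarrow> 'm" where
  "cobdry2 Q M act f = (\<lambda>(g, h, k)\<in>carrier Q \<times> carrier Q \<times> carrier Q.
     act g (f (h, k)) \<otimes>\<^bsub>M\<^esub> inv\<^bsub>M\<^esub> (f (g \<otimes>\<^bsub>Q\<^esub> h, k))
       \<otimes>\<^bsub>M\<^esub> f (g, h \<otimes>\<^bsub>Q\<^esub> k) \<otimes>\<^bsub>M\<^esub> inv\<^bsub>M\<^esub> (f (g, h)))"

definition cobdry3 :: "('q, 'r) monoid_scheme \<Rightarrow> ('m, 's) monoid_scheme \<Rightarrow> ('q \<Rightarrow> 'm \<Rightarrow> 'm)
    \<Rightarrow> ('q \<times> 'q \<times> 'q \<Rightarrow> 'm) \<Rightarrow> 'q \<times> 'q \<times> 'q \<times> 'q \<Rightarrow> 'm" where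
  "cobdry3 Q M act f = (\<lambda>(g, h, k, l)\<in>carrier Q \<times> carrier Q \<times> carrier Q \<times> carrier Q.
     act g (f (h, k, l)) \<otimes>\<^bsub>M\<^esub> inv\<^bsub>M\<^esub> (f (g \<otimes>\<^bsub>Q\<^esub> h, k, l))
       \<otimes>\<^bsub>M\<^esub> f (g, h \<otimes>\<^bsub>Q\<^esub> k, l) \<otimes>\<^bsub>M\<^esub> inv\<^bsub>M\<^esub> (f (g, h, k \<otimes>\<^bsub>Q\<^esub> l))
       \<otimes>\<^bsub>M\<^esub> f (g, h, k))"

definition Z1 :: "('q, 'r) monoid_scheme \<Rightarrow> ('m, 's) monoid_scheme \<Rightarrow> ('q \<Rightarrow> 'm \<Rightarrow> 'm)
    \<Rightarrow> ('q \<Rightarrow> 'm) monoid" where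
  "Z1 Q M act = (C1 Q M)\<lparr>carrier := kernel (C1 Q M) (C2 Q M) (cobdry1 Q M act)\<rparr>"

definition Z2 :: "('q, 'r) monoid_scheme \<Rightarrow> ('m, 's) monoid_scheme \<Rightarrow> ('q \<Rightarrow> 'm \<Rightarrow> 'm)
    \<Rightarrow> ('q \<times> 'q \<Rightarrow> 'm) monoid" where
  "Z2 Q M act = (C2 Q M)\<lparr>carrier := kernel (C2 Q M) (C3 Q M) (cobdry2 Q M act)\<rparr>"

definition Z3 :: "('q, 'r) monoid_scheme \<Rightarrow> ('m, 's) monoid_scheme \<Rightarrow> ('q \<Rightarrow> 'm \<Rightarrow> 'm)
    \<Rightarrow> ('q \<times> 'q \<times> 'q \<Rightarrow> 'm) monoid" where
  "Z3 Q M act = (C3 Q M)\<lparr>carrier := kernel (C3 Q M) (C4 Q M) (cobdry3 Q M act)\<rparr>"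

definition B1 :: "('q, 'r) monoid_scheme \<Rightarrow> ('m, 's) monoid_scheme \<Rightarrow> ('q \<Rightarrow> 'm \<Rightarrow> 'm)
    \<Rightarrow> ('q \<Rightarrow> 'm) set" where
  "B1 Q M act = cobdry0 Q M act ` carrier M"

definition B2 :: "('q, 'r) monoid_scheme \<Rightarrow> ('m, 's) monoid_scheme \<Rightarrow> ('q \<Rightarrow> 'm \<Rightarrow> 'm)
    \<Rightarrow> ('q \<times> 'q \<Rightarrow> 'm) set" where
  "B2 Q M act = cobdry1 Q M act ` carrier (C1 Q M)"

definition B3 :: "('q, 'r) monoid_scheme \<Rightarrow> ('m, 's) monoid_scheme \<Rightarrow> ('q \<Rightarrow> 'm \<Rightarrow> 'm)
    \<Rightarrow> ('q \<times> 'q \<times> 'q \<Rightarrow> 'm) set" where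
  "B3 Q M act = cobdry2 Q M act ` carrier (C2 Q M)"

definition H1 :: "('q, 'r) monoid_scheme \<Rightarrow> ('m, 's) monoid_scheme \<Rightarrow> ('q \<Rightarrow> 'm \<Rightarrow> 'm)
    \<Rightarrow> ('q \<Rightarrow> 'm) set monoid" where
  "H1 Q M act = Z1 Q M act Mod B1 Q M act"

definition H2 :: "('q, 'r) monoid_scheme \<Rightarrow> ('m, 's) monoid_scheme \<Rightarrow> ('q \<Rightarrow> 'm \<Rightarrow> 'm)
    \<Rightarrow> ('q \<times> 'q \<Rightarrow> 'm) set monoid" where
  "H2 Q M act = Z2 Q M act Mod B2 Q M act"

definition H3 :: "('q, 'r) monoid_scheme \<Rightarrow> ('m, 's) monoid_scheme \<Rightarrow> ('q \<Rightarrow> 'm \<Rightarrow> 'm)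
    \<Rightarrow> ('q \<times> 'q \<times> 'q \<Rightarrow> 'm) set monoid" where
  "H3 Q M act = Z3 Q M act Mod B3 Q M act"

abbreviation triv_act :: "'q \<Rightarrow> 'm \<Rightarrow> 'm" where
  "triv_act \<equiv> \<lambda>_ x. x"

definition Cstar :: "complex monoid" where
  "Cstar = \<lparr>carrier = UNIV - {0}, monoid.mult = (*), one = 1\<rparr>"

text \<open>
  The map \<open>H\<^sup>2(K, \<complex>\<^sup>*) \<rightarrow> H\<^sup>2(L, \<complex>\<^sup>*)\<close> induced by a homomorphism \<open>\<phi> : L \<rightarrow> K\<close>.  A class is a
  coset of cocycles; its image is the coset spanned by the pulled-back cocycles.
\<close>

definition pullback2 :: "('l, 'r) monoid_scheme \<Rightarrow> ('l \<Rightarrow> 'k) \<Rightarrow> ('k \<times> 'k \<Rightarrow> complex)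
    \<Rightarrow> 'l \<times> 'l \<Rightarrow> complex" where
  "pullback2 L \<phi> c = (\<lambda>(x, y)\<in>carrier L \<times> carrier L. c (\<phi> x, \<phi> y))"

definition H2_map :: "('l, 'r) monoid_scheme \<Rightarrow> ('l \<Rightarrow> 'k) \<Rightarrow> ('k \<times> 'k \<Rightarrow> complex) set
    \<Rightarrow> ('l \<times> 'l \<Rightarrow> complex) set" where
  "H2_map L \<phi> W = B2 L Cstar triv_act <#>\<^bsub>Z2 L Cstar triv_act\<^esub> (pullback2 L \<phi> ` W)"

section \<open>Extensions and the modules they define\<close>

locale abelian_extension =
  A: comm_group A + G: group G + Q: group Q
  for A :: "('a, 'r) monoid_scheme" and G :: "('g, 's) monoid_scheme"
    and Q :: "('q, 't) monoid_scheme" and \<iota> :: "'a \<Rightarrow> 'g" and p :: "'g \<Rightarrow> 'q" +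
  assumes \<iota>_hom: "\<iota> \<in> hom A G"
    and p_hom: "p \<in> hom G Q"
    and \<iota>_inj: "inj_on \<iota> (carrier A)"
    and p_surj: "p ` carrier G = carrier Q"
    and exact: "kernel G Q p = \<iota> ` carrier A"

definition conj_act :: "('a, 'r) monoid_scheme \<Rightarrow> ('g, 's) monoid_scheme \<Rightarrow> ('a \<Rightarrow> 'g)
    \<Rightarrow> ('g \<Rightarrow> 'q) \<Rightarrow> 'q \<Rightarrow> 'a \<Rightarrow> 'a" where
  "conj_act A G \<iota> p q a =
     (let x = inv_into (carrier G) p q
      in inv_into (carrier A) \<iota> (x \<otimes>\<^bsub>G\<^esub> \<iota> a \<otimes>\<^bsub>G\<^esub> inv\<^bsub>G\<^esub> x))"

lemma (in abelian_extension) conj_act_eqI: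
  assumes x: "x \<in> carrier G" and a: "a \<in> carrier A" and b: "b \<in> carrier A"
    and eq: "\<iota> b = x \<otimes>\<^bsub>G\<^esub> \<iota> a \<otimes>\<^bsub>G\<^esub> inv\<^bsub>G\<^esub> x"
  shows "conj_act A G \<iota> p (p x) a = b"
proof -
  interpret i: group_hom A G \<iota> using \<iota>_hom by unfold_locales
  interpret p: group_hom G Q p using p_hom by unfold_locales
  define y where "y = inv_into (carrier G) p (p x)"
  have y: "y \<in> carrier G" "p y = p x"
    unfolding y_def using x by (auto intro: inv_into_into f_inv_into_f)
  have "inv\<^bsub>G\<^esub> x \<otimes>\<^bsub>G\<^esub> y \<in> kernel G Q p"
    using x y by (simp add: kernel_def)
  then obtain k where k: "k \<in> carrier A" "\<iota> k = inv\<^bsub>G\<^esub> x \<otimes>\<^bsub>G\<^esub> y"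
    using exact by auto
  have y_eq: "y = x \<otimes>\<^bsub>G\<^esub> \<iota> k" using k x y by (simp add: G.inv_solve_left)
  have "\<iota> k \<otimes>\<^bsub>G\<^esub> \<iota> a = \<iota> a \<otimes>\<^bsub>G\<^esub> \<iota> k"
    using k a by (metis i.hom_mult A.m_comm)
  hence "x \<otimes>\<^bsub>G\<^esub> \<iota> k \<otimes>\<^bsub>G\<^esub> \<iota> a = x \<otimes>\<^bsub>G\<^esub> \<iota> a \<otimes>\<^bsub>G\<^esub> \<iota> k"
    using k(1) x a by (simp add: G.m_assoc)
  hence "y \<otimes>\<^bsub>G\<^esub> \<iota> a \<otimes>\<^bsub>G\<^esub> inv\<^bsub>G\<^esub> y = x \<otimes>\<^bsub>G\<^esub> \<iota> a \<otimes>\<^bsub>G\<^esub> inv\<^bsub>G\<^esub> x"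
    unfolding y_eq using k(1) x a
    by (simp add: G.inv_mult_group G.m_assoc G.inv_solve_right' flip: G.m_assoc)
  thus ?thesis
    unfolding conj_act_def Let_def y_def[symmetric] eq[symmetric] using b \<iota>_inj by simp
qed

lemma (in abelian_extension) conj_act:
  assumes x: "x \<in> carrier G" and a: "a \<in> carrier A"
  shows "conj_act A G \<iota> p (p x) a \<in> carrier A"
    and "\<iota> (conj_act A G \<iota> p (p x) a) = x \<otimes>\<^bsub>G\<^esub> \<iota> a \<otimes>\<^bsub>G\<^esub> inv\<^bsub>G\<^esub> x"
proof -
  interpret i: group_hom A G \<iota> using \<iota>_hom by unfold_locales
  interpret p: group_hom G Q p using p_hom by unfold_locales
  have "\<iota> a \<in> kernel G Q p" using exact a by blast
  hence "x \<otimes>\<^bsub>G\<^esub> \<iota> a \<otimes>\<^bsub>G\<^esub> inv\<^bsub>G\<^esub> x \<in> kernel G Q p"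
    using x a by (simp add: kernel_def)
  then obtain b where b: "b \<in> carrier A" "\<iota> b = x \<otimes>\<^bsub>G\<^esub> \<iota> a \<otimes>\<^bsub>G\<^esub> inv\<^bsub>G\<^esub> x"
    using exact by auto
  show "conj_act A G \<iota> p (p x) a \<in> carrier A"
    and "\<iota> (conj_act A G \<iota> p (p x) a) = x \<otimes>\<^bsub>G\<^esub> \<iota> a \<otimes>\<^bsub>G\<^esub> inv\<^bsub>G\<^esub> x"
    using conj_act_eqI[OF x a b] b by auto
qed

text \<open>
  \<open>\<beta>\<close> is the factor set of some set-theoretic section \<open>s\<close>, that is,
  \<open>\<iota> (\<beta>(g, h)) = s(g) s(h) s(gh)\<^sup>-\<^sup>1\<close>.  The cocycles with this property make up the class in
  \<open>H\<^sup>2(Q, A)\<close> of the extension.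
\<close>

definition extension_cocycle :: "('a, 'r) monoid_scheme \<Rightarrow> ('g, 's) monoid_scheme
    \<Rightarrow> ('q, 't) monoid_scheme \<Rightarrow> ('a \<Rightarrow> 'g) \<Rightarrow> ('g \<Rightarrow> 'q) \<Rightarrow> ('q \<times> 'q \<Rightarrow> 'a) \<Rightarrow> bool" where
  "extension_cocycle A G Q \<iota> p \<beta> \<longleftrightarrow>
     \<beta> \<in> carrier (Z2 Q A (conj_act A G \<iota> p)) \<and>
     (\<exists>s. (\<forall>g\<in>carrier Q. s g \<in> carrier G \<and> p (s g) = g) \<and>
          (\<forall>g\<in>carrier Q. \<forall>h\<in>carrier Q.
             \<iota> (\<beta> (g, h)) = s g \<otimes>\<^bsub>G\<^esub> s h \<otimes>\<^bsub>G\<^esub> inv\<^bsub>G\<^esub> (s (g \<otimes>\<^bsub>Q\<^esub> h))))"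

lemma (in abelian_extension) extension_cocycle_exists:
  "\<exists>\<beta>. extension_cocycle A G Q \<iota> p \<beta>"
proof -
  interpret i: group_hom A G \<iota> using \<iota>_hom by unfold_locales
  interpret p: group_hom G Q p using p_hom by unfold_locales
  let ?act = "conj_act A G \<iota> p"
  have "\<forall>g\<in>carrier Q. \<exists>x\<in>carrier G. p x = g" using p_surj by (metis imageE)
  then obtain s where s: "\<And>g. g \<in> carrier Q \<Longrightarrow> s g \<in> carrier G" "\<And>g. g \<in> carrier Q \<Longrightarrow> p (s g) = g"
    by metis
  have "\<exists>a\<in>carrier A. \<iota> a = s g \<otimes>\<^bsub>G\<^esub> s h \<otimes>\<^bsub>G\<^esub> inv\<^bsub>G\<^esub> (s (g \<otimes>\<^bsub>Q\<^esub> h))"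
    if "g \<in> carrier Q" "h \<in> carrier Q" for g h
  proof -
    have "s g \<otimes>\<^bsub>G\<^esub> s h \<otimes>\<^bsub>G\<^esub> inv\<^bsub>G\<^esub> (s (g \<otimes>\<^bsub>Q\<^esub> h)) \<in> kernel G Q p"
      using that s by (simp add: kernel_def)
    thus ?thesis using exact by (metis imageE)
  qed
  then obtain b where b: "\<And>g h. g \<in> carrier Q \<Longrightarrow> h \<in> carrier Q \<Longrightarrow> b g h \<in> carrier A"
    "\<And>g h. g \<in> carrier Q \<Longrightarrow> h \<in> carrier Q \<Longrightarrow> \<iota> (b g h) = s g \<otimes>\<^bsub>G\<^esub> s h \<otimes>\<^bsub>G\<^esub> inv\<^bsub>G\<^esub> (s (g \<otimes>\<^bsub>Q\<^esub> h))"
    by metis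
  have act: "?act g a \<in> carrier A" "\<iota> (?act g a) = s g \<otimes>\<^bsub>G\<^esub> \<iota> a \<otimes>\<^bsub>G\<^esub> inv\<^bsub>G\<^esub> (s g)"
    if "g \<in> carrier Q" "a \<in> carrier A" for g a
    using conj_act[of "s g" a] s that by auto
  have coc: "?act g (b h k) \<otimes>\<^bsub>A\<^esub> inv\<^bsub>A\<^esub> (b (g \<otimes>\<^bsub>Q\<^esub> h) k) \<otimes>\<^bsub>A\<^esub> b g (h \<otimes>\<^bsub>Q\<^esub> k) \<otimes>\<^bsub>A\<^esub> inv\<^bsub>A\<^esub> (b g h) = \<one>\<^bsub>A\<^esub>"
    if gh: "g \<in> carrier Q" "h \<in> carrier Q" "k \<in> carrier Q" for g h k
  proof -
    note [simp] = b act s gh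
    let ?u = "?act g (b h k)" let ?v = "b (g \<otimes>\<^bsub>Q\<^esub> h) k" let ?w = "b g (h \<otimes>\<^bsub>Q\<^esub> k)" let ?z = "b g h"
    have inj: "x = y" if "\<iota> x = \<iota> y" "x \<in> carrier A" "y \<in> carrier A" for x y
      using that \<iota>_inj by (auto dest: inj_onD)
    have cancel: "inv\<^bsub>G\<^esub> x \<otimes>\<^bsub>G\<^esub> (x \<otimes>\<^bsub>G\<^esub> y) = y" if "x \<in> carrier G" "y \<in> carrier G" for x y
      using that by (simp flip: G.m_assoc)
    have "?u \<otimes>\<^bsub>A\<^esub> ?w = ?z \<otimes>\<^bsub>A\<^esub> ?v"
      by (rule inj) (simp_all add: G.m_assoc cancel Q.m_assoc)
    hence "?u \<otimes>\<^bsub>A\<^esub> ?w \<otimes>\<^bsub>A\<^esub> inv\<^bsub>A\<^esub> (?z \<otimes>\<^bsub>A\<^esub> ?v) = \<one>\<^bsub>A\<^esub>" by simp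
    moreover have "?u \<otimes>\<^bsub>A\<^esub> inv\<^bsub>A\<^esub> ?v \<otimes>\<^bsub>A\<^esub> ?w \<otimes>\<^bsub>A\<^esub> inv\<^bsub>A\<^esub> ?z = ?u \<otimes>\<^bsub>A\<^esub> ?w \<otimes>\<^bsub>A\<^esub> inv\<^bsub>A\<^esub> (?z \<otimes>\<^bsub>A\<^esub> ?v)"
      by (simp add: A.inv_mult A.m_ac)
    ultimately show ?thesis by simp
  qed
  define \<beta> where "\<beta> = (\<lambda>(g,h)\<in>carrier Q \<times> carrier Q. b g h)"
  have "\<beta> \<in> carrier (Z2 Q A ?act)"
    by (auto simp: \<beta>_def Z2_def kernel_def cochains_def cobdry2_def b coc fun_eq_iff restrict_def split: if_splits)
  moreover have "\<forall>g\<in>carrier Q. \<forall>h\<in>carrier Q.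
             \<iota> (\<beta> (g, h)) = s g \<otimes>\<^bsub>G\<^esub> s h \<otimes>\<^bsub>G\<^esub> inv\<^bsub>G\<^esub> (s (g \<otimes>\<^bsub>Q\<^esub> h))"
    by (auto simp: \<beta>_def b)
  ultimately show ?thesis unfolding extension_cocycle_def using s by blast
qed

definition dual_group :: "('a, 'r) monoid_scheme \<Rightarrow> ('a \<Rightarrow> complex) monoid" where
  "dual_group A = (product_group (carrier A) (\<lambda>_. Cstar))
     \<lparr>carrier := hom A Cstar \<inter> extensional (carrier A)\<rparr>"

definition dual_act :: "('q, 't) monoid_scheme \<Rightarrow> ('a, 'r) monoid_scheme \<Rightarrow> ('q \<Rightarrow> 'a \<Rightarrow> 'a)
    \<Rightarrow> 'q \<Rightarrow> ('a \<Rightarrow> complex) \<Rightarrow> 'a \<Rightarrow> complex" where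
  "dual_act Q A act g \<chi> = (\<lambda>a\<in>carrier A. \<chi> (act (inv\<^bsub>Q\<^esub> g) a))"

section \<open>Bijective classes and the cup product\<close>

definition bijective_class :: "('q, 't) monoid_scheme \<Rightarrow> ('m, 'r) monoid_scheme
    \<Rightarrow> ('q \<Rightarrow> 'm) set \<Rightarrow> bool" where
  "bijective_class Q M P \<longleftrightarrow> (\<exists>\<pi>\<in>P. bij_betw \<pi> (carrier Q) (carrier M))"

definition cup_cochain :: "('q, 't) monoid_scheme \<Rightarrow> ('q \<Rightarrow> 'a \<Rightarrow> 'a) \<Rightarrow> ('q \<times> 'q \<Rightarrow> 'a)
    \<Rightarrow> ('q \<Rightarrow> 'a \<Rightarrow> complex) \<Rightarrow> 'q \<times> 'q \<times> 'q \<Rightarrow> complex" where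
  "cup_cochain Q act \<beta> \<pi> =
     (\<lambda>(g, h, k)\<in>carrier Q \<times> carrier Q \<times> carrier Q. \<pi> g (act g (\<beta> (h, k))))"

definition cup_class :: "('q, 't) monoid_scheme \<Rightarrow> ('q \<Rightarrow> 'a \<Rightarrow> 'a) \<Rightarrow> ('q \<times> 'q \<Rightarrow> 'a) set
    \<Rightarrow> ('q \<Rightarrow> 'a \<Rightarrow> complex) set \<Rightarrow> ('q \<times> 'q \<times> 'q \<Rightarrow> complex) set" where
  "cup_class Q act W P = B3 Q Cstar triv_act <#>\<^bsub>Z3 Q Cstar triv_act\<^esub>
     {cup_cochain Q act \<beta> \<pi> | \<beta> \<pi>. \<beta> \<in> W \<and> \<pi> \<in> P}"

section \<open>Twisted group algebras and non-degenerate classes\<close>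

text \<open>
  The function \<open>u\<close> stands for \<open>\<Sum>\<sigma>. u(\<sigma>) U\<^sub>\<sigma>\<close>.  Since \<open>c\<close> need not be normalized, the unit is
  \<open>c(1, 1)\<^sup>-\<^sup>1 U\<^sub>1\<close>.  The group is meant to be finite.
\<close>

definition twisted_group_algebra :: "('g, 's) monoid_scheme \<Rightarrow> ('g \<times> 'g \<Rightarrow> complex)
    \<Rightarrow> (complex, 'g \<Rightarrow> complex) module" where
  "twisted_group_algebra G c =
     \<lparr>carrier = carrier G \<rightarrow>\<^sub>E UNIV,
      monoid.mult = (\<lambda>u v. \<lambda>\<tau>\<in>carrier G.
        \<Sum>(\<sigma>, \<gamma>) | \<sigma> \<in> carrier G \<and> \<gamma> \<in> carrier G \<and> \<sigma> \<otimes>\<^bsub>G\<^esub> \<gamma> = \<tau>. u \<sigma> * v \<gamma> * c (\<sigma>, \<gamma>)),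
      one = (\<lambda>\<tau>\<in>carrier G. if \<tau> = \<one>\<^bsub>G\<^esub> then inverse (c (\<one>\<^bsub>G\<^esub>, \<one>\<^bsub>G\<^esub>)) else 0),
      zero = (\<lambda>\<tau>\<in>carrier G. 0),
      add = (\<lambda>u v. \<lambda>\<tau>\<in>carrier G. u \<tau> + v \<tau>),
      smult = (\<lambda>a u. \<lambda>\<tau>\<in>carrier G. a * u \<tau>)\<rparr>"

definition basis_elem :: "('g, 's) monoid_scheme \<Rightarrow> 'g \<Rightarrow> 'g \<Rightarrow> complex" where
  "basis_elem G \<sigma> = (\<lambda>\<tau>\<in>carrier G. if \<tau> = \<sigma> then 1 else 0)"

lemma (in group) basis_elem_mult:
  assumes fin: "finite (carrier G)" and "\<sigma> \<in> carrier G" "\<gamma> \<in> carrier G"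
  shows "basis_elem G \<sigma> \<otimes>\<^bsub>twisted_group_algebra G c\<^esub> basis_elem G \<gamma>
       = c (\<sigma>, \<gamma>) \<odot>\<^bsub>twisted_group_algebra G c\<^esub> basis_elem G (\<sigma> \<otimes> \<gamma>)"
proof -
  have "(\<Sum>(s, t) | s \<in> carrier G \<and> t \<in> carrier G \<and> s \<otimes> t = \<tau>.
           basis_elem G \<sigma> s * basis_elem G \<gamma> t * c (s, t))
       = (if \<tau> = \<sigma> \<otimes> \<gamma> then c (\<sigma>, \<gamma>) else 0)" (is "?S = _") for \<tau>
  proof -
    let ?I = "{(s, t). s \<in> carrier G \<and> t \<in> carrier G \<and> s \<otimes> t = \<tau>}"
    have "finite ?I" by (rule finite_subset[of _ "carrier G \<times> carrier G"]) (auto simp: fin)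
    hence "?S = (\<Sum>x\<in>?I. if x = (\<sigma>, \<gamma>) then c (\<sigma>, \<gamma>) else 0)"
      by (intro sum.cong) (auto simp: basis_elem_def assms split: if_splits)
    also have "\<dots> = (if \<tau> = \<sigma> \<otimes> \<gamma> then c (\<sigma>, \<gamma>) else 0)"
      using \<open>finite ?I\<close> assms by (auto simp: sum.delta)
    finally show ?thesis .
  qed
  thus ?thesis
    by (auto simp: twisted_group_algebra_def basis_elem_def restrict_def fun_eq_iff)
qed

definition nondegenerate_cocycle :: "('g, 's) monoid_scheme \<Rightarrow> ('g \<times> 'g \<Rightarrow> complex) \<Rightarrow> bool" where
  "nondegenerate_cocycle G c \<longleftrightarrow>
     (\<exists>n F. n * n = order G \<and>
        F \<in> ring_iso (twisted_group_algebra G c) (module_mat TYPE(complex) n n) \<and>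
        (\<forall>a. \<forall>u\<in>carrier (twisted_group_algebra G c).
           F (a \<odot>\<^bsub>twisted_group_algebra G c\<^esub> u) = a \<odot>\<^bsub>module_mat TYPE(complex) n n\<^esub> F u))"

definition nondegenerate_class :: "('g, 's) monoid_scheme \<Rightarrow> ('g \<times> 'g \<Rightarrow> complex) set \<Rightarrow> bool" where
  "nondegenerate_class G W \<longleftrightarrow> (\<exists>c\<in>W. nondegenerate_cocycle G c)"

definition ker_res :: "('a, 'r) monoid_scheme \<Rightarrow> ('g, 's) monoid_scheme \<Rightarrow> ('a \<Rightarrow> 'g)
    \<Rightarrow> ('g \<times> 'g \<Rightarrow> complex) set set" where
  "ker_res A G \<iota> = kernel (H2 G Cstar triv_act) (H2 A Cstar triv_act) (H2_map A \<iota>)"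

definition im_inf :: "('g, 's) monoid_scheme \<Rightarrow> ('q, 't) monoid_scheme \<Rightarrow> ('g \<Rightarrow> 'q)
    \<Rightarrow> ('g \<times> 'g \<Rightarrow> complex) set set" where
  "im_inf G Q p = H2_map G p ` carrier (H2 Q Cstar triv_act)"

definition ker_res_mod_im_inf :: "('a, 'r) monoid_scheme \<Rightarrow> ('g, 's) monoid_scheme
    \<Rightarrow> ('q, 't) monoid_scheme \<Rightarrow> ('a \<Rightarrow> 'g) \<Rightarrow> ('g \<Rightarrow> 'q)
    \<Rightarrow> ('g \<times> 'g \<Rightarrow> complex) set set monoid" where
  "ker_res_mod_im_inf A G Q \<iota> p =
     ((H2 G Cstar triv_act)\<lparr>carrier := ker_res A G \<iota>\<rparr>) Mod im_inf G Q p"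

definition nondegenerate_element :: "('g, 's) monoid_scheme
    \<Rightarrow> ('g \<times> 'g \<Rightarrow> complex) set set \<Rightarrow> bool" where
  "nondegenerate_element G Y \<longleftrightarrow> (\<exists>W\<in>Y. nondegenerate_class G W)"

end

theory Submission
  imports Defs "Jordan_Normal_Form.Determinant"
begin

text \<open>
  Let \<open>c\<close> be a cocycle on \<open>G\<close> whose restriction to \<open>A\<close> is a coboundary, and rescale the basis
  elements \<open>U\<^sub>a\<close>, \<open>a \<in> A\<close>, so that they multiply without a factor.  Then \<open>U\<^sub>x U\<^sub>a U\<^sub>x\<^sup>-\<^sup>1\<close> is a multiple
  of the element attached to \<open>x a x\<^sup>-\<^sup>1\<close>, and the factor, as a function of \<open>x a x\<^sup>-\<^sup>1\<close>, is a character of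
  \<open>A\<close> that depends on \<open>x\<close> only modulo \<open>A\<close>.  This gives a 1-cocycle \<open>\<pi>\<close> on \<open>Q\<close>.  Rescaling all
  \<open>U\<^sub>x\<close> along the cosets of \<open>A\<close> makes \<open>c\<close> invariant under \<open>A\<close> on the left and equivariant with factor
  \<open>\<pi>\<close> on the right; from this form one reads off that \<open>c\<close> is determined by \<open>\<pi>\<close> up to inflation
  from \<open>Q\<close>, and that associativity at lifts of elements of \<open>Q\<close> says precisely that \<open>\<beta> \<union> \<pi>\<close> is a
  coboundary.

  For non-degeneracy, induce the one-dimensional module of the subalgebra spanned by the \<open>U\<^sub>a\<close> to the
  whole twisted group algebra.  The induced module has a basis indexed by \<open>Q\<close>, which \<open>A\<close> scales by
  the characters \<open>\<pi>(g)\<^sup>-\<^sup>1\<close> (up to \<open>\<chi>\<close>) and \<open>G\<close> permutes transitively up to scalars.  As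
  \<open>|G| = |Q|\<^sup>2\<close> and matrix algebras are simple, the algebra is a matrix algebra iff this module is
  faithful, iff the square matrix \<open>(\<pi>(g)(a)\<^sup>-\<^sup>1)\<close> is invertible, iff \<open>\<pi>\<close> is a bijection onto the
  characters of \<open>A\<close>.
\<close>

text \<open>Both names would otherwise shadow the constants of HOL-Algebra.\<close>

hide_const (open) Polynomial.order Ring_Hom.ring_hom

section \<open>Cochains with values in the multiplicative group\<close>

lemma Cstar_simps [simp]:
  "x \<in> carrier Cstar \<longleftrightarrow> x \<noteq> 0" "x \<otimes>\<^bsub>Cstar\<^esub> y = x * y" "\<one>\<^bsub>Cstar\<^esub> = 1"
  by (auto simp: Cstar_def)

lemma comm_group_Cstar: "comm_group Cstar"
proof (rule comm_groupI)
  fix x assume "x \<in> carrier Cstar"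
  then show "\<exists>y\<in>carrier Cstar. y \<otimes>\<^bsub>Cstar\<^esub> x = \<one>\<^bsub>Cstar\<^esub>"
    by (intro bexI[of _ "inverse x"]) auto
qed auto

interpretation Cstar: comm_group Cstar
  by (rule comm_group_Cstar)

lemma inv_Cstar [simp]: "x \<noteq> 0 \<Longrightarrow> inv\<^bsub>Cstar\<^esub> x = inverse x"
  by (rule Cstar.inv_equality) auto

lemma comm_group_cochains:
  assumes "comm_group M"
  shows "comm_group (cochains S M)"
proof -
  interpret M: comm_group M by fact
  interpret C: group "cochains S M"
    unfolding cochains_def by (rule product_group) (rule M.is_group)
  show ?thesis
    by (rule C.group_comm_groupI) (auto simp: cochains_def M.m_comm PiE_def Pi_def)
qed

text \<open>Clearing the two inverses in \<open>cobdry2\<close> gives the two-against-two form of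
  the cocycle identity. Cross-multiplying is legitimate because the values are nonzero, so the
  equivalence is first proved under \<open>?N\<close>.\<close>

lemma Z2_Cstar_iff:
  assumes "group L"
  shows "c \<in> carrier (Z2 L Cstar triv_act) \<longleftrightarrow>
    c \<in> extensional (carrier L \<times> carrier L) \<and>
    (\<forall>x\<in>carrier L. \<forall>y\<in>carrier L. c (x, y) \<noteq> 0) \<and>
    (\<forall>x\<in>carrier L. \<forall>y\<in>carrier L. \<forall>z\<in>carrier L.
       c (x, y) * c (x \<otimes>\<^bsub>L\<^esub> y, z) = c (x, y \<otimes>\<^bsub>L\<^esub> z) * c (y, z))"
    (is "_ \<longleftrightarrow> ?E \<and> ?N \<and> ?C")
proof -
  interpret L: group L by fact
  have "?C \<longleftrightarrow> cobdry2 L Cstar triv_act c = \<one>\<^bsub>C3 L Cstar\<^esub>" if ?N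
    unfolding cobdry2_def cochains_def using that
    by (auto simp: fun_eq_iff restrict_def field_simps)
  then show ?thesis
    by (auto simp: Z2_def kernel_def cochains_def PiE_def Pi_def)
qed

text \<open>Restricting a cochain to the carrier does not change its coboundary, so the potential
  \<open>f\<close> may be any function that is nonzero on the carrier. Later constructions can then
  use plain lambda terms.\<close>

lemma B2_Cstar_iff:
  assumes "group L"
  shows "b \<in> B2 L Cstar triv_act \<longleftrightarrow> (\<exists>f. (\<forall>x\<in>carrier L. f x \<noteq> 0) \<and>
    b = (\<lambda>(x, y)\<in>carrier L \<times> carrier L. f x * f y / f (x \<otimes>\<^bsub>L\<^esub> y)))"
proof -
  interpret L: group L by fact
  have *: "cobdry1 L Cstar triv_act f = (\<lambda>(x, y)\<in>carrier L \<times> carrier L. f x * f y / f (x \<otimes>\<^bsub>L\<^esub> y))"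
    if "\<forall>x\<in>carrier L. f x \<noteq> 0" for f
    using that by (auto simp: cobdry1_def fun_eq_iff restrict_def field_simps)
  show ?thesis
  proof
    assume "b \<in> B2 L Cstar triv_act"
    then show "\<exists>f. (\<forall>x\<in>carrier L. f x \<noteq> 0) \<and>
      b = (\<lambda>(x, y)\<in>carrier L \<times> carrier L. f x * f y / f (x \<otimes>\<^bsub>L\<^esub> y))"
      using * by (auto simp: B2_def cochains_def PiE_def Pi_def)
  next
    assume "\<exists>f. (\<forall>x\<in>carrier L. f x \<noteq> 0) \<and>
      b = (\<lambda>(x, y)\<in>carrier L \<times> carrier L. f x * f y / f (x \<otimes>\<^bsub>L\<^esub> y))"
    then obtain f where f: "\<forall>x\<in>carrier L. f x \<noteq> 0"
      "b = (\<lambda>(x, y)\<in>carrier L \<times> carrier L. f x * f y / f (x \<otimes>\<^bsub>L\<^esub> y))" by blast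
    have "cobdry1 L Cstar triv_act (restrict f (carrier L)) = b"
      using f by (subst *) (auto simp: fun_eq_iff restrict_def)
    moreover have "restrict f (carrier L) \<in> carrier (C1 L Cstar)"
      using f by (auto simp: cochains_def)
    ultimately show "b \<in> B2 L Cstar triv_act" unfolding B2_def by blast
  qed
qed

lemma B3_Cstar_iff:
  assumes "group L"
  shows "b \<in> B3 L Cstar triv_act \<longleftrightarrow>
    (\<exists>\<omega>. (\<forall>x\<in>carrier L. \<forall>y\<in>carrier L. \<omega> x y \<noteq> 0) \<and>
    b = (\<lambda>(x, y, z)\<in>carrier L \<times> carrier L \<times> carrier L.
           \<omega> x (y \<otimes>\<^bsub>L\<^esub> z) * \<omega> y z / (\<omega> x y * \<omega> (x \<otimes>\<^bsub>L\<^esub> y) z)))"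
proof -
  interpret L: group L by fact
  have *: "cobdry2 L Cstar triv_act f = (\<lambda>(x, y, z)\<in>carrier L \<times> carrier L \<times> carrier L.
           f (x, y \<otimes>\<^bsub>L\<^esub> z) * f (y, z) / (f (x, y) * f (x \<otimes>\<^bsub>L\<^esub> y, z)))"
    if "\<forall>x\<in>carrier L. \<forall>y\<in>carrier L. f (x, y) \<noteq> 0" for f
    using that by (auto simp: cobdry2_def fun_eq_iff restrict_def field_simps)
  show ?thesis
  proof
    assume "b \<in> B3 L Cstar triv_act"
    then obtain f where f: "f \<in> carrier (C2 L Cstar)" "b = cobdry2 L Cstar triv_act f"
      by (auto simp: B3_def)
    then show "\<exists>\<omega>. (\<forall>x\<in>carrier L. \<forall>y\<in>carrier L. \<omega> x y \<noteq> 0) \<and>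
    b = (\<lambda>(x, y, z)\<in>carrier L \<times> carrier L \<times> carrier L.
           \<omega> x (y \<otimes>\<^bsub>L\<^esub> z) * \<omega> y z / (\<omega> x y * \<omega> (x \<otimes>\<^bsub>L\<^esub> y) z))"
      by (intro exI[of _ "\<lambda>x y. f (x, y)"]) (auto simp: * cochains_def PiE_def Pi_def)
  next
    assume "\<exists>\<omega>. (\<forall>x\<in>carrier L. \<forall>y\<in>carrier L. \<omega> x y \<noteq> 0) \<and>
    b = (\<lambda>(x, y, z)\<in>carrier L \<times> carrier L \<times> carrier L.
           \<omega> x (y \<otimes>\<^bsub>L\<^esub> z) * \<omega> y z / (\<omega> x y * \<omega> (x \<otimes>\<^bsub>L\<^esub> y) z))"
    then obtain \<omega> where f: "\<forall>x\<in>carrier L. \<forall>y\<in>carrier L. \<omega> x y \<noteq> 0"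
      "b = (\<lambda>(x, y, z)\<in>carrier L \<times> carrier L \<times> carrier L.
           \<omega> x (y \<otimes>\<^bsub>L\<^esub> z) * \<omega> y z / (\<omega> x y * \<omega> (x \<otimes>\<^bsub>L\<^esub> y) z))" by blast
    let ?f = "\<lambda>(x, y)\<in>carrier L \<times> carrier L. \<omega> x y"
    have "cobdry2 L Cstar triv_act ?f = b"
      using f by (subst *) (auto simp: fun_eq_iff restrict_def)
    moreover have "?f \<in> carrier (C2 L Cstar)"
      using f by (auto simp: cochains_def)
    ultimately show "b \<in> B3 L Cstar triv_act" unfolding B3_def by blast
  qed
qed

section \<open>The group of 2-cocycles and its subgroup of coboundaries\<close>

lemma Z2_mult [simp]:
  "c \<otimes>\<^bsub>Z2 L Cstar act\<^esub> d = (\<lambda>x\<in>carrier L \<times> carrier L. c x * d x)"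
  by (simp add: Z2_def cochains_def)

lemma comm_group_Z2:
  assumes "group L"
  shows "comm_group (Z2 L Cstar triv_act)"
proof -
  interpret L: group L by fact
  interpret C: comm_group "C2 L Cstar" by (rule comm_group_cochains) (rule comm_group_Cstar)
  have car: "carrier (Z2 L Cstar triv_act) \<subseteq> carrier (C2 L Cstar)"
    by (auto simp: Z2_def kernel_def)
  have "subgroup (carrier (Z2 L Cstar triv_act)) (C2 L Cstar)"
  proof
    show "carrier (Z2 L Cstar triv_act) \<subseteq> carrier (C2 L Cstar)" by (rule car)
    show "\<one>\<^bsub>C2 L Cstar\<^esub> \<in> carrier (Z2 L Cstar triv_act)"
      by (simp add: Z2_Cstar_iff[OF assms] cochains_def)
    fix c assume c: "c \<in> carrier (Z2 L Cstar triv_act)"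
    have *: "inv\<^bsub>C2 L Cstar\<^esub> c = (\<lambda>x\<in>carrier L \<times> carrier L. inverse (c x))"
      using subsetD[OF car c] unfolding cochains_def
      by (subst inv_product_group) (auto simp: Cstar.is_group fun_eq_iff restrict_def PiE_def Pi_def)
    show "inv\<^bsub>C2 L Cstar\<^esub> c \<in> carrier (Z2 L Cstar triv_act)"
      using c unfolding * Z2_Cstar_iff[OF assms]
      by (auto simp flip: inverse_mult_distrib)
    fix d assume d: "d \<in> carrier (Z2 L Cstar triv_act)"
    show "c \<otimes>\<^bsub>C2 L Cstar\<^esub> d \<in> carrier (Z2 L Cstar triv_act)"
      using c d unfolding Z2_Cstar_iff[OF assms]
      by (auto simp: cochains_def mult.commute mult.left_commute)
  qed
  then have "group (Z2 L Cstar triv_act)"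
    using C.subgroup_imp_group by (simp add: Z2_def)
  then show ?thesis
    by (rule group.group_comm_groupI) (auto simp: mult.commute)
qed

lemma B2_subgroup_Z2:
  assumes "group L"
  shows "subgroup (B2 L Cstar triv_act) (Z2 L Cstar triv_act)"
proof -
  interpret L: group L by fact
  interpret Z: comm_group "Z2 L Cstar triv_act" by (rule comm_group_Z2) fact
  have sub: "B2 L Cstar triv_act \<subseteq> carrier (Z2 L Cstar triv_act)"
    by (auto simp: B2_Cstar_iff[OF assms] Z2_Cstar_iff[OF assms] L.m_assoc field_simps)
  have one: "\<one>\<^bsub>Z2 L Cstar triv_act\<^esub> = (\<lambda>x\<in>carrier L \<times> carrier L. 1)"
    by (auto simp: Z2_def cochains_def)
  show ?thesis
  proof (rule Z.subgroupI[OF sub])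
    have "(\<lambda>x\<in>carrier L \<times> carrier L. 1) \<in> B2 L Cstar triv_act"
      unfolding B2_Cstar_iff[OF assms] by (intro exI[of _ "\<lambda>_. 1"]) (auto simp: fun_eq_iff restrict_def)
    then show "B2 L Cstar triv_act \<noteq> {}" by blast
    fix b assume b: "b \<in> B2 L Cstar triv_act"
    then obtain f where f: "\<And>x. x \<in> carrier L \<Longrightarrow> f x \<noteq> 0"
      "b = (\<lambda>(x, y)\<in>carrier L \<times> carrier L. f x * f y / f (x \<otimes>\<^bsub>L\<^esub> y))"
      unfolding B2_Cstar_iff[OF assms] by blast
    \<comment> \<open>This is the coboundary of \<open>1 / f\<close>, the candidate for the inverse
      of \<open>b\<close>.\<close>
    have 1: "(\<lambda>(x, y)\<in>carrier L \<times> carrier L. f (x \<otimes>\<^bsub>L\<^esub> y) / (f x * f y)) \<in> B2 L Cstar triv_act"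
      unfolding B2_Cstar_iff[OF assms]
      by (intro exI[of _ "\<lambda>x. inverse (f x)"]) (auto simp: f fun_eq_iff restrict_def divide_simps)
    have "inv\<^bsub>Z2 L Cstar triv_act\<^esub> b = (\<lambda>(x, y)\<in>carrier L \<times> carrier L. f (x \<otimes>\<^bsub>L\<^esub> y) / (f x * f y))"
    proof (rule Z.inv_equality)
      show "(\<lambda>(x, y)\<in>carrier L \<times> carrier L. f (x \<otimes>\<^bsub>L\<^esub> y) / (f x * f y)) \<otimes>\<^bsub>Z2 L Cstar triv_act\<^esub> b
        = \<one>\<^bsub>Z2 L Cstar triv_act\<^esub>"
        unfolding one f(2) by (auto simp: fun_eq_iff restrict_def f)
    qed (use sub b 1 in auto)
    with 1 show "inv\<^bsub>Z2 L Cstar triv_act\<^esub> b \<in> B2 L Cstar triv_act" by simp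
    fix b' assume b': "b' \<in> B2 L Cstar triv_act"
    then obtain f' where f': "\<And>x. x \<in> carrier L \<Longrightarrow> f' x \<noteq> 0"
      "b' = (\<lambda>(x, y)\<in>carrier L \<times> carrier L. f' x * f' y / f' (x \<otimes>\<^bsub>L\<^esub> y))"
      unfolding B2_Cstar_iff[OF assms] by blast
    show "b \<otimes>\<^bsub>Z2 L Cstar triv_act\<^esub> b' \<in> B2 L Cstar triv_act"
      unfolding B2_Cstar_iff[OF assms] f f'
      by (intro exI[of _ "\<lambda>x. f x * f' x"]) (auto simp: f(1) f'(1) fun_eq_iff restrict_def)
  qed
qed

section \<open>Pullback of 2-cocycles along a homomorphism\<close>

lemma pullback2_Z2:
  assumes "group L" "group K" "\<phi> \<in> hom L K" "z \<in> carrier (Z2 K Cstar triv_act)"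
  shows "pullback2 L \<phi> z \<in> carrier (Z2 L Cstar triv_act)"
proof -
  interpret \<phi>: group_hom L K \<phi> using assms by (simp add: group_hom_def group_hom_axioms_def)
  show ?thesis using assms(4)
    by (simp add: Z2_Cstar_iff[OF assms(1)] Z2_Cstar_iff[OF assms(2)] pullback2_def)
qed

lemma pullback2_B2:
  assumes "group L" "group K" "\<phi> \<in> hom L K" "b \<in> B2 K Cstar triv_act"
  shows "pullback2 L \<phi> b \<in> B2 L Cstar triv_act"
proof -
  interpret \<phi>: group_hom L K \<phi> using assms by (simp add: group_hom_def group_hom_axioms_def)
  obtain f where f: "\<And>x. x \<in> carrier K \<Longrightarrow> f x \<noteq> 0"
    "b = (\<lambda>(x, y)\<in>carrier K \<times> carrier K. f x * f y / f (x \<otimes>\<^bsub>K\<^esub> y))"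
    using assms(4) unfolding B2_Cstar_iff[OF assms(2)] by blast
  have "pullback2 L \<phi> b = (\<lambda>(x, y)\<in>carrier L \<times> carrier L. f (\<phi> x) * f (\<phi> y) / f (\<phi> (x \<otimes>\<^bsub>L\<^esub> y)))"
    unfolding pullback2_def f(2) by (rule restrict_ext) auto
  then show ?thesis
    unfolding B2_Cstar_iff[OF assms(1)] using f(1)
    by (intro exI[of _ "\<lambda>x. f (\<phi> x)"]) simp
qed

text \<open>Pullback is multiplicative and carries coboundaries to coboundaries, so the pulled-back
  coset lies in a single coset, and multiplying by all of \<open>B2 L\<close> fills that coset.
  Hence \<open>H2_map\<close> can be computed on representatives.\<close>

lemma H2_map_coset:
  assumes "group L" "group K" "\<phi> \<in> hom L K" "z \<in> carrier (Z2 K Cstar triv_act)"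
  shows "H2_map L \<phi> (B2 K Cstar triv_act #>\<^bsub>Z2 K Cstar triv_act\<^esub> z)
    = B2 L Cstar triv_act #>\<^bsub>Z2 L Cstar triv_act\<^esub> pullback2 L \<phi> z"
proof -
  interpret \<phi>: group_hom L K \<phi> using assms by (simp add: group_hom_def group_hom_axioms_def)
  interpret Z: comm_group "Z2 L Cstar triv_act" by (rule comm_group_Z2) fact
  interpret B: subgroup "B2 L Cstar triv_act" "Z2 L Cstar triv_act" by (rule B2_subgroup_Z2) fact
  interpret ZK: comm_group "Z2 K Cstar triv_act" by (rule comm_group_Z2) fact
  interpret BK: subgroup "B2 K Cstar triv_act" "Z2 K Cstar triv_act" by (rule B2_subgroup_Z2) fact
  let ?p = "pullback2 L \<phi>"
  have pz: "?p z \<in> carrier (Z2 L Cstar triv_act)" by (rule pullback2_Z2) fact+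
  have 1: "?p z \<in> ?p ` (B2 K Cstar triv_act #>\<^bsub>Z2 K Cstar triv_act\<^esub> z)"
    using ZK.rcos_self[OF assms(4) B2_subgroup_Z2[OF assms(2)]] by blast
  have "?p b \<in> B2 L Cstar triv_act" if "b \<in> B2 K Cstar triv_act" for b
    by (rule pullback2_B2[OF assms(1-3) that])
  moreover have "?p (b \<otimes>\<^bsub>Z2 K Cstar triv_act\<^esub> z) = ?p b \<otimes>\<^bsub>Z2 L Cstar triv_act\<^esub> ?p z" for b
    by (auto simp: pullback2_def fun_eq_iff restrict_def)
  ultimately have 2: "?p ` (B2 K Cstar triv_act #>\<^bsub>Z2 K Cstar triv_act\<^esub> z)
      \<subseteq> B2 L Cstar triv_act #>\<^bsub>Z2 L Cstar triv_act\<^esub> ?p z"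
    unfolding r_coset_def by (auto simp del: Z2_mult)
  have 3: "b \<otimes>\<^bsub>Z2 L Cstar triv_act\<^esub> w \<in> B2 L Cstar triv_act #>\<^bsub>Z2 L Cstar triv_act\<^esub> ?p z"
    if b: "b \<in> B2 L Cstar triv_act" and w: "w \<in> B2 L Cstar triv_act #>\<^bsub>Z2 L Cstar triv_act\<^esub> ?p z" for b w
  proof -
    obtain b' where "b' \<in> B2 L Cstar triv_act" "w = b' \<otimes>\<^bsub>Z2 L Cstar triv_act\<^esub> ?p z"
      using w unfolding r_coset_def by blast
    then have "b \<otimes>\<^bsub>Z2 L Cstar triv_act\<^esub> w = (b \<otimes>\<^bsub>Z2 L Cstar triv_act\<^esub> b') \<otimes>\<^bsub>Z2 L Cstar triv_act\<^esub> ?p z"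
      using b pz by (simp only: Z.m_assoc B.mem_carrier)
    then show ?thesis
      using B.m_closed[OF b \<open>b' \<in> _\<close>] unfolding r_coset_def by (auto simp del: Z2_mult)
  qed
  show ?thesis
    unfolding H2_map_def
  proof
    show "B2 L Cstar triv_act <#>\<^bsub>Z2 L Cstar triv_act\<^esub> ?p ` (B2 K Cstar triv_act #>\<^bsub>Z2 K Cstar triv_act\<^esub> z)
      \<subseteq> B2 L Cstar triv_act #>\<^bsub>Z2 L Cstar triv_act\<^esub> ?p z"
      using 2 3 unfolding set_mult_def by (auto simp del: Z2_mult)
    show "B2 L Cstar triv_act #>\<^bsub>Z2 L Cstar triv_act\<^esub> ?p z
      \<subseteq> B2 L Cstar triv_act <#>\<^bsub>Z2 L Cstar triv_act\<^esub> ?p ` (B2 K Cstar triv_act #>\<^bsub>Z2 K Cstar triv_act\<^esub> z)"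
      using 1 unfolding set_mult_def r_coset_def[of "Z2 L Cstar triv_act"] by blast
  qed
qed

lemma carrier_H2: "carrier (H2 L Cstar triv_act)
    = {B2 L Cstar triv_act #>\<^bsub>Z2 L Cstar triv_act\<^esub> c | c. c \<in> carrier (Z2 L Cstar triv_act)}"
  by (auto simp: H2_def FactGroup_def RCOSETS_def)

section \<open>The character group\<close>

lemma mem_dual_group:
  "\<chi> \<in> carrier (dual_group A) \<longleftrightarrow> \<chi> \<in> extensional (carrier A) \<and> (\<forall>a\<in>carrier A. \<chi> a \<noteq> 0) \<and>
    (\<forall>a\<in>carrier A. \<forall>b\<in>carrier A. \<chi> (a \<otimes>\<^bsub>A\<^esub> b) = \<chi> a * \<chi> b)"
  by (auto simp: dual_group_def hom_def)

lemma dual_group_mult: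
  "\<chi> \<otimes>\<^bsub>dual_group A\<^esub> \<psi> = (\<lambda>a\<in>carrier A. \<chi> a * \<psi> a)"
  by (simp add: dual_group_def)

lemma dual_group_one: "\<one>\<^bsub>dual_group A\<^esub> = (\<lambda>a\<in>carrier A. 1)"
  by (simp add: dual_group_def)

text \<open>The inverse in \<open>dual_group\<close> is sought among characters only, so besides the
  two products one checks that the pointwise inverse is again a character.\<close>

lemma dual_group_inv:
  assumes "group A" "\<chi> \<in> carrier (dual_group A)"
  shows "inv\<^bsub>dual_group A\<^esub> \<chi> = (\<lambda>a\<in>carrier A. inverse (\<chi> a))"
proof -
  interpret A: group A by fact
  have mon: "Group.monoid (dual_group A)"
    by unfold_locales (auto simp: mem_dual_group dual_group_mult dual_group_one fun_eq_iff restrict_def extensional_def)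
  show ?thesis
    by (rule monoid.inv_char[OF mon])
       (use assms in \<open>auto simp: mem_dual_group dual_group_mult dual_group_one fun_eq_iff\<close>)
qed

section \<open>The module structure given by an extension\<close>

context abelian_extension
begin

abbreviation qact (infixr "\<triangleright>" 75) where "g \<triangleright> a \<equiv> conj_act A G \<iota> p g a"
abbreviation gmult (infixl "\<odot>" 70) where "x \<odot> y \<equiv> x \<otimes>\<^bsub>G\<^esub> y"
abbreviation qmult (infixl "\<cdot>" 70) where "g \<cdot> h \<equiv> g \<otimes>\<^bsub>Q\<^esub> h"
abbreviation amult (infixl "\<oplus>" 70) where "a \<oplus> b \<equiv> a \<otimes>\<^bsub>A\<^esub> b"

sublocale i: group_hom A G \<iota> using \<iota>_hom by unfold_locales
sublocale p: group_hom G Q p using p_hom by unfold_locales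

lemma p_\<iota> [simp]: "a \<in> carrier A \<Longrightarrow> p (\<iota> a) = \<one>\<^bsub>Q\<^esub>"
  using exact by (auto simp: kernel_def)

lemma p_surjE:
  assumes "g \<in> carrier Q"
  obtains x where "x \<in> carrier G" "p x = g"
  using assms p_surj by (metis imageE)

lemma act_closed [simp]: "g \<in> carrier Q \<Longrightarrow> a \<in> carrier A \<Longrightarrow> g \<triangleright> a \<in> carrier A"
  by (elim p_surjE) (auto dest: conj_act)

text \<open>The definition of the action, freed of inverses: moving an element of A leftwards past
  \<open>x\<close> replaces it by its conjugate. All later computations in G use this form.\<close>

lemma act_comm: "x \<in> carrier G \<Longrightarrow> a \<in> carrier A \<Longrightarrow> \<iota> (p x \<triangleright> a) \<odot> x = x \<odot> \<iota> a"
  by (simp add: conj_act G.m_assoc)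

text \<open>The commutation rule determines the action, so the module axioms below follow by lifting
  elements of Q to G and moving factors past each other.\<close>

lemma act_eqI:
  assumes "x \<in> carrier G" "a \<in> carrier A" "b \<in> carrier A" "\<iota> b \<odot> x = x \<odot> \<iota> a"
  shows "p x \<triangleright> a = b"
  using assms by (intro conj_act_eqI) (simp_all add: G.inv_solve_right)

lemma act_mult [simp]:
  assumes g: "g \<in> carrier Q" and [simp]: "a \<in> carrier A" "b \<in> carrier A"
  shows "g \<triangleright> (a \<oplus> b) = (g \<triangleright> a) \<oplus> (g \<triangleright> b)"
proof -
  obtain x where x [simp]: "x \<in> carrier G" and g [simp]: "p x = g" using g by (rule p_surjE)
  have "p x \<triangleright> (a \<oplus> b) = (p x \<triangleright> a) \<oplus> (p x \<triangleright> b)"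
  proof (rule act_eqI)
    have "\<iota> ((p x \<triangleright> a) \<oplus> (p x \<triangleright> b)) \<odot> x = \<iota> (p x \<triangleright> a) \<odot> (x \<odot> \<iota> b)"
      by (simp del: g add: G.m_assoc act_comm)
    also have "\<dots> = x \<odot> \<iota> a \<odot> \<iota> b"
      by (simp del: g add: act_comm flip: G.m_assoc)
    finally show "\<iota> ((p x \<triangleright> a) \<oplus> (p x \<triangleright> b)) \<odot> x = x \<odot> \<iota> (a \<oplus> b)"
      by (simp add: G.m_assoc)
  qed (simp_all del: g)
  then show ?thesis by simp
qed

lemma act_act:
  assumes gh: "g \<in> carrier Q" "h \<in> carrier Q" and [simp]: "a \<in> carrier A"
  shows "(g \<cdot> h) \<triangleright> a = g \<triangleright> h \<triangleright> a"
proof -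
  obtain x where x [simp]: "x \<in> carrier G" and g: "p x = g" using gh(1) by (rule p_surjE)
  obtain y where y [simp]: "y \<in> carrier G" and h: "p y = h" using gh(2) by (rule p_surjE)
  have "p (x \<odot> y) \<triangleright> a = p x \<triangleright> p y \<triangleright> a"
  proof (rule act_eqI)
    have "\<iota> (p x \<triangleright> p y \<triangleright> a) \<odot> (x \<odot> y) = x \<odot> (\<iota> (p y \<triangleright> a) \<odot> y)"
      using act_comm[of x "p y \<triangleright> a"] by (simp flip: G.m_assoc)
    also have "\<dots> = x \<odot> y \<odot> \<iota> a"
      by (subst act_comm) (simp_all add: G.m_assoc)
    finally show "\<iota> (p x \<triangleright> p y \<triangleright> a) \<odot> (x \<odot> y) = x \<odot> y \<odot> \<iota> a" .
  qed simp_all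
  then show ?thesis by (simp add: g h)
qed

lemma act_one [simp]: "a \<in> carrier A \<Longrightarrow> \<one>\<^bsub>Q\<^esub> \<triangleright> a = a"
  using act_eqI[of "\<one>\<^bsub>G\<^esub>" a a] by simp

lemma act_inv_act [simp]: "g \<in> carrier Q \<Longrightarrow> a \<in> carrier A \<Longrightarrow> (inv\<^bsub>Q\<^esub> g) \<triangleright> g \<triangleright> a = a"
  by (simp flip: act_act)

lemma act_act_inv [simp]: "g \<in> carrier Q \<Longrightarrow> a \<in> carrier A \<Longrightarrow> g \<triangleright> (inv\<^bsub>Q\<^esub> g) \<triangleright> a = a"
  by (simp flip: act_act)

lemma act_unit [simp]: "g \<in> carrier Q \<Longrightarrow> g \<triangleright> \<one>\<^bsub>A\<^esub> = \<one>\<^bsub>A\<^esub>"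
  by (elim p_surjE) (metis A.one_closed G.l_one G.r_one act_eqI i.hom_one)

section \<open>1-cocycles with values in the dual module\<close>

abbreviation "dact \<equiv> dual_act Q A (conj_act A G \<iota> p)"
abbreviation "cocyc \<equiv> carrier (Z1 Q (dual_group A) dact)"

lemma mem_cocyc:
  "\<pi> \<in> cocyc \<longleftrightarrow> \<pi> \<in> carrier Q \<rightarrow>\<^sub>E carrier (dual_group A) \<and>
     (\<forall>g\<in>carrier Q. \<forall>h\<in>carrier Q. \<forall>a\<in>carrier A. \<pi> (g \<cdot> h) a = \<pi> g a * \<pi> h ((inv\<^bsub>Q\<^esub> g) \<triangleright> a))"
  (is "_ \<longleftrightarrow> ?D \<and> ?C")
proof -
  have "?C \<longleftrightarrow> cobdry1 Q (dual_group A) dact \<pi> = \<one>\<^bsub>C2 Q (dual_group A)\<^esub>" if ?D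
  proof -
    have D: "\<pi> g \<in> carrier (dual_group A)" if "g \<in> carrier Q" for g using that \<open>?D\<close> by auto
    then have N: "\<pi> g a \<noteq> 0" if "g \<in> carrier Q" "a \<in> carrier A" for g a
      using that by (auto simp: mem_dual_group)
    have I: "inv\<^bsub>dual_group A\<^esub> (\<pi> (g \<cdot> h)) = (\<lambda>a\<in>carrier A. inverse (\<pi> (g \<cdot> h) a))"
      if "g \<in> carrier Q" "h \<in> carrier Q" for g h
      using that D by (intro dual_group_inv) (auto simp: A.is_group)
    show ?thesis
      by (auto simp: cobdry1_def cochains_def fun_eq_iff restrict_def dual_group_mult dual_group_one I N
          dual_act_def divide_simps mult.commute)
  qed
  then show ?thesis
    by (auto simp: Z1_def kernel_def cochains_def)
qed

lemma mem_B1: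
  "b \<in> B1 Q (dual_group A) dact \<longleftrightarrow>
    (\<exists>\<psi>\<in>carrier (dual_group A). b = (\<lambda>g\<in>carrier Q. \<lambda>a\<in>carrier A. \<psi> ((inv\<^bsub>Q\<^esub> g) \<triangleright> a) / \<psi> a))"
proof -
  have "cobdry0 Q (dual_group A) dact \<psi> = (\<lambda>g\<in>carrier Q. \<lambda>a\<in>carrier A. \<psi> ((inv\<^bsub>Q\<^esub> g) \<triangleright> a) / \<psi> a)"
    if "\<psi> \<in> carrier (dual_group A)" for \<psi>
    using that by (auto simp: cobdry0_def fun_eq_iff restrict_def dual_group_mult dual_act_def
      dual_group_inv A.is_group divide_inverse)
  then show ?thesis unfolding B1_def by auto
qed

section \<open>The 1-cocycle associated with a 2-cocycle\<close>

abbreviation "GZ \<equiv> carrier (Z2 G Cstar triv_act)"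

lemma GZ_nonzero: "c \<in> GZ \<Longrightarrow> x \<in> carrier G \<Longrightarrow> y \<in> carrier G \<Longrightarrow> c (x, y) \<noteq> 0"
  by (simp add: Z2_Cstar_iff[OF G.is_group])

lemma GZ_cocycle: "c \<in> GZ \<Longrightarrow> x \<in> carrier G \<Longrightarrow> y \<in> carrier G \<Longrightarrow> z \<in> carrier G \<Longrightarrow>
    c (x, y) * c (x \<odot> y, z) = c (x, y \<odot> z) * c (y, z)"
  by (simp add: Z2_Cstar_iff[OF G.is_group])

text \<open>In the twisted group algebra, \<open>splits \<chi> c\<close> says that the elements \<open>\<chi>(a)\<^sup>-\<^sup>1 U\<^sub>a\<close> multiply
  without a factor, and \<open>commutes \<chi> \<pi> c\<close> that conjugation by \<open>U\<^sub>x\<close> maps the one attached to \<open>a\<close> to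
  \<open>\<pi>(x)(x a x\<^sup>-\<^sup>1)\<close> times the one attached to \<open>x a x\<^sup>-\<^sup>1\<close>.\<close>

definition splits :: "('a \<Rightarrow> complex) \<Rightarrow> ('g \<times> 'g \<Rightarrow> complex) \<Rightarrow> bool" where
  "splits \<chi> c \<longleftrightarrow> (\<forall>a\<in>carrier A. \<chi> a \<noteq> 0) \<and>
     (\<forall>a\<in>carrier A. \<forall>b\<in>carrier A. \<chi> (a \<oplus> b) * c (\<iota> a, \<iota> b) = \<chi> a * \<chi> b)"

definition commutes :: "('a \<Rightarrow> complex) \<Rightarrow> ('q \<Rightarrow> 'a \<Rightarrow> complex) \<Rightarrow> ('g \<times> 'g \<Rightarrow> complex) \<Rightarrow> bool" where
  "commutes \<chi> \<pi> c \<longleftrightarrow> (\<forall>x\<in>carrier G. \<forall>a\<in>carrier A.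
     c (x, \<iota> a) * \<chi> (p x \<triangleright> a) = \<pi> (p x) (p x \<triangleright> a) * c (\<iota> (p x \<triangleright> a), x) * \<chi> a)"

text \<open>The relation from which the correspondence is built. It is not a function in either
  direction: another choice of \<chi> changes \<pi> by a coboundary, and inflating from Q changes
  \<open>c\<close> but not \<pi>.\<close>

definition associated :: "('q \<Rightarrow> 'a \<Rightarrow> complex) \<Rightarrow> ('g \<times> 'g \<Rightarrow> complex) \<Rightarrow> bool" where
  "associated \<pi> c \<longleftrightarrow> \<pi> \<in> cocyc \<and> (\<exists>\<chi>. splits \<chi> c \<and> commutes \<chi> \<pi> c)"

section \<open>Scalar factors arising from conjugation of A\<close>

lemma section_exists: "\<exists>s. \<forall>g\<in>carrier Q. s g \<in> carrier G \<and> p (s g) = g"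
  by (rule bchoice) (blast elim: p_surjE)

lemma lift_kernel:
  assumes "x \<in> carrier G" "y \<in> carrier G" "p x = p y"
  shows "\<exists>a\<in>carrier A. x = \<iota> a \<odot> y"
proof -
  have "x \<odot> inv\<^bsub>G\<^esub> y \<in> kernel G Q p" using assms by (simp add: kernel_def)
  then obtain a where "a \<in> carrier A" "x \<odot> inv\<^bsub>G\<^esub> y = \<iota> a" using exact by auto
  then have "x = \<iota> a \<odot> y" using assms by (metis G.inv_solve_right i.hom_closed)
  with \<open>a \<in> _\<close> show ?thesis by blast
qed

lemma \<iota>_inject [simp]: "a \<in> carrier A \<Longrightarrow> b \<in> carrier A \<Longrightarrow> \<iota> a = \<iota> b \<longleftrightarrow> a = b"
  using \<iota>_inj by (auto dest: inj_onD)

text \<open>The equation in \<open>commutes\<close>, solved for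
  \<open>\<pi> (p x) (p x \<triangleright> a)\<close>. With \<open>u_a\<close> the rescaled
  \<open>U_a\<close>, it is the scalar in \<open>U_x u_a = factor * u_b U_x\<close>, where
  \<open>b = p x \<triangleright> a\<close>; its argument is \<open>a\<close>, not the
  conjugate.\<close>

definition commutator_factor :: "('a \<Rightarrow> complex) \<Rightarrow> ('g \<times> 'g \<Rightarrow> complex) \<Rightarrow> 'g \<Rightarrow> 'a \<Rightarrow> complex" where
  "commutator_factor \<chi> c x a =
     c (x, \<iota> a) * \<chi> (p x \<triangleright> a) / (c (\<iota> (p x \<triangleright> a), x) * \<chi> a)"

context
  fixes c \<chi>
  assumes c: "c \<in> GZ" and \<chi>: "splits \<chi> c"
begin

lemma splits_nonzero: "a \<in> carrier A \<Longrightarrow> \<chi> a \<noteq> 0"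
  using \<chi> by (simp add: splits_def)

lemma splits_mult: "a \<in> carrier A \<Longrightarrow> b \<in> carrier A \<Longrightarrow> \<chi> (a \<oplus> b) = \<chi> a * \<chi> b / c (\<iota> a, \<iota> b)"
  using \<chi> GZ_nonzero[OF c] by (simp add: splits_def eq_divide_eq)

lemma commutator_factor_nonzero:
  "x \<in> carrier G \<Longrightarrow> a \<in> carrier A \<Longrightarrow> commutator_factor \<chi> c x a \<noteq> 0"
  by (simp add: commutator_factor_def splits_nonzero GZ_nonzero[OF c])

text \<open>\<open>U_x\<close> is moved past \<open>u_a\<close> and \<open>u_b\<close> in turn, and
  the rescaled elements multiply without a factor. In terms of \<open>c\<close>, three cocycle
  identities introduce the common value \<open>c (x \<odot> \<iota> a, \<iota> b)\<close>, which
  cancels.\<close>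

lemma commutator_factor_mult:
  assumes [simp]: "x \<in> carrier G" "a \<in> carrier A" "b \<in> carrier A"
  shows "commutator_factor \<chi> c x (a \<oplus> b) = commutator_factor \<chi> c x a * commutator_factor \<chi> c x b"
proof -
  define a' b' where "a' = p x \<triangleright> a" and "b' = p x \<triangleright> b"
  have [simp]: "a' \<in> carrier A" "b' \<in> carrier A" by (simp_all add: a'_def b'_def)
  note [simp] = GZ_nonzero[OF c] splits_nonzero
  have comm: "\<iota> a' \<odot> x = x \<odot> \<iota> a" "\<iota> b' \<odot> x = x \<odot> \<iota> b" by (simp_all add: a'_def b'_def act_comm)
  have e1: "c (x, \<iota> a \<odot> \<iota> b) = c (x, \<iota> a) * c (x \<odot> \<iota> a, \<iota> b) / c (\<iota> a, \<iota> b)"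
    using GZ_cocycle[OF c, of x "\<iota> a" "\<iota> b"] by (simp add: eq_divide_eq)
  have e2: "c (\<iota> a', x \<odot> \<iota> b) = c (\<iota> a', x) * c (x \<odot> \<iota> a, \<iota> b) / c (x, \<iota> b)"
    using GZ_cocycle[OF c, of "\<iota> a'" x "\<iota> b"] by (simp add: eq_divide_eq comm)
  have e3: "c (\<iota> a' \<odot> \<iota> b', x) = c (\<iota> a', x \<odot> \<iota> b) * c (\<iota> b', x) / c (\<iota> a', \<iota> b')"
    using GZ_cocycle[OF c, of "\<iota> a'" "\<iota> b'" x] by (simp add: eq_divide_eq comm mult.commute)
  have nz: "c (x \<odot> \<iota> a, \<iota> b) \<noteq> 0" by simp
  show ?thesis
    unfolding commutator_factor_def using nz
    by (simp add: a'_def[symmetric] b'_def[symmetric] splits_mult e1 e3 e2 mult_ac)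
qed

text \<open>Conjugation by \<open>U_x U_y\<close> is conjugation by \<open>U_y\<close>, which
  replaces \<open>a\<close> by \<open>p y \<triangleright> a\<close>, followed by conjugation by
  \<open>U_x\<close>. The scalar \<open>c (x, y)\<close> relating \<open>U_x U_y\<close> to the
  basis element at \<open>x \<odot> y\<close> cancels.\<close>

lemma commutator_factor_prod:
  assumes [simp]: "x \<in> carrier G" "y \<in> carrier G" "a \<in> carrier A"
  shows "commutator_factor \<chi> c (x \<odot> y) a = commutator_factor \<chi> c y a * commutator_factor \<chi> c x (p y \<triangleright> a)"
proof -
  define b d where "b = p y \<triangleright> a" and "d = p x \<triangleright> b"
  have [simp]: "b \<in> carrier A" "d \<in> carrier A" by (simp_all add: b_def d_def)
  note [simp] = GZ_nonzero[OF c] splits_nonzero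
  have d: "(p x \<cdot> p y) \<triangleright> a = d" by (simp add: b_def d_def act_act)
  have comm: "\<iota> b \<odot> y = y \<odot> \<iota> a" "\<iota> d \<odot> x = x \<odot> \<iota> b" by (simp_all add: b_def d_def act_comm)
  have e1: "c (x \<odot> y, \<iota> a) = c (x, y \<odot> \<iota> a) * c (y, \<iota> a) / c (x, y)"
    using GZ_cocycle[OF c, of x y "\<iota> a"] by (simp add: eq_divide_eq mult.commute)
  have e2: "c (x, y \<odot> \<iota> a) = c (x, \<iota> b) * c (x \<odot> \<iota> b, y) / c (\<iota> b, y)"
    using GZ_cocycle[OF c, of x "\<iota> b" y] by (simp add: eq_divide_eq comm)
  have e3: "c (\<iota> d, x \<odot> y) = c (\<iota> d, x) * c (x \<odot> \<iota> b, y) / c (x, y)"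
    using GZ_cocycle[OF c, of "\<iota> d" x y] by (simp add: eq_divide_eq comm)
  have nz: "c (x \<odot> \<iota> b, y) \<noteq> 0" by simp
  show ?thesis
    unfolding commutator_factor_def using nz
    by (simp add: d b_def[symmetric] d_def[symmetric] e1 e3 e2 mult_ac)
qed

text \<open>A splitting makes \<open>c\<close> symmetric on the abelian group A, and A acts
  trivially on itself.\<close>

lemma commutator_factor_\<iota>:
  assumes [simp]: "a \<in> carrier A" "b \<in> carrier A"
  shows "commutator_factor \<chi> c (\<iota> b) a = 1"
proof -
  have "c (\<iota> b, \<iota> a) = c (\<iota> a, \<iota> b)"
    using splits_mult[of a b] splits_mult[of b a] GZ_nonzero[OF c] splits_nonzero[of a] splits_nonzero[of b]
    by (simp add: A.m_comm frac_eq_eq)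
  then show ?thesis by (simp add: commutator_factor_def GZ_nonzero[OF c] splits_nonzero)
qed

text \<open>Elements over the same point of Q differ by some \<open>\<iota> k\<close>, whose factor
  is 1 by the previous two rules, so the factor descends to Q.\<close>

lemma commutator_factor_cong:
  assumes "x \<in> carrier G" "y \<in> carrier G" "p x = p y" "a \<in> carrier A"
  shows "commutator_factor \<chi> c x a = commutator_factor \<chi> c y a"
proof -
  obtain k where "k \<in> carrier A" "x = \<iota> k \<odot> y" using lift_kernel assms by metis
  then show ?thesis using assms by (simp add: commutator_factor_prod commutator_factor_\<iota>)
qed

lemma associated_exists: "\<exists>\<pi>. associated \<pi> c"
proof -
  obtain s where s: "\<And>g. g \<in> carrier Q \<Longrightarrow> s g \<in> carrier G" "\<And>g. g \<in> carrier Q \<Longrightarrow> p (s g) = g"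
    using section_exists by blast
  let ?L = "commutator_factor \<chi> c"
  \<comment> \<open>The factor takes the element before conjugation while \<pi> is indexed by the
    one after it; hence the inverse action on \<open>a\<close>.\<close>
  define \<pi> where "\<pi> = (\<lambda>g\<in>carrier Q. \<lambda>a\<in>carrier A. ?L (s g) ((inv\<^bsub>Q\<^esub> g) \<triangleright> a))"
  have "\<pi> \<in> cocyc"
    unfolding mem_cocyc
  proof (intro conjI PiE_I ballI)
    fix g assume "g \<in> carrier Q"
    then show "\<pi> g \<in> carrier (dual_group A)"
      by (auto simp: \<pi>_def mem_dual_group s commutator_factor_mult commutator_factor_nonzero)
  next
    fix g h a assume [simp]: "g \<in> carrier Q" "h \<in> carrier Q" "a \<in> carrier A"
    have "?L (s (g \<cdot> h)) ((inv\<^bsub>Q\<^esub> (g \<cdot> h)) \<triangleright> a) = ?L (s g \<odot> s h) ((inv\<^bsub>Q\<^esub> (g \<cdot> h)) \<triangleright> a)"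
      by (rule commutator_factor_cong) (simp_all add: s)
    also have "\<dots> = ?L (s g) ((inv\<^bsub>Q\<^esub> g) \<triangleright> a) * ?L (s h) ((inv\<^bsub>Q\<^esub> h) \<triangleright> (inv\<^bsub>Q\<^esub> g) \<triangleright> a)"
      by (simp add: commutator_factor_prod s Q.inv_mult_group act_act)
    finally show "\<pi> (g \<cdot> h) a = \<pi> g a * \<pi> h ((inv\<^bsub>Q\<^esub> g) \<triangleright> a)"
      by (simp add: \<pi>_def)
  qed (simp add: \<pi>_def)
  moreover have "commutes \<chi> \<pi> c"
    unfolding commutes_def
  proof (intro ballI)
    fix x a assume [simp]: "x \<in> carrier G" "a \<in> carrier A"
    have "\<pi> (p x) (p x \<triangleright> a) = ?L x a"
      using commutator_factor_cong[of "s (p x)" x a] by (simp add: \<pi>_def s)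
    then show "c (x, \<iota> a) * \<chi> (p x \<triangleright> a) = \<pi> (p x) (p x \<triangleright> a) * c (\<iota> (p x \<triangleright> a), x) * \<chi> a"
      by (simp add: commutator_factor_def GZ_nonzero[OF c] splits_nonzero)
  qed
  ultimately show ?thesis unfolding associated_def using \<chi> by blast
qed

text \<open>The rescaling takes \<open>\<chi>(a)\<^sup>-\<^sup>1 U\<^sub>a U\<^sub>s\<close> as the new basis element at \<open>a s\<close>, for \<open>s\<close> in a
  transversal of \<open>A\<close>.\<close>

lemma normal_form:
  assumes "commutes \<chi> \<pi> c"
  shows "\<exists>f. (\<forall>x\<in>carrier G. f x \<noteq> 0) \<and>
    (\<forall>x\<in>carrier G. \<forall>y\<in>carrier G. \<forall>a\<in>carrier A.
      c (\<iota> a \<odot> x, y) * f (\<iota> a \<odot> x) * f y / f (\<iota> a \<odot> x \<odot> y) = c (x, y) * f x * f y / f (x \<odot> y) \<and>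
      c (x, \<iota> a \<odot> y) * f x * f (\<iota> a \<odot> y) / f (x \<odot> (\<iota> a \<odot> y))
        = \<pi> (p x) (p x \<triangleright> a) * (c (x, y) * f x * f y / f (x \<odot> y)))"
proof -
  obtain s where s: "\<And>g. g \<in> carrier Q \<Longrightarrow> s g \<in> carrier G" "\<And>g. g \<in> carrier Q \<Longrightarrow> p (s g) = g"
    using section_exists by blast
  have "\<forall>x\<in>carrier G. \<exists>a\<in>carrier A. x = \<iota> a \<odot> s (p x)"
    by (intro ballI lift_kernel) (simp_all add: s)
  then obtain \<alpha> where \<alpha>: "\<And>x. x \<in> carrier G \<Longrightarrow> \<alpha> x \<in> carrier A"
    "\<And>x. x \<in> carrier G \<Longrightarrow> \<iota> (\<alpha> x) \<odot> s (p x) = x" by metis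
  have \<alpha>_mult: "\<alpha> (\<iota> a \<odot> x) = a \<oplus> \<alpha> x" if [simp]: "a \<in> carrier A" "x \<in> carrier G" for a x
  proof -
    have "\<iota> (\<alpha> (\<iota> a \<odot> x)) \<odot> s (p x) = \<iota> (a \<oplus> \<alpha> x) \<odot> s (p x)"
      using \<alpha>(2)[of "\<iota> a \<odot> x"] by (simp add: G.m_assoc \<alpha> s)
    then have "\<iota> (\<alpha> (\<iota> a \<odot> x)) = \<iota> (a \<oplus> \<alpha> x)"
      by (subst (asm) G.right_cancel) (simp_all add: s \<alpha>)
    then show ?thesis by (subst (asm) \<iota>_inject) (simp_all add: \<alpha>)
  qed
  note [simp] = GZ_nonzero[OF c] splits_nonzero
  \<comment> \<open>The coefficient of \<open>U_x\<close> in the product of the rescaled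
    \<open>\<alpha> x\<close> element with \<open>U_s\<close>, where \<open>s\<close> is the lift
    \<open>s (p x)\<close>.\<close>
  define f where "f x = c (\<iota> (\<alpha> x), s (p x)) / \<chi> (\<alpha> x)" for x
  have f_nz [simp]: "f x \<noteq> 0" if "x \<in> carrier G" for x
    using that by (simp add: f_def \<alpha> s)
  \<comment> \<open>For the new basis \<open>f x * U_x\<close>, left multiplication by a rescaled
    element of A costs no scalar. Both claims follow from this rule.\<close>
  have f: "f (\<iota> a \<odot> x) = f x * c (\<iota> a, x) / \<chi> a" if [simp]: "a \<in> carrier A" "x \<in> carrier G" for a x
  proof -
    have "c (\<iota> a \<odot> \<iota> (\<alpha> x), s (p x)) = c (\<iota> a, x) * c (\<iota> (\<alpha> x), s (p x)) / c (\<iota> a, \<iota> (\<alpha> x))"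
      using GZ_cocycle[OF c, of "\<iota> a" "\<iota> (\<alpha> x)" "s (p x)"] by (simp add: eq_divide_eq \<alpha> s mult.commute)
    then show ?thesis by (simp add: f_def \<alpha>_mult \<alpha> splits_mult s mult_ac)
  qed
  have "c (\<iota> a \<odot> x, y) * f (\<iota> a \<odot> x) * f y / f (\<iota> a \<odot> x \<odot> y) = c (x, y) * f x * f y / f (x \<odot> y)"
    if [simp]: "x \<in> carrier G" "y \<in> carrier G" "a \<in> carrier A" for x y a
  proof -
    have "c (\<iota> a \<odot> x, y) = c (\<iota> a, x \<odot> y) * c (x, y) / c (\<iota> a, x)"
      using GZ_cocycle[OF c, of "\<iota> a" x y] by (simp add: eq_divide_eq mult.commute)
    then show ?thesis by (simp add: f G.m_assoc)
  qed
  moreover have "c (x, \<iota> a \<odot> y) * f x * f (\<iota> a \<odot> y) / f (x \<odot> (\<iota> a \<odot> y))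
        = \<pi> (p x) (p x \<triangleright> a) * (c (x, y) * f x * f y / f (x \<odot> y))"
    if [simp]: "x \<in> carrier G" "y \<in> carrier G" "a \<in> carrier A" for x y a
  proof -
    define a' where "a' = p x \<triangleright> a"
    have [simp]: "a' \<in> carrier A" by (simp add: a'_def)
    have comm: "\<iota> a' \<odot> x = x \<odot> \<iota> a" by (simp add: a'_def act_comm)
    \<comment> \<open>Moving \<open>\<iota> a\<close> to the far left makes the rule for
      \<open>f\<close> applicable.\<close>
    then have swap: "x \<odot> (\<iota> a \<odot> y) = \<iota> a' \<odot> (x \<odot> y)"
      by (simp flip: G.m_assoc)
    have e1: "c (x, \<iota> a \<odot> y) = c (x, \<iota> a) * c (x \<odot> \<iota> a, y) / c (\<iota> a, y)"
      using GZ_cocycle[OF c, of x "\<iota> a" y] by (simp add: eq_divide_eq)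
    have e2: "c (\<iota> a', x \<odot> y) = c (\<iota> a', x) * c (x \<odot> \<iota> a, y) / c (x, y)"
      using GZ_cocycle[OF c, of "\<iota> a'" x y] by (simp add: eq_divide_eq comm)
    \<comment> \<open>This is the only place where \<pi> enters.\<close>
    have e3: "c (x, \<iota> a) = \<pi> (p x) a' * c (\<iota> a', x) * \<chi> a / \<chi> a'"
      using assms by (simp add: commutes_def a'_def eq_divide_eq)
    have nz: "c (x \<odot> \<iota> a, y) \<noteq> 0" by simp
    show ?thesis
      unfolding swap using nz by (simp add: f e1 e2 e3 flip: a'_def)
  qed
  ultimately show ?thesis using f_nz by (intro exI[of _ f]) blast
qed

end

section \<open>The cup product obstruction, and uniqueness up to inflation\<close>

lemma associatedE:
  assumes "associated \<pi> c" "c \<in> GZ"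
  obtains f where "\<And>x. x \<in> carrier G \<Longrightarrow> f x \<noteq> 0"
    "\<And>x y a. x \<in> carrier G \<Longrightarrow> y \<in> carrier G \<Longrightarrow> a \<in> carrier A \<Longrightarrow>
      c (\<iota> a \<odot> x, y) * f (\<iota> a \<odot> x) * f y / f (\<iota> a \<odot> x \<odot> y) = c (x, y) * f x * f y / f (x \<odot> y)"
    "\<And>x y a. x \<in> carrier G \<Longrightarrow> y \<in> carrier G \<Longrightarrow> a \<in> carrier A \<Longrightarrow>
      c (x, \<iota> a \<odot> y) * f x * f (\<iota> a \<odot> y) / f (x \<odot> (\<iota> a \<odot> y))
        = \<pi> (p x) (p x \<triangleright> a) * (c (x, y) * f x * f y / f (x \<odot> y))"
proof -
  obtain \<chi> where "splits \<chi> c" "commutes \<chi> \<pi> c" using assms(1) by (auto simp: associated_def)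
  from normal_form[OF assms(2) this] show ?thesis using that by blast
qed

lemma cocyc_nonzero: "\<pi> \<in> cocyc \<Longrightarrow> g \<in> carrier Q \<Longrightarrow> a \<in> carrier A \<Longrightarrow> \<pi> g a \<noteq> 0"
  by (auto simp: mem_cocyc mem_dual_group PiE_def Pi_def)

lemma cocyc_mult: "\<pi> \<in> cocyc \<Longrightarrow> g \<in> carrier Q \<Longrightarrow> a \<in> carrier A \<Longrightarrow> b \<in> carrier A \<Longrightarrow>
    \<pi> g (a \<oplus> b) = \<pi> g a * \<pi> g b"
  by (auto simp: mem_cocyc mem_dual_group PiE_def Pi_def)

lemma cocyc_prod: "\<pi> \<in> cocyc \<Longrightarrow> g \<in> carrier Q \<Longrightarrow> h \<in> carrier Q \<Longrightarrow> a \<in> carrier A \<Longrightarrow>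
    \<pi> (g \<cdot> h) a = \<pi> g a * \<pi> h ((inv\<^bsub>Q\<^esub> g) \<triangleright> a)"
  by (simp add: mem_cocyc)

lemma cocyc_one: "\<pi> \<in> cocyc \<Longrightarrow> a \<in> carrier A \<Longrightarrow> \<pi> \<one>\<^bsub>Q\<^esub> a = 1"
  using cocyc_prod[of \<pi> "\<one>\<^bsub>Q\<^esub>" "\<one>\<^bsub>Q\<^esub>" a] cocyc_nonzero[of \<pi> "\<one>\<^bsub>Q\<^esub>" a] by simp

text \<open>The normal form \<open>d\<close> of \<open>c\<close> satisfies the cocycle identity at
  three lifts. Replacing \<open>s g \<odot> s h\<close> by
  \<open>\<iota> (\<beta> (g, h)) \<odot> s (g \<cdot> h)\<close> costs nothing in the left
  argument, whereas the analogous replacement in the right argument produces the value of the cup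
  cochain.\<close>

lemma cup_cochain_in_B3:
  assumes assoc: "associated \<pi> c" and c: "c \<in> GZ"
    and s: "\<And>g. g \<in> carrier Q \<Longrightarrow> s g \<in> carrier G" "\<And>g. g \<in> carrier Q \<Longrightarrow> p (s g) = g"
    and \<beta>: "\<And>g h. g \<in> carrier Q \<Longrightarrow> h \<in> carrier Q \<Longrightarrow> \<beta> (g, h) \<in> carrier A"
    "\<And>g h. g \<in> carrier Q \<Longrightarrow> h \<in> carrier Q \<Longrightarrow> \<iota> (\<beta> (g, h)) \<odot> s (g \<cdot> h) = s g \<odot> s h"
  shows "cup_cochain Q (conj_act A G \<iota> p) \<beta> \<pi> \<in> B3 Q Cstar triv_act"
proof -
  from assoc c obtain f where f: "\<And>x. x \<in> carrier G \<Longrightarrow> f x \<noteq> 0"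
    "\<And>x y a. x \<in> carrier G \<Longrightarrow> y \<in> carrier G \<Longrightarrow> a \<in> carrier A \<Longrightarrow>
      c (\<iota> a \<odot> x, y) * f (\<iota> a \<odot> x) * f y / f (\<iota> a \<odot> x \<odot> y) = c (x, y) * f x * f y / f (x \<odot> y)"
    "\<And>x y a. x \<in> carrier G \<Longrightarrow> y \<in> carrier G \<Longrightarrow> a \<in> carrier A \<Longrightarrow>
      c (x, \<iota> a \<odot> y) * f x * f (\<iota> a \<odot> y) / f (x \<odot> (\<iota> a \<odot> y))
        = \<pi> (p x) (p x \<triangleright> a) * (c (x, y) * f x * f y / f (x \<odot> y))"
    by (rule associatedE) blast
  define d where "d x y = c (x, y) * f x * f y / f (x \<odot> y)" for x y
  have d_nz: "d x y \<noteq> 0" if "x \<in> carrier G" "y \<in> carrier G" for x y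
    using that by (simp add: d_def f(1) GZ_nonzero[OF c])
  have d_coc: "d x y * d (x \<odot> y) z = d x (y \<odot> z) * d y z"
    if "x \<in> carrier G" "y \<in> carrier G" "z \<in> carrier G" for x y z
    using that GZ_cocycle[OF c that] by (simp add: d_def f(1) G.m_assoc)
  have d_left: "d (\<iota> a \<odot> x) y = d x y"
    if "x \<in> carrier G" "y \<in> carrier G" "a \<in> carrier A" for x y a
    using f(2)[OF that] by (simp add: d_def)
  have d_right: "d x (\<iota> a \<odot> y) = \<pi> (p x) (p x \<triangleright> a) * d x y"
    if "x \<in> carrier G" "y \<in> carrier G" "a \<in> carrier A" for x y a
    using f(3)[OF that] by (simp add: d_def)
  \<comment> \<open>The inverse matches the sign convention of \<open>cobdry2\<close>: the identity
    for \<open>d\<close> has the factors with left argument \<open>s g \<odot> s h\<close> and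
    \<open>s g\<close> on the opposite side of the fraction.\<close>
  define \<omega> where "\<omega> g h = inverse (d (s g) (s h))" for g h
  have "\<pi> g (g \<triangleright> \<beta> (h, k)) = \<omega> g (h \<cdot> k) * \<omega> h k / (\<omega> g h * \<omega> (g \<cdot> h) k)"
    if [simp]: "g \<in> carrier Q" "h \<in> carrier Q" "k \<in> carrier Q" for g h k
  proof -
    have "d (s g) (s h) * d (s g \<odot> s h) (s k) = d (s g) (s h \<odot> s k) * d (s h) (s k)"
      by (rule d_coc) (simp_all add: s)
    moreover have "d (s g \<odot> s h) (s k) = d (s (g \<cdot> h)) (s k)"
      by (simp add: s \<beta> d_left flip: \<beta>(2))
    moreover have "d (s g) (s h \<odot> s k) = \<pi> g (g \<triangleright> \<beta> (h, k)) * d (s g) (s (h \<cdot> k))"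
      using d_right[of "s g" "s (h \<cdot> k)" "\<beta> (h, k)"] by (simp add: s \<beta>)
    ultimately have "d (s g) (s h) * d (s (g \<cdot> h)) (s k)
        = \<pi> g (g \<triangleright> \<beta> (h, k)) * d (s g) (s (h \<cdot> k)) * d (s h) (s k)" by simp
    then show ?thesis by (simp add: \<omega>_def d_nz s field_simps)
  qed
  then have "cup_cochain Q (conj_act A G \<iota> p) \<beta> \<pi>
      = (\<lambda>(g, h, k)\<in>carrier Q \<times> carrier Q \<times> carrier Q.
           \<omega> g (h \<cdot> k) * \<omega> h k / (\<omega> g h * \<omega> (g \<cdot> h) k))"
    unfolding cup_cochain_def by (intro restrict_ext) auto
  moreover have "\<forall>g\<in>carrier Q. \<forall>h\<in>carrier Q. \<omega> g h \<noteq> 0"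
    by (simp add: \<omega>_def d_nz s)
  ultimately show ?thesis unfolding B3_Cstar_iff[OF Q.is_group] by blast
qed

text \<open>In normal form both cocycles are invariant under A on the left and have the same
  \<pi>-factor on the right. Their quotient is therefore invariant in both arguments and descends to
  a cocycle on Q.\<close>

lemma associated_differ_by_inflation:
  assumes assoc: "associated \<pi> c" "associated \<pi> c'" and c: "c \<in> GZ" "c' \<in> GZ"
  shows "\<exists>f z. (\<forall>x\<in>carrier G. f x \<noteq> 0) \<and> z \<in> carrier (Z2 Q Cstar triv_act) \<and>
    (\<forall>x\<in>carrier G. \<forall>y\<in>carrier G. c' (x, y) = f x * f y / f (x \<odot> y) * z (p x, p y) * c (x, y))"
proof -
  from assoc(1) c(1) obtain f where f: "\<And>x. x \<in> carrier G \<Longrightarrow> f x \<noteq> 0"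
    "\<And>x y a. x \<in> carrier G \<Longrightarrow> y \<in> carrier G \<Longrightarrow> a \<in> carrier A \<Longrightarrow>
      c (\<iota> a \<odot> x, y) * f (\<iota> a \<odot> x) * f y / f (\<iota> a \<odot> x \<odot> y) = c (x, y) * f x * f y / f (x \<odot> y)"
    "\<And>x y a. x \<in> carrier G \<Longrightarrow> y \<in> carrier G \<Longrightarrow> a \<in> carrier A \<Longrightarrow>
      c (x, \<iota> a \<odot> y) * f x * f (\<iota> a \<odot> y) / f (x \<odot> (\<iota> a \<odot> y))
        = \<pi> (p x) (p x \<triangleright> a) * (c (x, y) * f x * f y / f (x \<odot> y))"
    by (rule associatedE) blast
  from assoc(2) c(2) obtain f' where f': "\<And>x. x \<in> carrier G \<Longrightarrow> f' x \<noteq> 0"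
    "\<And>x y a. x \<in> carrier G \<Longrightarrow> y \<in> carrier G \<Longrightarrow> a \<in> carrier A \<Longrightarrow>
      c' (\<iota> a \<odot> x, y) * f' (\<iota> a \<odot> x) * f' y / f' (\<iota> a \<odot> x \<odot> y) = c' (x, y) * f' x * f' y / f' (x \<odot> y)"
    "\<And>x y a. x \<in> carrier G \<Longrightarrow> y \<in> carrier G \<Longrightarrow> a \<in> carrier A \<Longrightarrow>
      c' (x, \<iota> a \<odot> y) * f' x * f' (\<iota> a \<odot> y) / f' (x \<odot> (\<iota> a \<odot> y))
        = \<pi> (p x) (p x \<triangleright> a) * (c' (x, y) * f' x * f' y / f' (x \<odot> y))"
    by (rule associatedE) blast
  have \<pi>: "\<pi> \<in> cocyc" using assoc by (simp add: associated_def)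
  obtain s where s: "\<And>g. g \<in> carrier Q \<Longrightarrow> s g \<in> carrier G" "\<And>g. g \<in> carrier Q \<Longrightarrow> p (s g) = g"
    using section_exists by blast
  define d where "d x y = c (x, y) * f x * f y / f (x \<odot> y)" for x y
  define d' where "d' x y = c' (x, y) * f' x * f' y / f' (x \<odot> y)" for x y
  define q where "q x y = d' x y / d x y" for x y
  have d_nz: "d x y \<noteq> 0" "d' x y \<noteq> 0" if "x \<in> carrier G" "y \<in> carrier G" for x y
    using that by (simp_all add: d_def d'_def f(1) f'(1) GZ_nonzero c)
  have d_coc: "d x y * d (x \<odot> y) z = d x (y \<odot> z) * d y z" "d' x y * d' (x \<odot> y) z = d' x (y \<odot> z) * d' y z"
    if "x \<in> carrier G" "y \<in> carrier G" "z \<in> carrier G" for x y z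
    using that GZ_cocycle[OF c(1) that] GZ_cocycle[OF c(2) that]
    by (simp_all add: d_def d'_def f(1) f'(1) G.m_assoc)
  have q_nz: "q x y \<noteq> 0" if "x \<in> carrier G" "y \<in> carrier G" for x y
    using d_nz that by (simp add: q_def)
  have q_coc: "q x y * q (x \<odot> y) z = q x (y \<odot> z) * q y z"
    if "x \<in> carrier G" "y \<in> carrier G" "z \<in> carrier G" for x y z
    unfolding q_def times_divide_times_eq d_coc[OF that] ..
  have q_left: "q (\<iota> a \<odot> x) y = q x y"
    if "x \<in> carrier G" "y \<in> carrier G" "a \<in> carrier A" for x y a
    using f(2)[OF that] f'(2)[OF that] by (simp add: q_def d_def d'_def)
  have q_right: "q x (\<iota> a \<odot> y) = q x y"
    if "x \<in> carrier G" "y \<in> carrier G" "a \<in> carrier A" for x y a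
    unfolding q_def d_def d'_def f(3)[OF that] f'(3)[OF that]
    using that cocyc_nonzero[OF \<pi>] by (intro mult_divide_mult_cancel_left) simp
  have q_cong: "q x y = q x' y'"
    if G: "x \<in> carrier G" "y \<in> carrier G" "x' \<in> carrier G" "y' \<in> carrier G" and px: "p x = p x'" and py: "p y = p y'"
    for x y x' y'
  proof -
    obtain a where "a \<in> carrier A" "x = \<iota> a \<odot> x'" using lift_kernel[OF G(1,3) px] by blast
    moreover obtain b where "b \<in> carrier A" "y = \<iota> b \<odot> y'" using lift_kernel[OF G(2,4) py] by blast
    ultimately show ?thesis using G by (simp add: q_left q_right)
  qed
  \<comment> \<open>By \<open>q_cong\<close> the choice of lifts does not affect the value.\<close>
  define z where "z = (\<lambda>(g, h)\<in>carrier Q \<times> carrier Q. q (s g) (s h))"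
  have z: "z (p x, p y) = q x y" if "x \<in> carrier G" "y \<in> carrier G" for x y
    using that by (simp add: z_def, intro q_cong) (simp_all add: s)
  have "z \<in> carrier (Z2 Q Cstar triv_act)"
    unfolding Z2_Cstar_iff[OF Q.is_group]
  proof (intro conjI ballI)
    fix g h k assume [simp]: "g \<in> carrier Q" "h \<in> carrier Q" "k \<in> carrier Q"
    show "z (g, h) * z (g \<cdot> h, k) = z (g, h \<cdot> k) * z (h, k)"
      using q_coc[of "s g" "s h" "s k"] z[of "s g" "s h"] z[of "s g \<odot> s h" "s k"]
        z[of "s g" "s h \<odot> s k"] z[of "s h" "s k"] by (simp add: s)
  qed (auto simp: z_def q_nz s)
  moreover have "c' (x, y) = (f x / f' x) * (f y / f' y) / (f (x \<odot> y) / f' (x \<odot> y)) * z (p x, p y) * c (x, y)"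
    if "x \<in> carrier G" "y \<in> carrier G" for x y
    using that by (simp add: z q_def d_def d'_def f(1) f'(1) GZ_nonzero c)
  ultimately show ?thesis
    using f(1) f'(1) by (intro exI[of _ "\<lambda>x. f x / f' x"] exI[of _ z]) simp
qed

text \<open>Cochains are not normalized, so a cocycle is constant along both axes with a value that
  may differ from 1. This value has to be carried along when an inflated cocycle is restricted to
  A.\<close>

lemma Z2_normalized:
  assumes "z \<in> carrier (Z2 Q Cstar triv_act)" "g \<in> carrier Q"
  shows "z (\<one>\<^bsub>Q\<^esub>, g) = z (\<one>\<^bsub>Q\<^esub>, \<one>\<^bsub>Q\<^esub>)" "z (g, \<one>\<^bsub>Q\<^esub>) = z (\<one>\<^bsub>Q\<^esub>, \<one>\<^bsub>Q\<^esub>)"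
proof -
  have nz: "z (x, y) \<noteq> 0" if "x \<in> carrier Q" "y \<in> carrier Q" for x y
    using assms that by (simp add: Z2_Cstar_iff[OF Q.is_group])
  have coc: "z (x, y) * z (x \<cdot> y, w) = z (x, y \<cdot> w) * z (y, w)"
    if "x \<in> carrier Q" "y \<in> carrier Q" "w \<in> carrier Q" for x y w
    using assms that by (simp add: Z2_Cstar_iff[OF Q.is_group])
  show "z (\<one>\<^bsub>Q\<^esub>, g) = z (\<one>\<^bsub>Q\<^esub>, \<one>\<^bsub>Q\<^esub>)"
    using coc[of "\<one>\<^bsub>Q\<^esub>" "\<one>\<^bsub>Q\<^esub>" g] nz[of "\<one>\<^bsub>Q\<^esub>" g] assms by simp
  show "z (g, \<one>\<^bsub>Q\<^esub>) = z (\<one>\<^bsub>Q\<^esub>, \<one>\<^bsub>Q\<^esub>)"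
    using coc[of g "\<one>\<^bsub>Q\<^esub>" "\<one>\<^bsub>Q\<^esub>"] nz[of g "\<one>\<^bsub>Q\<^esub>"] assms by simp
qed

lemma associated_times_inflation:
  assumes "associated \<pi> c" and f: "\<forall>x\<in>carrier G. f x \<noteq> 0" and z: "z \<in> carrier (Z2 Q Cstar triv_act)"
    and c': "\<And>x y. x \<in> carrier G \<Longrightarrow> y \<in> carrier G \<Longrightarrow>
      c' (x, y) = f x * f y / f (x \<odot> y) * z (p x, p y) * c (x, y)"
  shows "associated \<pi> c'"
proof -
  obtain \<chi> where \<pi>: "\<pi> \<in> cocyc" and \<chi>: "splits \<chi> c" "commutes \<chi> \<pi> c"
    using assms(1) by (auto simp: associated_def)
  define z1 where "z1 = z (\<one>\<^bsub>Q\<^esub>, \<one>\<^bsub>Q\<^esub>)"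
  have z1: "z1 \<noteq> 0" using z by (simp add: z1_def Z2_Cstar_iff[OF Q.is_group])
  note zs = Z2_normalized[OF z, folded z1_def]
  \<comment> \<open>The factor \<open>f (\<iota> a)\<close> compensates the coboundary, and
    \<open>z1\<close> is the constant value on A of the inflated cocycle.\<close>
  let ?\<chi> = "\<lambda>a. \<chi> a * f (\<iota> a) * z1"
  have "splits ?\<chi> c'"
    using \<chi>(1) f z1 by (auto simp: splits_def c' zs)
  moreover have "commutes ?\<chi> \<pi> c'"
    unfolding commutes_def
  proof (intro ballI)
    fix x a assume [simp]: "x \<in> carrier G" "a \<in> carrier A"
    have "c (x, \<iota> a) * \<chi> (p x \<triangleright> a) = \<pi> (p x) (p x \<triangleright> a) * c (\<iota> (p x \<triangleright> a), x) * \<chi> a"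
      using \<chi>(2) by (simp add: commutes_def)
    then show "c' (x, \<iota> a) * (\<chi> (p x \<triangleright> a) * f (\<iota> (p x \<triangleright> a)) * z1)
        = \<pi> (p x) (p x \<triangleright> a) * c' (\<iota> (p x \<triangleright> a), x) * (\<chi> a * f (\<iota> a) * z1)"
      using f z1 by (simp add: c' zs act_comm)
  qed
  ultimately show ?thesis using \<pi> by (auto simp: associated_def)
qed

section \<open>Changing the 1-cocycle by a coboundary\<close>

lemma cocyc_times_coboundary:
  assumes \<pi>: "\<pi> \<in> cocyc" and \<psi>: "\<psi> \<in> carrier (dual_group A)"
    and \<pi>0: "\<pi>0 = (\<lambda>g\<in>carrier Q. \<lambda>a\<in>carrier A. \<psi> ((inv\<^bsub>Q\<^esub> g) \<triangleright> a) / \<psi> a * \<pi> g a)"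
  shows "\<pi>0 \<in> cocyc"
  unfolding mem_cocyc
proof (intro conjI PiE_I ballI)
  have \<psi>_nz: "\<psi> a \<noteq> 0" if "a \<in> carrier A" for a
    using \<psi> that by (auto simp: mem_dual_group)
  have \<psi>_mult: "\<psi> (a \<oplus> b) = \<psi> a * \<psi> b" if "a \<in> carrier A" "b \<in> carrier A" for a b
    using \<psi> that by (auto simp: mem_dual_group)
  {
    fix g assume "g \<in> carrier Q"
    then show "\<pi>0 g \<in> carrier (dual_group A)"
      by (simp add: \<pi>0 mem_dual_group \<psi>_nz cocyc_nonzero[OF \<pi>] \<psi>_mult cocyc_mult[OF \<pi>])
  next
    fix g h a assume "g \<in> carrier Q" "h \<in> carrier Q" "a \<in> carrier A"
    then show "\<pi>0 (g \<cdot> h) a = \<pi>0 g a * \<pi>0 h ((inv\<^bsub>Q\<^esub> g) \<triangleright> a)"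
      by (simp add: \<pi>0 \<psi>_nz cocyc_nonzero[OF \<pi>] cocyc_prod[OF \<pi>] Q.inv_mult_group act_act)
  }
qed (simp add: \<pi>0)

text \<open>Dividing \<chi> by the character \<psi> yields another splitting of the same
  \<open>c\<close>, and this change multiplies \<pi> by the coboundary of \<psi>.\<close>

lemma associated_times_coboundary:
  assumes "associated \<pi> c" and \<psi>: "\<psi> \<in> carrier (dual_group A)"
    and \<pi>0: "\<pi>0 = (\<lambda>g\<in>carrier Q. \<lambda>a\<in>carrier A. \<psi> ((inv\<^bsub>Q\<^esub> g) \<triangleright> a) / \<psi> a * \<pi> g a)"
  shows "associated \<pi>0 c"
proof -
  obtain \<chi> where \<pi>: "\<pi> \<in> cocyc" and \<chi>: "splits \<chi> c" "commutes \<chi> \<pi> c"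
    using assms(1) by (auto simp: associated_def)
  have \<psi>_nz: "\<psi> a \<noteq> 0" if "a \<in> carrier A" for a
    using \<psi> that by (auto simp: mem_dual_group)
  have \<psi>_mult: "\<psi> (a \<oplus> b) = \<psi> a * \<psi> b" if "a \<in> carrier A" "b \<in> carrier A" for a b
    using \<psi> that by (auto simp: mem_dual_group)
  have "\<pi>0 \<in> cocyc" by (rule cocyc_times_coboundary[OF \<pi> \<psi> \<pi>0])
  moreover have "splits (\<lambda>a. \<chi> a / \<psi> a) c"
    using \<chi>(1) by (auto simp: splits_def \<psi>_nz \<psi>_mult)
  moreover have "commutes (\<lambda>a. \<chi> a / \<psi> a) \<pi>0 c"
    using \<chi>(2) unfolding commutes_def
    by (auto simp: \<pi>0 \<psi>_nz)
  ultimately show ?thesis by (auto simp: associated_def)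
qed

text \<open>Two splittings of the same restricted cocycle have a character as quotient, and
  \<open>commutes\<close> leaves \<pi> no freedom once \<open>c\<close> and the splitting are
  fixed.\<close>

lemma associated_differ_by_coboundary:
  assumes "associated \<pi> c" "associated \<pi>0 c" and c: "c \<in> GZ"
  shows "\<exists>\<psi>\<in>carrier (dual_group A).
    \<pi>0 = (\<lambda>g\<in>carrier Q. \<lambda>a\<in>carrier A. \<psi> ((inv\<^bsub>Q\<^esub> g) \<triangleright> a) / \<psi> a * \<pi> g a)"
proof -
  obtain \<chi> where \<pi>: "\<pi> \<in> cocyc" and \<chi>: "splits \<chi> c" "commutes \<chi> \<pi> c"
    using assms(1) by (auto simp: associated_def)
  obtain \<chi>' where \<pi>0: "\<pi>0 \<in> cocyc" and \<chi>': "splits \<chi>' c" "commutes \<chi>' \<pi>0 c"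
    using assms(2) by (auto simp: associated_def)
  define \<psi> where "\<psi> = (\<lambda>a\<in>carrier A. \<chi> a / \<chi>' a)"
  note nz = splits_nonzero[OF c \<chi>(1)] splits_nonzero[OF c \<chi>'(1)]
  have "\<psi> \<in> carrier (dual_group A)"
    by (auto simp: mem_dual_group \<psi>_def nz splits_mult[OF c \<chi>(1)] splits_mult[OF c \<chi>'(1)] GZ_nonzero[OF c])
  moreover have "\<pi>0 g a = \<psi> ((inv\<^bsub>Q\<^esub> g) \<triangleright> a) / \<psi> a * \<pi> g a" if g: "g \<in> carrier Q" and a: "a \<in> carrier A" for g a
  proof -
    obtain x where x: "x \<in> carrier G" "p x = g" using g by (rule p_surjE)
    let ?b = "(inv\<^bsub>Q\<^esub> g) \<triangleright> a"
    have "c (x, \<iota> ?b) * \<chi> a = \<pi> g a * c (\<iota> a, x) * \<chi> ?b" "c (x, \<iota> ?b) * \<chi>' a = \<pi>0 g a * c (\<iota> a, x) * \<chi>' ?b"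
      using \<chi>(2)[unfolded commutes_def, rule_format, of x ?b]
        \<chi>'(2)[unfolded commutes_def, rule_format, of x ?b] x a g by simp_all
    then have "\<pi>0 g a = c (x, \<iota> ?b) * \<chi>' a / (c (\<iota> a, x) * \<chi>' ?b)" "\<pi> g a = c (x, \<iota> ?b) * \<chi> a / (c (\<iota> a, x) * \<chi> ?b)"
      using x a g by (simp_all add: eq_divide_eq GZ_nonzero[OF c] nz)
    then show ?thesis using x a g by (simp add: \<psi>_def GZ_nonzero[OF c] nz mult.commute)
  qed
  moreover have "\<pi>0 \<in> extensional (carrier Q)" "\<And>g. g \<in> carrier Q \<Longrightarrow> \<pi>0 g \<in> extensional (carrier A)"
    using \<pi>0 by (auto simp: mem_cocyc mem_dual_group PiE_def Pi_def)
  ultimately show ?thesis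
    by (intro bexI[of _ \<psi>] extensionalityI[of _ "carrier Q"]) (auto intro!: extensionalityI[of _ "carrier A"])
qed

text \<open>Writing \<open>x = a s(g)\<close> and \<open>y = b s(h)\<close>, the cocycle is \<open>c(x, y) = \<pi>(g)(g b) \<omega>(g, h)\<close>, where
  \<open>\<omega>\<^sup>-\<^sup>1\<close> is a cochain with coboundary \<open>\<beta> \<union> \<pi>\<close>.\<close>

lemma associated_cocycle_exists:
  assumes \<pi>: "\<pi> \<in> cocyc"
    and s: "\<And>g. g \<in> carrier Q \<Longrightarrow> s g \<in> carrier G" "\<And>g. g \<in> carrier Q \<Longrightarrow> p (s g) = g"
    and \<beta>: "\<And>g h. g \<in> carrier Q \<Longrightarrow> h \<in> carrier Q \<Longrightarrow> \<beta> (g, h) \<in> carrier A"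
    "\<And>g h. g \<in> carrier Q \<Longrightarrow> h \<in> carrier Q \<Longrightarrow> \<iota> (\<beta> (g, h)) \<odot> s (g \<cdot> h) = s g \<odot> s h"
    and cup: "cup_cochain Q (conj_act A G \<iota> p) \<beta> \<pi> \<in> B3 Q Cstar triv_act"
  shows "\<exists>c\<in>GZ. associated \<pi> c"
proof -
  from cup obtain w where w: "\<And>g h. g \<in> carrier Q \<Longrightarrow> h \<in> carrier Q \<Longrightarrow> w g h \<noteq> 0"
    "cup_cochain Q (conj_act A G \<iota> p) \<beta> \<pi> = (\<lambda>(g, h, k)\<in>carrier Q \<times> carrier Q \<times> carrier Q.
        w g (h \<cdot> k) * w h k / (w g h * w (g \<cdot> h) k))"
    unfolding B3_Cstar_iff[OF Q.is_group] by blast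
  \<comment> \<open>Inverting the cochain brings its coboundary relation into the form of a cocycle
    identity twisted by \<beta>.\<close>
  define \<omega> where "\<omega> g h = inverse (w g h)" for g h
  have \<omega>_nz: "\<omega> g h \<noteq> 0" if "g \<in> carrier Q" "h \<in> carrier Q" for g h
    using that w(1) by (simp add: \<omega>_def)
  have \<omega>: "\<omega> g h * \<omega> (g \<cdot> h) k = \<pi> g (g \<triangleright> \<beta> (h, k)) * \<omega> g (h \<cdot> k) * \<omega> h k"
    if [simp]: "g \<in> carrier Q" "h \<in> carrier Q" "k \<in> carrier Q" for g h k
  proof -
    have "\<pi> g (g \<triangleright> \<beta> (h, k)) = w g (h \<cdot> k) * w h k / (w g h * w (g \<cdot> h) k)"
      using fun_cong[OF w(2), of "(g, h, k)"] by (simp add: cup_cochain_def)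
    then show ?thesis by (simp add: \<omega>_def w(1) field_simps)
  qed
  have "\<forall>x\<in>carrier G. \<exists>a\<in>carrier A. x = \<iota> a \<odot> s (p x)"
    by (intro ballI lift_kernel) (simp_all add: s)
  then obtain \<alpha> where \<alpha>: "\<And>x. x \<in> carrier G \<Longrightarrow> \<alpha> x \<in> carrier A"
    "\<And>x. x \<in> carrier G \<Longrightarrow> \<iota> (\<alpha> x) \<odot> s (p x) = x" by metis
  have \<alpha>_eqI: "\<alpha> x = a" if "x \<in> carrier G" "a \<in> carrier A" "\<iota> a \<odot> s (p x) = x" for x a
  proof -
    have "\<iota> (\<alpha> x) \<odot> s (p x) = \<iota> a \<odot> s (p x)" using that \<alpha> by simp
    then have "\<iota> (\<alpha> x) = \<iota> a" using that by (subst (asm) G.right_cancel) (simp_all add: s \<alpha>)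
    then show ?thesis using that by (subst (asm) \<iota>_inject) (simp_all add: \<alpha>)
  qed
  \<comment> \<open>The A-coordinate of a product: \<open>\<iota> (\<alpha> z)\<close> is conjugated
    on its way past \<open>s (p y)\<close>, and the two lifts together contribute \<beta>.\<close>
  have \<alpha>_mult: "\<alpha> (y \<odot> z) = \<alpha> y \<oplus> (p y \<triangleright> \<alpha> z) \<oplus> \<beta> (p y, p z)"
    if [simp]: "y \<in> carrier G" "z \<in> carrier G" for y z
  proof (rule \<alpha>_eqI)
    note [simp] = \<alpha>(1) s \<beta>(1)
    have "\<iota> (\<alpha> y \<oplus> (p y \<triangleright> \<alpha> z) \<oplus> \<beta> (p y, p z)) \<odot> s (p (y \<odot> z))
        = \<iota> (\<alpha> y) \<odot> (\<iota> (p y \<triangleright> \<alpha> z) \<odot> s (p y)) \<odot> s (p z)"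
      using \<beta>(2)[of "p y" "p z"] by (simp add: G.m_assoc)
    also have "\<iota> (p y \<triangleright> \<alpha> z) \<odot> s (p y) = s (p y) \<odot> \<iota> (\<alpha> z)"
      using act_comm[of "s (p y)" "\<alpha> z"] by simp
    also have "\<iota> (\<alpha> y) \<odot> (s (p y) \<odot> \<iota> (\<alpha> z)) \<odot> s (p z) = (\<iota> (\<alpha> y) \<odot> s (p y)) \<odot> (\<iota> (\<alpha> z) \<odot> s (p z))"
      by (simp add: G.m_assoc)
    also have "\<dots> = y \<odot> z" by (simp add: \<alpha>(2))
    finally show "\<iota> (\<alpha> y \<oplus> (p y \<triangleright> \<alpha> z) \<oplus> \<beta> (p y, p z)) \<odot> s (p (y \<odot> z)) = y \<odot> z" .
  qed (simp_all add: \<alpha> \<beta>)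
  define c where "c = (\<lambda>(x, y)\<in>carrier G \<times> carrier G. \<pi> (p x) (p x \<triangleright> \<alpha> y) * \<omega> (p x) (p y))"
  have c: "c (x, y) = \<pi> (p x) (p x \<triangleright> \<alpha> y) * \<omega> (p x) (p y)" if "x \<in> carrier G" "y \<in> carrier G" for x y
    using that by (simp add: c_def)
  have "c \<in> GZ"
    unfolding Z2_Cstar_iff[OF G.is_group]
  proof (intro conjI ballI)
    fix x y z assume [simp]: "x \<in> carrier G" "y \<in> carrier G" "z \<in> carrier G"
    \<comment> \<open>The 1-cocycle rule splits the character at \<open>p x \<cdot> p y\<close>. The
      same three character values arise from the right-hand side by \<open>\<alpha>_mult\<close>,
      and its remaining \<beta>-term is absorbed by the relation for \<omega>.\<close>
    have "c (x, y) * c (x \<odot> y, z) = \<pi> (p x) (p x \<triangleright> \<alpha> y) * \<pi> (p x) (p x \<triangleright> p y \<triangleright> \<alpha> z)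
        * \<pi> (p y) (p y \<triangleright> \<alpha> z) * (\<omega> (p x) (p y) * \<omega> (p x \<cdot> p y) (p z))"
      by (simp add: c \<alpha> cocyc_prod[OF \<pi>] act_act)
    also have "\<dots> = c (x, y \<odot> z) * c (y, z)"
      by (simp add: c \<alpha> \<alpha>_mult \<beta> cocyc_mult[OF \<pi>] \<omega>)
    finally show "c (x, y) * c (x \<odot> y, z) = c (x, y \<odot> z) * c (y, z)" .
  qed (auto simp: c_def \<omega>_nz cocyc_nonzero[OF \<pi>] \<alpha>)
  \<comment> \<open>On A the cocycle is constant because \<pi> is trivial at the identity, so the
    constant itself serves as \<chi>.\<close>
  moreover have "splits (\<lambda>_. \<omega> \<one>\<^bsub>Q\<^esub> \<one>\<^bsub>Q\<^esub>) c"
    by (simp add: splits_def \<omega>_nz c cocyc_one[OF \<pi>] \<alpha>)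
  moreover have "commutes (\<lambda>_. \<omega> \<one>\<^bsub>Q\<^esub> \<one>\<^bsub>Q\<^esub>) \<pi> c"
    unfolding commutes_def
  proof (intro ballI)
    fix x a assume [simp]: "x \<in> carrier G" "a \<in> carrier A"
    \<comment> \<open>The section need not send 1 to 1. The resulting coordinate \<open>?b\<close>
      of the identity is inverse to \<open>?\<beta>\<close>, so the two corrections below
      cancel.\<close>
    let ?b = "\<alpha> (\<one>\<^bsub>G\<^esub>)" and ?\<beta> = "\<beta> (\<one>\<^bsub>Q\<^esub>, \<one>\<^bsub>Q\<^esub>)"
    have [simp]: "?b \<in> carrier A" "?\<beta> \<in> carrier A" by (simp_all add: \<alpha> \<beta>)
    have "?b = ?b \<oplus> ?b \<oplus> ?\<beta>" using \<alpha>_mult[of "\<one>\<^bsub>G\<^esub>" "\<one>\<^bsub>G\<^esub>"] by simp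
    then have "?b \<oplus> (?b \<oplus> ?\<beta>) = ?b" by (simp add: A.m_assoc)
    then have b\<beta>: "?b \<oplus> ?\<beta> = \<one>\<^bsub>A\<^esub>" by simp
    have "\<iota> a = \<iota> a \<odot> \<iota> ?b \<odot> s \<one>\<^bsub>Q\<^esub>" using \<alpha>(2)[of "\<one>\<^bsub>G\<^esub>"] by (simp add: G.m_assoc s)
    then have \<alpha>a: "\<alpha> (\<iota> a) = a \<oplus> ?b"
      by (intro \<alpha>_eqI) (simp_all)
    have 1: "\<omega> \<one>\<^bsub>Q\<^esub> (p x) = \<omega> \<one>\<^bsub>Q\<^esub> \<one>\<^bsub>Q\<^esub>"
      using \<omega>[of "\<one>\<^bsub>Q\<^esub>" "\<one>\<^bsub>Q\<^esub>" "p x"] \<omega>_nz[of "\<one>\<^bsub>Q\<^esub>" "p x"]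
      by (simp add: \<beta> cocyc_one[OF \<pi>])
    have 2: "\<omega> (p x) \<one>\<^bsub>Q\<^esub> = \<pi> (p x) (p x \<triangleright> ?\<beta>) * \<omega> \<one>\<^bsub>Q\<^esub> \<one>\<^bsub>Q\<^esub>"
      using \<omega>[of "p x" "\<one>\<^bsub>Q\<^esub>" "\<one>\<^bsub>Q\<^esub>"] \<omega>_nz[of "p x" "\<one>\<^bsub>Q\<^esub>"] by simp
    have "\<pi> (p x) (p x \<triangleright> ?b) * \<pi> (p x) (p x \<triangleright> ?\<beta>) = \<pi> (p x) (p x \<triangleright> (?b \<oplus> ?\<beta>))"
      by (simp add: cocyc_mult[OF \<pi>])
    also have "\<dots> = 1"
      using cocyc_mult[OF \<pi>, of "p x" "\<one>\<^bsub>A\<^esub>" "\<one>\<^bsub>A\<^esub>"] cocyc_nonzero[OF \<pi>, of "p x" "\<one>\<^bsub>A\<^esub>"]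
      by (simp add: b\<beta>)
    finally have 3: "\<pi> (p x) (p x \<triangleright> ?b) * \<pi> (p x) (p x \<triangleright> ?\<beta>) = 1" .
    have "c (x, \<iota> a) = \<pi> (p x) (p x \<triangleright> a) * (\<pi> (p x) (p x \<triangleright> ?b) * \<pi> (p x) (p x \<triangleright> ?\<beta>)) * \<omega> \<one>\<^bsub>Q\<^esub> \<one>\<^bsub>Q\<^esub>"
      by (simp add: c \<alpha>a 2 cocyc_mult[OF \<pi>])
    then show "c (x, \<iota> a) * \<omega> \<one>\<^bsub>Q\<^esub> \<one>\<^bsub>Q\<^esub>
        = \<pi> (p x) (p x \<triangleright> a) * c (\<iota> (p x \<triangleright> a), x) * \<omega> \<one>\<^bsub>Q\<^esub> \<one>\<^bsub>Q\<^esub>"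
      unfolding 3 by (simp add: c 1 cocyc_one[OF \<pi>] \<alpha>)
  qed
  ultimately show ?thesis using \<pi> by (auto simp: associated_def)
qed

end

section \<open>Characters and matrices\<close>

text \<open>Enumerating both index sets turns the array into a square matrix, and a matrix and its
  transpose have the same determinant.\<close>

lemma trivial_kernel_transpose:
  fixes M :: "'i \<Rightarrow> 'j \<Rightarrow> complex"
  assumes fin: "finite I" "finite J" and card: "card I = card J"
    and ker: "\<And>w. \<forall>i\<in>I. (\<Sum>j\<in>J. M i j * w j) = 0 \<Longrightarrow> \<forall>j\<in>J. w j = 0"
    and v: "\<forall>j\<in>J. (\<Sum>i\<in>I. M i j * v i) = 0"
  shows "\<forall>i\<in>I. v i = 0"
proof -
  define n where "n = card I"
  obtain e where e: "bij_betw e {0..<n} I" using ex_bij_betw_nat_finite[OF fin(1)] n_def by metis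
  obtain e' where e': "bij_betw e' {0..<n} J" using ex_bij_betw_nat_finite[OF fin(2)] n_def card by metis
  define N where "N = mat n n (\<lambda>(i, j). M (e i) (e' j))"
  have N: "N \<in> carrier_mat n n" by (simp add: N_def)
  have "det N \<noteq> 0"
  proof
    assume "det N = 0"
    then obtain u where u: "u \<in> carrier_vec n" "u \<noteq> 0\<^sub>v n" "N *\<^sub>v u = 0\<^sub>v n"
      using det_0_iff_vec_prod_zero[OF N] by blast
    define w where "w j = u $ (inv_into {0..<n} e' j)" for j
    have w: "w (e' j) = u $ j" if "j < n" for j
      using e' that by (simp add: w_def bij_betw_def)
    have "(\<Sum>j\<in>J. M (e i) j * w j) = 0" if "i < n" for i
    proof -
      have "(\<Sum>j\<in>J. M (e i) j * w j) = (\<Sum>j\<in>{0..<n}. M (e i) (e' j) * w (e' j))"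
        by (rule sum.reindex_bij_betw[OF e', symmetric])
      also have "\<dots> = (N *\<^sub>v u) $ i"
        using that u(1) by (auto simp: N_def scalar_prod_def w intro!: sum.cong)
      finally show ?thesis using u(3) that by simp
    qed
    then have "\<forall>i\<in>I. (\<Sum>j\<in>J. M i j * w j) = 0" using e by (auto simp: bij_betw_def)
    from ker[OF this] have "u $ j = 0" if "j < n" for j
      using that w e' by (force simp: bij_betw_def)
    with u show False by auto
  qed
  then have T: "det (transpose_mat N) \<noteq> 0" using det_transpose[OF N] by simp
  define x where "x = vec n (\<lambda>i. v (e i))"
  have x: "x \<in> carrier_vec n" by (simp add: x_def)
  have "transpose_mat N *\<^sub>v x = 0\<^sub>v n"
  proof (rule eq_vecI)
    fix j assume "j < dim_vec (0\<^sub>v n :: complex vec)"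
    then have j: "j < n" by simp
    have "(transpose_mat N *\<^sub>v x) $ j = (\<Sum>i\<in>{0..<n}. M (e i) (e' j) * v (e i))"
      using j by (auto simp: N_def x_def scalar_prod_def intro!: sum.cong)
    also have "\<dots> = (\<Sum>i\<in>I. M i (e' j) * v i)"
      by (rule sum.reindex_bij_betw[OF e])
    finally show "(transpose_mat N *\<^sub>v x) $ j = 0\<^sub>v n $ j"
      using v e' j by (auto simp: bij_betw_def)
  qed (simp add: N_def)
  then have "x = 0\<^sub>v n" using T x det_0_iff_vec_prod_zero[of "transpose_mat N" n] N by auto
  then have "v (e i) = 0" if "i < n" for i using that by (metis index_vec index_zero_vec(1) x_def)
  then show ?thesis using e by (auto simp: bij_betw_def)
qed

lemma mult_mat_entry:
  "X \<in> carrier_mat n n \<Longrightarrow> Y \<in> carrier_mat n n \<Longrightarrow> i < n \<Longrightarrow> j < n \<Longrightarrow>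
    (X * Y) $$ (i, j) = (\<Sum>k = 0..<n. X $$ (i, k) * Y $$ (k, j))"
  by (simp add: scalar_prod_def)

text \<open>Translation by \<open>b\<close> permutes the group and multiplies the sum by
  \<open>\<phi> b\<close>, which differs from 1.\<close>

lemma (in group) character_sum:
  fixes \<phi> :: "'a \<Rightarrow> complex"
  assumes "finite (carrier G)" and mult: "\<And>a b. a \<in> carrier G \<Longrightarrow> b \<in> carrier G \<Longrightarrow> \<phi> (a \<otimes> b) = \<phi> a * \<phi> b"
    and b: "b \<in> carrier G" "\<phi> b \<noteq> 1"
  shows "(\<Sum>a\<in>carrier G. \<phi> a) = 0"
proof -
  have "bij_betw (\<lambda>a. b \<otimes> a) (carrier G) (carrier G)"
    by (rule bij_betwI[of _ _ _ "\<lambda>a. inv b \<otimes> a"]) (use b in \<open>auto simp flip: m_assoc\<close>)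
  then have "(\<Sum>a\<in>carrier G. \<phi> a) = (\<Sum>a\<in>carrier G. \<phi> (b \<otimes> a))"
    by (rule sum.reindex_bij_betw[symmetric])
  also have "\<dots> = \<phi> b * (\<Sum>a\<in>carrier G. \<phi> a)"
    using b by (simp add: mult sum_distrib_left)
  finally show ?thesis using b(2) by simp
qed

lemma (in group) dual_orthogonality:
  assumes "finite (carrier G)" and "\<chi> \<in> carrier (dual_group G)" "\<psi> \<in> carrier (dual_group G)" "\<chi> \<noteq> \<psi>"
  shows "(\<Sum>a\<in>carrier G. \<chi> a / \<psi> a) = 0"
proof -
  have "\<exists>b\<in>carrier G. \<chi> b \<noteq> \<psi> b"
    using assms by (auto simp: mem_dual_group intro: extensionalityI)
  then obtain b where "b \<in> carrier G" "\<chi> b \<noteq> \<psi> b" by blast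
  then show ?thesis
    using assms by (intro character_sum[of "\<lambda>a. \<chi> a / \<psi> a" b]) (auto simp: mem_dual_group)
qed

text \<open>Multiplying a nonzero matrix by matrix units on both sides isolates a nonzero entry, so an
  additive multiplicative map that kills it also kills the diagonal matrix units and their sum.\<close>

lemma matrix_algebra_simple:
  fixes K :: "complex mat" and \<phi> :: "complex mat \<Rightarrow> complex mat"
  assumes K: "K \<in> carrier_mat n n" "K \<noteq> 0\<^sub>m n n" "\<phi> K = 0\<^sub>m n n"
    and closed: "\<And>X. X \<in> carrier_mat n n \<Longrightarrow> \<phi> X \<in> carrier_mat n n"
    and add: "\<And>X Y. X \<in> carrier_mat n n \<Longrightarrow> Y \<in> carrier_mat n n \<Longrightarrow> \<phi> (X + Y) = \<phi> X + \<phi> Y"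
    and mult: "\<And>X Y. X \<in> carrier_mat n n \<Longrightarrow> Y \<in> carrier_mat n n \<Longrightarrow> \<phi> (X * Y) = \<phi> X * \<phi> Y"
  shows "\<phi> (1\<^sub>m n) = 0\<^sub>m n n"
proof -
  have "\<exists>i<n. \<exists>j<n. K $$ (i, j) \<noteq> 0"
  proof (rule ccontr)
    assume "\<not> ?thesis"
    then have "K = 0\<^sub>m n n" using K(1) by (intro eq_matI) auto
    with K(2) show False by simp
  qed
  then obtain i j where ij: "i < n" "j < n" "K $$ (i, j) \<noteq> 0" by blast
  have unit: "\<phi> (mat n n (\<lambda>(r, s). if r = l \<and> s = l then 1 else 0)) = 0\<^sub>m n n" if l: "l < n" for l
  proof -
    \<comment> \<open>\<open>P\<close> is the matrix unit at \<open>(l, i)\<close> and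
      \<open>R\<close> the one at \<open>(j, l)\<close> divided by the chosen entry, so
      \<open>P * K * R\<close> is the matrix unit at \<open>(l, l)\<close>.\<close>
    define P where "P = mat n n (\<lambda>(r, s). if r = l \<and> s = i then 1 else 0 :: complex)"
    define R where "R = mat n n (\<lambda>(r, s). if r = j \<and> s = l then 1 / K $$ (i, j) else 0)"
    have PR: "P \<in> carrier_mat n n" "R \<in> carrier_mat n n" by (simp_all add: P_def R_def)
    have PK: "(P * K) $$ (r, s) = (if r = l then K $$ (i, s) else 0)" if "r < n" "s < n" for r s
    proof -
      have "(P * K) $$ (r, s) = (\<Sum>t = 0..<n. (if r = l \<and> t = i then 1 else 0) * K $$ (t, s))"
        unfolding mult_mat_entry[OF PR(1) K(1) that] using that by (intro sum.cong) (auto simp: P_def)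
      also have "\<dots> = (\<Sum>t = 0..<n. if t = i then (if r = l then K $$ (i, s) else 0) else 0)"
        by (rule sum.cong) auto
      finally show ?thesis using ij by simp
    qed
    have "mat n n (\<lambda>(r, s). if r = l \<and> s = l then 1 else 0) = P * K * R"
    proof (rule eq_matI)
      fix r s assume "r < dim_row (P * K * R)" "s < dim_col (P * K * R)"
      then have rs: "r < n" "s < n" by (simp_all add: P_def R_def)
      have PKc: "P * K \<in> carrier_mat n n" using PR K by simp
      have "(P * K * R) $$ (r, s) = (\<Sum>t = 0..<n. (P * K) $$ (r, t) * R $$ (t, s))"
        by (rule mult_mat_entry[OF PKc PR(2) rs])
      also have "\<dots> = (\<Sum>t = 0..<n. if t = j then (if r = l \<and> s = l then 1 else 0) else 0)"
        using rs ij by (intro sum.cong) (auto simp: PK R_def)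
      also have "\<dots> = (if r = l \<and> s = l then 1 else 0)" using ij by simp
      finally show "mat n n (\<lambda>(r, s). if r = l \<and> s = l then 1 else 0) $$ (r, s) = (P * K * R) $$ (r, s)"
        using rs by simp
    qed (simp_all add: P_def R_def)
    moreover have "\<phi> (P * K * R) = \<phi> P * \<phi> K * \<phi> R"
      using PR K(1) by (simp only: mult mult_carrier_mat)
    moreover have "\<dots> = 0\<^sub>m n n"
      using closed[OF PR(1)] closed[OF PR(2)] K(3) by simp
    ultimately show ?thesis by simp
  qed
  have "\<phi> (mat n n (\<lambda>(r, s). if r = s \<and> r < m then 1 else 0)) = 0\<^sub>m n n" if "m \<le> n" for m
    using that
  proof (induction m)
    case 0
    \<comment> \<open>That \<phi> kills the zero matrix comes from multiplicativity: the zero matrix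
      is a multiple of \<open>K\<close>.\<close>
    have "mat n n (\<lambda>(r, s). if r = s \<and> r < (0::nat) then 1 else 0) = 0\<^sub>m n n * K"
      using K(1) by (intro eq_matI) auto
    moreover have "\<phi> (0\<^sub>m n n * K) = 0\<^sub>m n n"
      using K(1,3) closed[of "0\<^sub>m n n"] by (subst mult) auto
    ultimately show ?case by (simp only:)
  next
    case (Suc m)
    have "mat n n (\<lambda>(r, s). if r = s \<and> r < Suc m then 1 else 0 :: complex)
      = mat n n (\<lambda>(r, s). if r = s \<and> r < m then 1 else 0) + mat n n (\<lambda>(r, s). if r = m \<and> s = m then 1 else 0)"
      by (intro eq_matI) auto
    then show ?case using Suc by (simp add: add unit)
  qed
  from this[of n] have "\<phi> (mat n n (\<lambda>(r, s). if r = s \<and> r < n then 1 else 0)) = 0\<^sub>m n n" by simp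
  moreover have "mat n n (\<lambda>(r, s). if r = s \<and> r < n then 1 else 0) = (1\<^sub>m n :: complex mat)"
    by (intro eq_matI) auto
  ultimately show ?thesis by (simp only:)
qed

section \<open>The character matrix of a 1-cocycle\<close>

context abelian_extension
begin

context
  fixes \<pi>
  assumes finA: "finite (carrier A)" and finQ: "finite (carrier Q)" and ord: "order A = order Q"
    and \<pi>: "\<pi> \<in> cocyc"
begin

lemma dual_cocyc: "g \<in> carrier Q \<Longrightarrow> \<pi> g \<in> carrier (dual_group A)"
  using \<pi> by (auto simp: mem_cocyc)

lemma card_AQ: "card (carrier A) = card (carrier Q)"
  using ord by (simp add: Coset.order_def)

lemma card_A_nonzero: "(of_nat (card (carrier A)) :: complex) \<noteq> 0"
  using finA A.one_closed by auto

lemma cocycle_orthogonality: 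
  assumes "inj_on \<pi> (carrier Q)" "g \<in> carrier Q" "h \<in> carrier Q"
  shows "(\<Sum>a\<in>carrier A. \<pi> g a / \<pi> h a) = (if g = h then of_nat (card (carrier A)) else 0)"
proof (cases "g = h")
  case True
  then show ?thesis using assms by (simp add: cocyc_nonzero[OF \<pi>])
next
  case False
  then have "\<pi> g \<noteq> \<pi> h" using assms by (auto dest: inj_onD)
  then show ?thesis using A.dual_orthogonality[OF finA dual_cocyc dual_cocyc] assms False by simp
qed

text \<open>The matrix is square because \<open>|A| = |Q|\<close>, so its transpose may be treated
  instead. There a null vector is a linear relation among distinct characters, and pairing it with
  \<open>\<pi> h\<close> isolates the coefficient at \<open>h\<close>.\<close>

lemma character_matrix_kernel:
  assumes inj: "inj_on \<pi> (carrier Q)"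
    and w: "\<forall>g\<in>carrier Q. (\<Sum>a\<in>carrier A. 1 / \<pi> g a * w a) = 0"
  shows "\<forall>a\<in>carrier A. w a = 0"
proof (rule trivial_kernel_transpose[where M = "\<lambda>a g. 1 / \<pi> g a" and I = "carrier A" and J = "carrier Q"])
  fix v assume v: "\<forall>a\<in>carrier A. (\<Sum>g\<in>carrier Q. 1 / \<pi> g a * v g) = 0"
  show "\<forall>g\<in>carrier Q. v g = 0"
  proof
    fix h assume h: "h \<in> carrier Q"
    have "0 = (\<Sum>a\<in>carrier A. \<pi> h a * (\<Sum>g\<in>carrier Q. 1 / \<pi> g a * v g))"
      using v by simp
    also have "\<dots> = (\<Sum>g\<in>carrier Q. (\<Sum>a\<in>carrier A. \<pi> h a / \<pi> g a) * v g)"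
      unfolding sum_distrib_left sum_distrib_right by (subst sum.swap) simp
    also have "\<dots> = (\<Sum>g\<in>carrier Q. if g = h then of_nat (card (carrier A)) * v h else 0)"
      by (rule sum.cong) (auto simp: cocycle_orthogonality[OF inj h])
    also have "\<dots> = of_nat (card (carrier A)) * v h"
      using finQ h by simp
    finally show "v h = 0" using card_A_nonzero by simp
  qed
qed (use finA finQ card_AQ w in auto)

text \<open>Fourier inversion: by orthogonality the matrix of values of \<pi>, divided by
  \<open>|A|\<close>, is an explicit right inverse.\<close>

lemma character_matrix_surj:
  assumes inj: "inj_on \<pi> (carrier Q)"
  shows "\<exists>w. \<forall>g\<in>carrier Q. (\<Sum>a\<in>carrier A. 1 / \<pi> g a * w a) = y g"
proof -
  let ?N = "of_nat (card (carrier A)) :: complex"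
  define w where "w a = (\<Sum>h\<in>carrier Q. \<pi> h a * y h / ?N)" for a
  have "(\<Sum>a\<in>carrier A. 1 / \<pi> g a * w a) = y g" if g: "g \<in> carrier Q" for g
  proof -
    have "(\<Sum>a\<in>carrier A. 1 / \<pi> g a * w a) = (\<Sum>h\<in>carrier Q. (\<Sum>a\<in>carrier A. \<pi> h a / \<pi> g a) * (y h / ?N))"
      unfolding sum_distrib_left sum_distrib_right w_def by (subst sum.swap) simp
    also have "\<dots> = (\<Sum>h\<in>carrier Q. if h = g then y g else 0)"
      using card_A_nonzero by (intro sum.cong) (auto simp: cocycle_orthogonality[OF inj _ g])
    also have "\<dots> = y g" using finQ g by simp
    finally show ?thesis .
  qed
  then show ?thesis by blast
qed

text \<open>A character missed by \<pi> would be orthogonal to every row and hence lie in the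
  kernel, although it does not vanish at 1. A repeated character would give two equal rows, which
  invertibility of a square matrix forbids.\<close>

lemma bijective_from_kernel:
  assumes ker: "\<And>w. \<forall>g\<in>carrier Q. (\<Sum>a\<in>carrier A. 1 / \<pi> g a * w a) = 0 \<Longrightarrow> \<forall>a\<in>carrier A. w a = 0"
  shows "bij_betw \<pi> (carrier Q) (carrier (dual_group A))"
  unfolding bij_betw_def
proof
  show "\<pi> ` carrier Q = carrier (dual_group A)"
  proof (intro equalityI subsetI)
    fix \<chi> assume \<chi>: "\<chi> \<in> carrier (dual_group A)"
    show "\<chi> \<in> \<pi> ` carrier Q"
    proof (rule ccontr)
      assume "\<chi> \<notin> \<pi> ` carrier Q"
      then have "\<forall>g\<in>carrier Q. (\<Sum>a\<in>carrier A. 1 / \<pi> g a * \<chi> a) = 0"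
        using A.dual_orthogonality[OF finA \<chi> dual_cocyc] by fastforce
      from ker[OF this] have "\<chi> \<one>\<^bsub>A\<^esub> = 0" by simp
      with \<chi> show False by (simp add: mem_dual_group)
    qed
  qed (auto simp: dual_cocyc)
  show "inj_on \<pi> (carrier Q)"
  proof (rule inj_onI, rule ccontr)
    fix g h assume gh: "g \<in> carrier Q" "h \<in> carrier Q" "\<pi> g = \<pi> h" "g \<noteq> h"
    \<comment> \<open>The relation row \<open>g\<close> minus row \<open>h\<close>, a null vector of
      the transpose.\<close>
    define v where "v k = (if k = g then 1 else if k = h then -1 else 0 :: complex)" for k
    have "(\<Sum>k\<in>carrier Q. 1 / \<pi> k a * v k) = 0" for a
    proof -
      have "(\<Sum>k\<in>carrier Q. 1 / \<pi> k a * v k)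
        = (\<Sum>k\<in>carrier Q. (if k = g then 1 / \<pi> g a else 0) - (if k = h then 1 / \<pi> g a else 0))"
        using gh by (intro sum.cong) (auto simp: v_def)
      then show ?thesis using finQ gh by (simp add: sum_subtractf)
    qed
    then have "\<forall>k\<in>carrier Q. v k = 0"
      using trivial_kernel_transpose[where M = "\<lambda>k a. 1 / \<pi> k a" and v = v, OF finQ finA card_AQ[symmetric] ker]
      by blast
    then show False using gh by (auto simp: v_def)
  qed
qed

end

section \<open>The induced module and non-degeneracy\<close>

text \<open>The coefficient of \<open>U\<^sub>x\<close> acting on the basis vector \<open>v\<^sub>h\<close> of the module induced from the
  one-dimensional module of the twisted group algebra of \<open>A\<close> on which \<open>U\<^sub>a\<close> acts as \<open>\<chi>(a)\<close>.\<close>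

definition kernel_part :: "('q \<Rightarrow> 'g) \<Rightarrow> 'g \<Rightarrow> 'q \<Rightarrow> 'a" where
  "kernel_part s x h = (SOME a. a \<in> carrier A \<and> s (p x \<cdot> h) \<odot> \<iota> a = x \<odot> s h)"

text \<open>The basis vector at \<open>h\<close> is \<open>U_(s h)\<close> applied to the generator.
  Multiplying by \<open>U_x\<close> gives \<open>c (x, s h)\<close>; splitting
  \<open>x \<odot> s h\<close> as a lift times an element of A divides by the second value of
  \<open>c\<close>; and the A-part acts on the generator through \<chi>.\<close>

definition induced_coeff :: "('q \<Rightarrow> 'g) \<Rightarrow> ('a \<Rightarrow> complex) \<Rightarrow> ('g \<times> 'g \<Rightarrow> complex) \<Rightarrow> 'g \<Rightarrow> 'q \<Rightarrow> complex" where
  "induced_coeff s \<chi> c x h =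
     c (x, s h) * \<chi> (kernel_part s x h) / c (s (p x \<cdot> h), \<iota> (kernel_part s x h))"

text \<open>The matrix entry in row \<open>k\<close> and column \<open>h\<close>: \<open>U_x\<close>
  moves the basis vector at \<open>h\<close> to a multiple of the one at
  \<open>p x \<cdot> h\<close>, which selects the contributing \<open>x\<close>.\<close>

definition induced_rep :: "('q \<Rightarrow> 'g) \<Rightarrow> ('a \<Rightarrow> complex) \<Rightarrow> ('g \<times> 'g \<Rightarrow> complex)
    \<Rightarrow> ('g \<Rightarrow> complex) \<Rightarrow> 'q \<Rightarrow> 'q \<Rightarrow> complex" where
  "induced_rep s \<chi> c u k h = (\<Sum>x\<in>carrier G. if p x \<cdot> h = k then u x * induced_coeff s \<chi> c x h else 0)"

section \<open>Coefficients of the induced module\<close>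

context
  fixes s c \<chi> \<pi>
  assumes s: "\<And>g. g \<in> carrier Q \<Longrightarrow> s g \<in> carrier G" "\<And>g. g \<in> carrier Q \<Longrightarrow> p (s g) = g"
    and c: "c \<in> GZ" and \<chi>: "splits \<chi> c" and comm: "commutes \<chi> \<pi> c" and \<pi>: "\<pi> \<in> cocyc"
    and finA: "finite (carrier A)" and finQ: "finite (carrier Q)" and ord: "order A = order Q"
begin

abbreviation (input) "\<kappa> \<equiv> kernel_part s"
abbreviation (input) "\<rho> \<equiv> induced_coeff s \<chi> c"
abbreviation (input) "R \<equiv> induced_rep s \<chi> c"
abbreviation (input) "\<A> \<equiv> twisted_group_algebra G c"

lemma kernel_part:
  assumes "x \<in> carrier G" "h \<in> carrier Q"
  shows "\<kappa> x h \<in> carrier A" "s (p x \<cdot> h) \<odot> \<iota> (\<kappa> x h) = x \<odot> s h"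
proof -
  have "\<exists>a\<in>carrier A. x \<odot> s h = \<iota> a \<odot> s (p x \<cdot> h)"
    using assms by (intro lift_kernel) (simp_all add: s)
  then obtain a where a: "a \<in> carrier A" "x \<odot> s h = \<iota> a \<odot> s (p x \<cdot> h)" by blast
  let ?k = "p x \<cdot> h"
  \<comment> \<open>\<open>lift_kernel\<close> leaves the element of A on the left; the inverse
    action carries it to the right of \<open>s ?k\<close>.\<close>
  have "s ?k \<odot> \<iota> ((inv\<^bsub>Q\<^esub> ?k) \<triangleright> a) = x \<odot> s h"
    using act_comm[of "s ?k" "(inv\<^bsub>Q\<^esub> ?k) \<triangleright> a"] a assms by (simp add: s)
  with a assms have "\<exists>a. a \<in> carrier A \<and> s ?k \<odot> \<iota> a = x \<odot> s h"
    by (intro exI[of _ "(inv\<^bsub>Q\<^esub> ?k) \<triangleright> a"]) simp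
  from someI_ex[OF this] show "\<kappa> x h \<in> carrier A" "s (p x \<cdot> h) \<odot> \<iota> (\<kappa> x h) = x \<odot> s h"
    by (auto simp: kernel_part_def)
qed

lemma kernel_part_eqI:
  assumes "x \<in> carrier G" "h \<in> carrier Q" "a \<in> carrier A" "s (p x \<cdot> h) \<odot> \<iota> a = x \<odot> s h"
  shows "\<kappa> x h = a"
proof -
  have "s (p x \<cdot> h) \<odot> \<iota> (\<kappa> x h) = s (p x \<cdot> h) \<odot> \<iota> a"
    using kernel_part[OF assms(1,2)] assms by simp
  then have "\<iota> (\<kappa> x h) = \<iota> a"
    by (subst (asm) G.Units_l_cancel) (simp_all add: s assms kernel_part)
  then show ?thesis using assms kernel_part[OF assms(1,2)] by simp
qed

lemma induced_coeff_nonzero: "x \<in> carrier G \<Longrightarrow> h \<in> carrier Q \<Longrightarrow> \<rho> x h \<noteq> 0"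
  by (simp add: induced_coeff_def GZ_nonzero[OF c] splits_nonzero[OF c \<chi>] kernel_part s)

text \<open>This is the module law for \<open>U_x U_y\<close> on the basis vector at
  \<open>h\<close>. The A-parts of the two steps multiply, and after three cocycle identities the
  common value \<open>c (x \<odot> s k, \<iota> a)\<close> cancels.\<close>

lemma induced_coeff_mult:
  assumes [simp]: "x \<in> carrier G" "y \<in> carrier G" "h \<in> carrier Q"
  shows "\<rho> y h * \<rho> x (p y \<cdot> h) = c (x, y) * \<rho> (x \<odot> y) h"
proof -
  note [simp] = GZ_nonzero[OF c] splits_nonzero[OF c \<chi>] s
  define k l where "k = p y \<cdot> h" and "l = p x \<cdot> k"
  have [simp]: "k \<in> carrier Q" "l \<in> carrier Q" by (simp_all add: k_def l_def)
  define a b where "a = \<kappa> y h" and "b = \<kappa> x k"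
  have [simp]: "a \<in> carrier A" "b \<in> carrier A" by (simp_all add: a_def b_def kernel_part)
  have a: "s k \<odot> \<iota> a = y \<odot> s h" and b: "s l \<odot> \<iota> b = x \<odot> s k"
    using kernel_part[of y h] kernel_part[of x k] by (simp_all add: a_def b_def k_def l_def)
  have pk: "p x \<cdot> p y \<cdot> h = l" by (simp add: k_def l_def Q.m_assoc)
  have ba: "\<kappa> (x \<odot> y) h = b \<oplus> a"
  proof (rule kernel_part_eqI)
    have "s l \<odot> \<iota> (b \<oplus> a) = (s l \<odot> \<iota> b) \<odot> \<iota> a" by (simp add: G.m_assoc)
    also have "\<dots> = x \<odot> (s k \<odot> \<iota> a)" by (simp add: b G.m_assoc)
    finally show "s (p (x \<odot> y) \<cdot> h) \<odot> \<iota> (b \<oplus> a) = x \<odot> y \<odot> s h"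
      by (simp add: a pk G.m_assoc)
  qed simp_all
  have e1: "c (x \<odot> y, s h) = c (x, y \<odot> s h) * c (y, s h) / c (x, y)"
    using GZ_cocycle[OF c, of x y "s h"] by (simp add: eq_divide_eq mult.commute)
  have e2: "c (x, y \<odot> s h) = c (x, s k) * c (x \<odot> s k, \<iota> a) / c (s k, \<iota> a)"
    using GZ_cocycle[OF c, of x "s k" "\<iota> a"] by (simp add: eq_divide_eq a)
  have e3: "c (s l, \<iota> b \<odot> \<iota> a) = c (s l, \<iota> b) * c (x \<odot> s k, \<iota> a) / c (\<iota> b, \<iota> a)"
    using GZ_cocycle[OF c, of "s l" "\<iota> b" "\<iota> a"] by (simp add: eq_divide_eq b)
  have nz: "c (x \<odot> s k, \<iota> a) \<noteq> 0" by simp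
  show ?thesis
    unfolding induced_coeff_def using nz
    by (simp add: k_def[symmetric] l_def[symmetric] a_def[symmetric] b_def[symmetric] ba pk
        e1 e2 e3 splits_mult[OF c \<chi>] mult_ac)
qed

text \<open>Moving \<open>U_a\<close> past \<open>U_(s h)\<close> replaces \<open>a\<close> by its
  image under the inverse of \<open>h\<close>, and \<open>commutes\<close> gives the cost in terms
  of \<pi>. So A acts diagonally, by characters that distinguish basis vectors as far as \<pi>
  does.\<close>

lemma induced_coeff_\<iota>:
  assumes [simp]: "a \<in> carrier A" "h \<in> carrier Q"
  shows "\<rho> (\<iota> a) h = \<chi> a / \<pi> h a"
proof -
  note [simp] = GZ_nonzero[OF c] splits_nonzero[OF c \<chi>] s cocyc_nonzero[OF \<pi>]
  let ?b = "(inv\<^bsub>Q\<^esub> h) \<triangleright> a"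
  have "\<kappa> (\<iota> a) h = ?b"
    using act_comm[of "s h" ?b] by (intro kernel_part_eqI) simp_all
  moreover have "c (s h, \<iota> ?b) * \<chi> a = \<pi> h a * c (\<iota> a, s h) * \<chi> ?b"
    using comm[unfolded commutes_def, rule_format, of "s h" ?b] by simp
  ultimately show ?thesis
    by (simp add: induced_coeff_def frac_eq_eq mult_ac)
qed

section \<open>Matrix entries of the induced representation\<close>

lemma finite_G: "finite (carrier G)" and card_G: "card (carrier G) = card (carrier A) * card (carrier Q)"
  and bij_AQ: "bij_betw (\<lambda>(a, g). \<iota> a \<odot> s g) (carrier A \<times> carrier Q) (carrier G)"
proof -
  show bij: "bij_betw (\<lambda>(a, g). \<iota> a \<odot> s g) (carrier A \<times> carrier Q) (carrier G)"
    unfolding bij_betw_def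
  proof
    show "inj_on (\<lambda>(a, g). \<iota> a \<odot> s g) (carrier A \<times> carrier Q)"
    proof (rule inj_onI, clarsimp)
      fix a g b h assume "a \<in> carrier A" "g \<in> carrier Q" "b \<in> carrier A" "h \<in> carrier Q"
        and eq: "\<iota> a \<odot> s g = \<iota> b \<odot> s h"
      moreover have "p (\<iota> a \<odot> s g) = p (\<iota> b \<odot> s h)" unfolding eq ..
      then have "g = h" using calculation(1-4) by (simp add: s)
      ultimately show "a = b \<and> g = h" by (simp add: s)
    qed
    show "(\<lambda>(a, g). \<iota> a \<odot> s g) ` (carrier A \<times> carrier Q) = carrier G"
    proof (intro equalityI subsetI)
      fix x assume x: "x \<in> carrier G"
      then obtain a where "a \<in> carrier A" "x = \<iota> a \<odot> s (p x)"
        using lift_kernel[of x "s (p x)"] by (auto simp: s)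
      with x show "x \<in> (\<lambda>(a, g). \<iota> a \<odot> s g) ` (carrier A \<times> carrier Q)"
        by (intro image_eqI[of _ _ "(a, p x)"]) simp_all
    qed (auto simp: s)
  qed
  show "finite (carrier G)" using bij_betw_finite[OF bij] finA finQ by simp
  show "card (carrier G) = card (carrier A) * card (carrier Q)"
    using bij_betw_same_card[OF bij] by (simp add: card_cartesian_product)
qed

text \<open>Only the coset of A through \<open>s g\<close> can move \<open>h\<close> to
  \<open>g \<cdot> h\<close>. On it the diagonal action of A turns the entry into a nonzero multiple
  of one row of the character matrix applied to rescaled coordinates. The representation thus
  decouples into one copy of that matrix for each \<open>g\<close>.\<close>

lemma induced_rep_entry:
  assumes g: "g \<in> carrier Q" and h: "h \<in> carrier Q"
  shows "R u (g \<cdot> h) h = \<rho> (s g) h *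
    (\<Sum>a\<in>carrier A. 1 / \<pi> (g \<cdot> h) a * (u (\<iota> a \<odot> s g) * \<chi> a / c (\<iota> a, s g)))"
proof -
  have "R u (g \<cdot> h) h = (\<Sum>(a, k)\<in>carrier A \<times> carrier Q.
      if p (\<iota> a \<odot> s k) \<cdot> h = g \<cdot> h then u (\<iota> a \<odot> s k) * \<rho> (\<iota> a \<odot> s k) h else 0)"
    unfolding induced_rep_def by (subst sum.reindex_bij_betw[OF bij_AQ, symmetric]) (auto intro!: sum.cong)
  also have "\<dots> = (\<Sum>a\<in>carrier A. \<Sum>k\<in>carrier Q.
      if k = g then u (\<iota> a \<odot> s g) * \<rho> (\<iota> a \<odot> s g) h else 0)"
    unfolding sum.cartesian_product[symmetric] using g h
    by (intro sum.cong refl) (auto simp: s)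
  also have "\<dots> = (\<Sum>a\<in>carrier A. u (\<iota> a \<odot> s g) * \<rho> (\<iota> a \<odot> s g) h)"
    using finQ g by simp
  also have "\<dots> = (\<Sum>a\<in>carrier A. \<rho> (s g) h * (1 / \<pi> (g \<cdot> h) a * (u (\<iota> a \<odot> s g) * \<chi> a / c (\<iota> a, s g))))"
  proof (rule sum.cong)
    fix a assume a: "a \<in> carrier A"
    \<comment> \<open>The module law for \<open>\<iota> a\<close> after \<open>s g\<close>, where
      \<open>\<iota> a\<close> acts by its diagonal coefficient at
      \<open>g \<cdot> h\<close>.\<close>
    have "\<rho> (s g) h * (\<chi> a / \<pi> (g \<cdot> h) a) = c (\<iota> a, s g) * \<rho> (\<iota> a \<odot> s g) h"
      using induced_coeff_mult[of "\<iota> a" "s g" h] a g h by (simp add: s induced_coeff_\<iota>)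
    then have "\<rho> (\<iota> a \<odot> s g) h = \<rho> (s g) h * (\<chi> a / \<pi> (g \<cdot> h) a) / c (\<iota> a, s g)"
      using a g GZ_nonzero[OF c] by (simp add: s)
    then show "u (\<iota> a \<odot> s g) * \<rho> (\<iota> a \<odot> s g) h
      = \<rho> (s g) h * (1 / \<pi> (g \<cdot> h) a * (u (\<iota> a \<odot> s g) * \<chi> a / c (\<iota> a, s g)))"
      by simp
  qed simp
  finally show ?thesis by (simp add: sum_distrib_left)
qed

lemma induced_rep_mult:
  assumes h: "h \<in> carrier Q"
  shows "R (u \<otimes>\<^bsub>\<A>\<^esub> v) k h = (\<Sum>m\<in>carrier Q. R u k m * R v m h)"
proof -
  have prod: "(u \<otimes>\<^bsub>\<A>\<^esub> v) x
      = (\<Sum>y\<in>carrier G. \<Sum>z\<in>carrier G. if x = y \<odot> z then u y * v z * c (y, z) else 0)"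
    if "x \<in> carrier G" for x
  proof -
    have "(u \<otimes>\<^bsub>\<A>\<^esub> v) x
      = (\<Sum>(y, z) | y \<in> carrier G \<and> z \<in> carrier G \<and> y \<odot> z = x. u y * v z * c (y, z))"
      using that by (simp add: twisted_group_algebra_def)
    also have "\<dots> = (\<Sum>q\<in>{q \<in> carrier G \<times> carrier G. x = fst q \<odot> snd q}. u (fst q) * v (snd q) * c (fst q, snd q))"
      by (rule sum.cong) auto
    also have "\<dots> = (\<Sum>q\<in>carrier G \<times> carrier G. if x = fst q \<odot> snd q then u (fst q) * v (snd q) * c (fst q, snd q) else 0)"
      using finite_G by (intro sum.inter_filter) simp
    finally show ?thesis by (simp add: sum.cartesian_product case_prod_unfold)
  qed
  have "R (u \<otimes>\<^bsub>\<A>\<^esub> v) k h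
    = (\<Sum>x\<in>carrier G. \<Sum>y\<in>carrier G. \<Sum>z\<in>carrier G.
        if x = y \<odot> z then (if p x \<cdot> h = k then u y * v z * c (y, z) * \<rho> x h else 0) else 0)"
    unfolding induced_rep_def
    by (intro sum.cong refl) (auto simp: prod sum_distrib_right intro!: sum.cong sum.neutral)
  also have "\<dots> = (\<Sum>y\<in>carrier G. \<Sum>x\<in>carrier G. \<Sum>z\<in>carrier G.
        if x = y \<odot> z then (if p x \<cdot> h = k then u y * v z * c (y, z) * \<rho> x h else 0) else 0)"
    by (rule sum.swap)
  also have "\<dots> = (\<Sum>y\<in>carrier G. \<Sum>z\<in>carrier G. \<Sum>x\<in>carrier G.
        if x = y \<odot> z then (if p x \<cdot> h = k then u y * v z * c (y, z) * \<rho> x h else 0) else 0)"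
    by (rule sum.cong[OF refl], rule sum.swap)
  \<comment> \<open>Summing out \<open>x\<close> leaves \<open>x = y \<odot> z\<close>, and the
    module law absorbs \<open>c (y, z)\<close>.\<close>
  also have "\<dots> = (\<Sum>y\<in>carrier G. \<Sum>z\<in>carrier G.
        if p y \<cdot> (p z \<cdot> h) = k then u y * v z * (\<rho> z h * \<rho> y (p z \<cdot> h)) else 0)"
    using h finite_G by (intro sum.cong refl) (auto simp: induced_coeff_mult Q.m_assoc)
  \<comment> \<open>The index \<open>m\<close> of the matrix product is the basis vector reached
    after \<open>z\<close>.\<close>
  also have "\<dots> = (\<Sum>y\<in>carrier G. \<Sum>z\<in>carrier G. \<Sum>m\<in>carrier Q.
        if p z \<cdot> h = m then (if p y \<cdot> m = k then u y * \<rho> y m else 0) * (v z * \<rho> z h) else 0)"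
    using h finQ by (intro sum.cong refl) (auto simp: mult_ac)
  also have "\<dots> = (\<Sum>y\<in>carrier G. \<Sum>m\<in>carrier Q. \<Sum>z\<in>carrier G.
        if p z \<cdot> h = m then (if p y \<cdot> m = k then u y * \<rho> y m else 0) * (v z * \<rho> z h) else 0)"
    by (rule sum.cong[OF refl], rule sum.swap)
  also have "\<dots> = (\<Sum>m\<in>carrier Q. \<Sum>y\<in>carrier G. \<Sum>z\<in>carrier G.
        (if p y \<cdot> m = k then u y * \<rho> y m else 0) * (if p z \<cdot> h = m then v z * \<rho> z h else 0))"
    by (subst sum.swap) (auto intro!: sum.cong)
  finally show ?thesis unfolding induced_rep_def sum_product .
qed

lemma induced_rep_one:
  assumes h: "h \<in> carrier Q"
  shows "R \<one>\<^bsub>\<A>\<^esub> k h = (if k = h then 1 else 0)"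
proof -
  have \<chi>1: "\<chi> \<one>\<^bsub>A\<^esub> = c (\<one>\<^bsub>G\<^esub>, \<one>\<^bsub>G\<^esub>)"
    using splits_mult[OF c \<chi>, of "\<one>\<^bsub>A\<^esub>" "\<one>\<^bsub>A\<^esub>"] splits_nonzero[OF c \<chi>, of "\<one>\<^bsub>A\<^esub>"] GZ_nonzero[OF c, of "\<one>\<^bsub>G\<^esub>" "\<one>\<^bsub>G\<^esub>"]
    by (simp add: eq_divide_eq)
  have \<pi>1: "\<pi> h \<one>\<^bsub>A\<^esub> = 1" if h: "h \<in> carrier Q" for h
    using cocyc_mult[OF \<pi> h, of "\<one>\<^bsub>A\<^esub>" "\<one>\<^bsub>A\<^esub>"] cocyc_nonzero[OF \<pi> h, of "\<one>\<^bsub>A\<^esub>"] by simp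
  have \<rho>1: "\<rho> \<one>\<^bsub>G\<^esub> h = c (\<one>\<^bsub>G\<^esub>, \<one>\<^bsub>G\<^esub>)" if h: "h \<in> carrier Q" for h
    using induced_coeff_\<iota>[of "\<one>\<^bsub>A\<^esub>" h] h by (simp add: \<chi>1 \<pi>1)
  have "R \<one>\<^bsub>\<A>\<^esub> k h
    = (\<Sum>x\<in>carrier G. if x = \<one>\<^bsub>G\<^esub> then (if h = k then 1 else 0) else 0)"
    unfolding induced_rep_def using h GZ_nonzero[OF c, of "\<one>\<^bsub>G\<^esub>" "\<one>\<^bsub>G\<^esub>"]
    by (intro sum.cong refl) (auto simp: twisted_group_algebra_def \<rho>1)
  then show ?thesis using finite_G by auto
qed

section \<open>Kernel and image of the induced representation\<close>

lemma coordinates_exist: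
  "\<exists>u\<in>carrier \<A>. \<forall>g\<in>carrier Q. \<forall>a\<in>carrier A. u (\<iota> a \<odot> s g) * \<chi> a / c (\<iota> a, s g) = w g a"
proof -
  let ?b = "\<lambda>(a, g). \<iota> a \<odot> s g"
  note bij = bij_AQ
  \<comment> \<open>The coordinate equation solved for \<open>u\<close>; every \<open>x\<close> is
    uniquely \<open>\<iota> a \<odot> s g\<close>, so the cosets can be prescribed
    independently.\<close>
  define u where "u = (\<lambda>x\<in>carrier G. case inv_into (carrier A \<times> carrier Q) ?b x of
     (a, g) \<Rightarrow> w g a * c (\<iota> a, s g) / \<chi> a)"
  have "u (\<iota> a \<odot> s g) = w g a * c (\<iota> a, s g) / \<chi> a" if "g \<in> carrier Q" "a \<in> carrier A" for g a
    using that bij_betw_inv_into_left[OF bij, of "(a, g)"] by (simp add: u_def s)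
  moreover have "u \<in> carrier \<A>" by (simp add: u_def twisted_group_algebra_def)
  ultimately show ?thesis
    by (intro bexI[of _ u]) (simp_all add: s GZ_nonzero[OF c] splits_nonzero[OF c \<chi>])
qed

lemma entry_decomposition:
  assumes "k \<in> carrier Q" "h \<in> carrier Q"
  obtains g where "g \<in> carrier Q" "k = g \<cdot> h"
  using assms that[of "k \<cdot> inv\<^bsub>Q\<^esub> h"] by (simp add: Q.m_assoc)

lemma induced_rep_kernel:
  assumes inj: "inj_on \<pi> (carrier Q)"
    and zero: "\<And>k h. k \<in> carrier Q \<Longrightarrow> h \<in> carrier Q \<Longrightarrow> R u k h = 0" and x: "x \<in> carrier G"
  shows "u x = 0"
proof -
  obtain a where a: "a \<in> carrier A" "x = \<iota> a \<odot> s (p x)"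
    using lift_kernel[of x "s (p x)"] x by (auto simp: s)
  define g where "g = p x"
  have g: "g \<in> carrier Q" using x by (simp add: g_def)
  have "(\<Sum>a\<in>carrier A. 1 / \<pi> k a * (u (\<iota> a \<odot> s g) * \<chi> a / c (\<iota> a, s g))) = 0" if k: "k \<in> carrier Q" for k
  proof -
    let ?h = "inv\<^bsub>Q\<^esub> g \<cdot> k"
    have h: "?h \<in> carrier Q" "g \<cdot> ?h = k" using g k by (simp_all flip: Q.m_assoc)
    show ?thesis
      using induced_rep_entry[OF g h(1), of u] zero[OF k h(1)]
        induced_coeff_nonzero[OF s(1)[OF g] h(1)] unfolding h(2) by simp
  qed
  then have "\<forall>k\<in>carrier Q. (\<Sum>a\<in>carrier A. 1 / \<pi> k a * (u (\<iota> a \<odot> s g) * \<chi> a / c (\<iota> a, s g))) = 0" by blast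
  from character_matrix_kernel[OF finA finQ ord \<pi> inj this]
  have "u (\<iota> a \<odot> s g) * \<chi> a / c (\<iota> a, s g) = 0" using a by blast
  then show ?thesis
    using a g GZ_nonzero[OF c] splits_nonzero[OF c \<chi>] by (simp add: s flip: g_def)
qed

text \<open>For each \<open>g\<close> one solves a separate linear system with the character matrix,
  after dividing the prescribed entries by the nonzero coefficients of \<open>s g\<close>.\<close>

lemma induced_rep_surj:
  assumes inj: "inj_on \<pi> (carrier Q)"
  shows "\<exists>u\<in>carrier \<A>. \<forall>k\<in>carrier Q. \<forall>h\<in>carrier Q. R u k h = E k h"
proof -
  have "\<forall>g. \<exists>w. \<forall>k\<in>carrier Q. (\<Sum>a\<in>carrier A. 1 / \<pi> k a * w a)
      = E k (inv\<^bsub>Q\<^esub> g \<cdot> k) / \<rho> (s g) (inv\<^bsub>Q\<^esub> g \<cdot> k)"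
    by (intro allI character_matrix_surj[OF finA finQ ord \<pi> inj])
  then obtain w where w: "\<And>g k. k \<in> carrier Q \<Longrightarrow> (\<Sum>a\<in>carrier A. 1 / \<pi> k a * w g a)
      = E k (inv\<^bsub>Q\<^esub> g \<cdot> k) / \<rho> (s g) (inv\<^bsub>Q\<^esub> g \<cdot> k)"
    by metis
  obtain u where u: "u \<in> carrier \<A>"
    "\<forall>g\<in>carrier Q. \<forall>a\<in>carrier A. u (\<iota> a \<odot> s g) * \<chi> a / c (\<iota> a, s g) = w g a"
    using coordinates_exist by blast
  have "R u k h = E k h" if k: "k \<in> carrier Q" and h: "h \<in> carrier Q" for k h
  proof -
    obtain g where g: "g \<in> carrier Q" "k = g \<cdot> h" using k h by (rule entry_decomposition)
    have "inv\<^bsub>Q\<^esub> g \<cdot> k = h" using g h by (simp flip: Q.m_assoc)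
    have "R u k h = \<rho> (s g) h * (\<Sum>a\<in>carrier A. 1 / \<pi> k a * (u (\<iota> a \<odot> s g) * \<chi> a / c (\<iota> a, s g)))"
      unfolding g(2) by (rule induced_rep_entry[OF g(1) h])
    also have "\<dots> = \<rho> (s g) h * (\<Sum>a\<in>carrier A. 1 / \<pi> k a * w g a)"
      using u(2) g by simp
    also have "\<dots> = E k h"
      using w[OF k, of g] \<open>inv\<^bsub>Q\<^esub> g \<cdot> k = h\<close> induced_coeff_nonzero[OF s(1)[OF g(1)] h] by simp
    finally show ?thesis .
  qed
  with u(1) show ?thesis by blast
qed

text \<open>A null vector of the character matrix, used as the coordinates on every coset, makes all
  entries vanish.\<close>

lemma induced_rep_kernel_nontrivial:
  assumes w: "\<forall>g\<in>carrier Q. (\<Sum>a\<in>carrier A. 1 / \<pi> g a * w a) = 0" and b: "b \<in> carrier A" "w b \<noteq> 0"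
  shows "\<exists>u\<in>carrier \<A>. (\<forall>k\<in>carrier Q. \<forall>h\<in>carrier Q. R u k h = 0) \<and> u \<noteq> \<zero>\<^bsub>\<A>\<^esub>"
proof -
  obtain u where u: "u \<in> carrier \<A>"
    "\<forall>g\<in>carrier Q. \<forall>a\<in>carrier A. u (\<iota> a \<odot> s g) * \<chi> a / c (\<iota> a, s g) = w a"
    using coordinates_exist[of "\<lambda>_. w"] by blast
  have "R u k h = 0" if k: "k \<in> carrier Q" and h: "h \<in> carrier Q" for k h
  proof -
    obtain g where g: "g \<in> carrier Q" "k = g \<cdot> h" using k h by (rule entry_decomposition)
    have "R u k h = \<rho> (s g) h * (\<Sum>a\<in>carrier A. 1 / \<pi> k a * (u (\<iota> a \<odot> s g) * \<chi> a / c (\<iota> a, s g)))"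
      unfolding g(2) by (rule induced_rep_entry[OF g(1) h])
    also have "\<dots> = \<rho> (s g) h * (\<Sum>a\<in>carrier A. 1 / \<pi> k a * w a)"
      using u(2) g by simp
    finally show ?thesis using w k by simp
  qed
  moreover have "u (\<iota> b \<odot> s \<one>\<^bsub>Q\<^esub>) \<noteq> 0"
    using u(2)[rule_format, of "\<one>\<^bsub>Q\<^esub>" b] b by auto
  then have "u \<noteq> \<zero>\<^bsub>\<A>\<^esub>" using b by (auto simp: twisted_group_algebra_def s)
  ultimately show ?thesis using u(1) by blast
qed

text \<open>If \<pi> is bijective, the induced representation \<open>F\<close> is itself an
  isomorphism. Conversely, composing \<open>F\<close> with the inverse of a given isomorphism
  \<open>F0\<close> yields a ring map between matrix algebras. A singular character matrix would
  make it kill a nonzero matrix and hence the identity, contradicting that \<open>F\<close> is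
  unital.\<close>

lemma nondegenerate_iff_bij:
  "nondegenerate_cocycle G c \<longleftrightarrow> bij_betw \<pi> (carrier Q) (carrier (dual_group A))"
proof -
  define n where "n = card (carrier Q)"
  obtain e where e: "bij_betw e {0..<n} (carrier Q)"
    using ex_bij_betw_nat_finite[OF finQ] n_def by metis
  then have eQ: "e i \<in> carrier Q" if "i < n" for i using that by (auto simp: bij_betw_def)
  have e_eq: "e i = e j \<longleftrightarrow> i = j" if "i < n" "j < n" for i j
    using that e by (auto simp: bij_betw_def inj_on_def)
  have eE: "\<exists>i<n. k = e i" if "k \<in> carrier Q" for k
    using that e unfolding bij_betw_def by (metis atLeastLessThan_iff imageE)
  have nn: "n * n = order G"
    using card_G ord by (simp add: Coset.order_def n_def)
  have n_pos: "n > 0" using finQ by (auto simp: n_def card_gt_0_iff)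
  define F where "F u = mat n n (\<lambda>(i, j). R u (e i) (e j))" for u
  have F_car: "F u \<in> carrier_mat n n" for u by (simp add: F_def)
  have F_ix: "F u $$ (i, j) = R u (e i) (e j)" if "i < n" "j < n" for u i j
    using that by (simp add: F_def)
  have F_mult: "F (u \<otimes>\<^bsub>\<A>\<^esub> v) = F u * F v" for u v
  proof (rule eq_matI)
    fix i j assume "i < dim_row (F u * F v)" "j < dim_col (F u * F v)"
    then have ij: "i < n" "j < n" by (simp_all add: F_def)
    have "F (u \<otimes>\<^bsub>\<A>\<^esub> v) $$ (i, j) = (\<Sum>m\<in>carrier Q. R u (e i) m * R v m (e j))"
      using ij by (simp add: F_ix induced_rep_mult eQ)
    also have "\<dots> = (\<Sum>k = 0..<n. R u (e i) (e k) * R v (e k) (e j))"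
      by (rule sum.reindex_bij_betw[OF e, symmetric])
    also have "\<dots> = (F u * F v) $$ (i, j)"
      unfolding mult_mat_entry[OF F_car F_car ij] using ij by (simp add: F_ix)
    finally show "F (u \<otimes>\<^bsub>\<A>\<^esub> v) $$ (i, j) = (F u * F v) $$ (i, j)" .
  qed (simp_all add: F_def)
  have R_add: "R (u \<oplus>\<^bsub>\<A>\<^esub> v) k h = R u k h + R v k h" for u v k h
    unfolding induced_rep_def sum.distrib[symmetric]
    by (intro sum.cong refl) (auto simp: twisted_group_algebra_def distrib_right)
  have R_smult: "R (z \<odot>\<^bsub>\<A>\<^esub> u) k h = z * R u k h" for z u k h
    unfolding induced_rep_def sum_distrib_left
    by (intro sum.cong refl) (auto simp: twisted_group_algebra_def)
  have F_add: "F (u \<oplus>\<^bsub>\<A>\<^esub> v) = F u + F v" for u v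
    by (rule eq_matI) (simp_all add: F_def R_add)
  have F_smult: "F (z \<odot>\<^bsub>\<A>\<^esub> u) = z \<cdot>\<^sub>m F u" for z u
    by (rule eq_matI) (simp_all add: F_def R_smult)
  have F_one: "F \<one>\<^bsub>\<A>\<^esub> = 1\<^sub>m n"
    by (rule eq_matI) (simp_all add: F_def induced_rep_one eQ e_eq)
  show ?thesis
  proof
    assume bij: "bij_betw \<pi> (carrier Q) (carrier (dual_group A))"
    then have inj: "inj_on \<pi> (carrier Q)" by (simp add: bij_betw_def)
    have "F \<in> ring_hom \<A> (module_mat TYPE(complex) n n)"
      by (rule ring_hom_memI) (simp_all add: module_mat_simps F_car F_mult F_add F_one)
    moreover have "bij_betw F (carrier \<A>) (carrier (module_mat TYPE(complex) n n))"
      unfolding bij_betw_def module_mat_simps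
    proof
      show "inj_on F (carrier \<A>)"
      proof (rule inj_onI)
        fix u v assume uv: "u \<in> carrier \<A>" "v \<in> carrier \<A>" "F u = F v"
        \<comment> \<open>The difference of \<open>u\<close> and \<open>v\<close>, written so that
          additivity and homogeneity of \<open>R\<close> apply.\<close>
        let ?d = "u \<oplus>\<^bsub>\<A>\<^esub> ((-1) \<odot>\<^bsub>\<A>\<^esub> v)"
        have "R ?d k h = 0" if kh: "k \<in> carrier Q" "h \<in> carrier Q" for k h
        proof -
          obtain i where "i < n" "k = e i" using eE[OF kh(1)] by blast
          moreover obtain j where "j < n" "h = e j" using eE[OF kh(2)] by blast
          ultimately show ?thesis using F_ix[of i j u] F_ix[of i j v] uv(3) by (simp add: R_add R_smult)
        qed
        then have "?d x = 0" if "x \<in> carrier G" for x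
          using induced_rep_kernel[OF inj] that by blast
        then have "u x = v x" if "x \<in> carrier G" for x
          using that by (auto simp: twisted_group_algebra_def)
        then show "u = v"
          using uv by (auto simp: twisted_group_algebra_def intro: PiE_ext)
      qed
      show "F ` carrier \<A> = carrier_mat n n"
      proof (intro equalityI subsetI)
        fix E :: "complex mat" assume E: "E \<in> carrier_mat n n"
        obtain u where u: "u \<in> carrier \<A>" "\<forall>k\<in>carrier Q. \<forall>h\<in>carrier Q.
            R u k h = E $$ (inv_into {0..<n} e k, inv_into {0..<n} e h)"
          using induced_rep_surj[OF inj, of "\<lambda>k h. E $$ (inv_into {0..<n} e k, inv_into {0..<n} e h)"] by blast
        have "F u = E"
          using E u(2) bij_betw_inv_into_left[OF e] by (intro eq_matI) (auto simp: F_def eQ)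
        with u(1) show "E \<in> F ` carrier \<A>" by blast
      qed (auto simp: F_car)
    qed
    ultimately have "F \<in> ring_iso \<A> (module_mat TYPE(complex) n n)" by (simp add: ring_iso_def)
    moreover have "\<forall>a. \<forall>u\<in>carrier \<A>. F (a \<odot>\<^bsub>\<A>\<^esub> u) = a \<odot>\<^bsub>module_mat TYPE(complex) n n\<^esub> F u"
      by (simp add: F_smult module_mat_simps)
    ultimately show "nondegenerate_cocycle G c" unfolding nondegenerate_cocycle_def using nn by blast
  next
    assume "nondegenerate_cocycle G c"
    then obtain m F0 where m: "m * m = order G" and F0: "F0 \<in> ring_iso \<A> (module_mat TYPE(complex) m m)"
      unfolding nondegenerate_cocycle_def by blast
    have "m = n" using m nn by (metis power2_eq_square power2_eq_iff_nonneg zero_le)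
    with F0 have F0: "F0 \<in> ring_iso \<A> (module_mat TYPE(complex) n n)" by simp
    then have bij: "bij_betw F0 (carrier \<A>) (carrier_mat n n)"
      and F0_mult: "\<And>u v. u \<in> carrier \<A> \<Longrightarrow> v \<in> carrier \<A> \<Longrightarrow> F0 (u \<otimes>\<^bsub>\<A>\<^esub> v) = F0 u * F0 v"
      and F0_add: "\<And>u v. u \<in> carrier \<A> \<Longrightarrow> v \<in> carrier \<A> \<Longrightarrow> F0 (u \<oplus>\<^bsub>\<A>\<^esub> v) = F0 u + F0 v"
      and F0_one: "F0 \<one>\<^bsub>\<A>\<^esub> = 1\<^sub>m n"
      by (auto simp: ring_iso_def Ring.ring_hom_def module_mat_simps)
    have \<A>: "\<one>\<^bsub>\<A>\<^esub> \<in> carrier \<A>" "\<zero>\<^bsub>\<A>\<^esub> \<in> carrier \<A>" "\<zero>\<^bsub>\<A>\<^esub> \<oplus>\<^bsub>\<A>\<^esub> \<zero>\<^bsub>\<A>\<^esub> = \<zero>\<^bsub>\<A>\<^esub>"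
      "\<And>u v. u \<in> carrier \<A> \<Longrightarrow> v \<in> carrier \<A> \<Longrightarrow> u \<otimes>\<^bsub>\<A>\<^esub> v \<in> carrier \<A>"
      "\<And>u v. u \<in> carrier \<A> \<Longrightarrow> v \<in> carrier \<A> \<Longrightarrow> u \<oplus>\<^bsub>\<A>\<^esub> v \<in> carrier \<A>"
      by (auto simp: twisted_group_algebra_def)
    \<comment> \<open>Membership in \<open>ring_iso\<close> does not state preservation of zero, so
      it is derived from additivity.\<close>
    have F0_zero: "F0 \<zero>\<^bsub>\<A>\<^esub> = 0\<^sub>m n n"
    proof -
      have Z: "F0 \<zero>\<^bsub>\<A>\<^esub> \<in> carrier_mat n n" using bij \<A>(2) by (auto simp: bij_betw_def)
      have sum: "F0 \<zero>\<^bsub>\<A>\<^esub> = F0 \<zero>\<^bsub>\<A>\<^esub> + F0 \<zero>\<^bsub>\<A>\<^esub>" using F0_add[OF \<A>(2,2)] \<A>(3) by simp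
      have "F0 \<zero>\<^bsub>\<A>\<^esub> $$ (i, j) = 0" if "i < n" "j < n" for i j
        using arg_cong[OF sum, of "\<lambda>X. X $$ (i, j)"] Z that by simp
      then show ?thesis using Z by (intro eq_matI) auto
    qed
    define \<phi> where "\<phi> X = F (inv_into (carrier \<A>) F0 X)" for X
    have \<phi>: "\<phi> (F0 u) = F u" if "u \<in> carrier \<A>" for u
      using bij_betw_inv_into_left[OF bij that] by (simp add: \<phi>_def)
    have F0E: "\<exists>u\<in>carrier \<A>. X = F0 u" if "X \<in> carrier_mat n n" for X
      using that bij by (auto simp: bij_betw_def)
    show "bij_betw \<pi> (carrier Q) (carrier (dual_group A))"
    proof (rule bijective_from_kernel[OF finA finQ ord \<pi>], rule ccontr)
      fix w assume w: "\<forall>g\<in>carrier Q. (\<Sum>a\<in>carrier A. 1 / \<pi> g a * w a) = 0"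
        and "\<not> (\<forall>a\<in>carrier A. w a = 0)"
      then obtain u where u: "u \<in> carrier \<A>" "\<forall>k\<in>carrier Q. \<forall>h\<in>carrier Q. R u k h = 0" "u \<noteq> \<zero>\<^bsub>\<A>\<^esub>"
        using induced_rep_kernel_nontrivial[OF w] by blast
      have \<phi>_hom: "\<phi> (X + Y) = \<phi> X + \<phi> Y" "\<phi> (X * Y) = \<phi> X * \<phi> Y"
        if XY: "X \<in> carrier_mat n n" "Y \<in> carrier_mat n n" for X Y
      proof -
        obtain x where x: "x \<in> carrier \<A>" "X = F0 x" using F0E[OF XY(1)] by blast
        obtain y where y: "y \<in> carrier \<A>" "Y = F0 y" using F0E[OF XY(2)] by blast
        show "\<phi> (X + Y) = \<phi> X + \<phi> Y"
          unfolding x(2) y(2) F0_add[OF x(1) y(1), symmetric] using x(1) y(1) \<A> by (simp add: \<phi> F_add)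
        show "\<phi> (X * Y) = \<phi> X * \<phi> Y"
          unfolding x(2) y(2) F0_mult[OF x(1) y(1), symmetric] using x(1) y(1) \<A> by (simp add: \<phi> F_mult)
      qed
      have "\<phi> (1\<^sub>m n) = 0\<^sub>m n n"
      proof (rule matrix_algebra_simple[of "F0 u"])
        show "F0 u \<in> carrier_mat n n" using u(1) bij by (auto simp: bij_betw_def)
        show "F0 u \<noteq> 0\<^sub>m n n"
          using u \<A>(2) bij unfolding F0_zero[symmetric] by (auto simp: bij_betw_def dest: inj_onD)
        show "\<phi> (F0 u) = 0\<^sub>m n n"
          unfolding \<phi>[OF u(1)] using u(2) by (intro eq_matI) (auto simp: F_def eQ)
        show "\<phi> X \<in> carrier_mat n n" for X by (simp add: \<phi>_def F_car)
      qed (rule \<phi>_hom; assumption)+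
      then have "F \<one>\<^bsub>\<A>\<^esub> = 0\<^sub>m n n" using \<phi>[OF \<A>(1)] by (simp add: F0_one)
      \<comment> \<open>The entry at \<open>(0, 0)\<close> exists because Q is nonempty.\<close>
      then have "(1\<^sub>m n :: complex mat) $$ (0, 0) = 0\<^sub>m n n $$ (0, 0)" by (simp add: F_one)
      then show False using n_pos by simp
    qed
  qed
qed

end

section \<open>The correspondence of classes\<close>

abbreviation "cls c \<equiv> B2 G Cstar triv_act #>\<^bsub>Z2 G Cstar triv_act\<^esub> c"

lemma mem_cls: "c' \<in> cls c \<longleftrightarrow> (\<exists>f. (\<forall>x\<in>carrier G. f x \<noteq> 0) \<and>
    c' = (\<lambda>(x, y)\<in>carrier G \<times> carrier G. f x * f y / f (x \<odot> y) * c (x, y)))"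
    (is "_ \<longleftrightarrow> ?R")
proof -
  have *: "(\<lambda>(x, y)\<in>carrier G \<times> carrier G. f x * f y / f (x \<odot> y)) \<otimes>\<^bsub>Z2 G Cstar triv_act\<^esub> c
    = (\<lambda>(x, y)\<in>carrier G \<times> carrier G. f x * f y / f (x \<odot> y) * c (x, y))" for f :: "'g \<Rightarrow> complex"
    unfolding Z2_mult by (rule restrict_ext) auto
  show ?thesis
  proof
    assume "c' \<in> cls c"
    then obtain b where "b \<in> B2 G Cstar triv_act" and b: "c' = b \<otimes>\<^bsub>Z2 G Cstar triv_act\<^esub> c"
      unfolding r_coset_def by blast
    then obtain f where f: "\<forall>x\<in>carrier G. f x \<noteq> 0"
      "b = (\<lambda>(x, y)\<in>carrier G \<times> carrier G. f x * f y / f (x \<odot> y))"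
      unfolding B2_Cstar_iff[OF G.is_group] by blast
    show ?R using f(1) b unfolding f(2) * by blast
  next
    assume ?R
    then obtain f where f: "\<forall>x\<in>carrier G. f x \<noteq> 0"
      "c' = (\<lambda>(x, y)\<in>carrier G \<times> carrier G. f x * f y / f (x \<odot> y) * c (x, y))" by blast
    then have "(\<lambda>(x, y)\<in>carrier G \<times> carrier G. f x * f y / f (x \<odot> y)) \<in> B2 G Cstar triv_act"
      unfolding B2_Cstar_iff[OF G.is_group] by blast
    then show "c' \<in> cls c" unfolding r_coset_def f(2) *[symmetric] by blast
  qed
qed

lemma
  assumes c: "c \<in> GZ"
  shows cls_self: "c \<in> cls c"
    and cls_subset: "c' \<in> cls c \<Longrightarrow> c' \<in> GZ"
    and cls_eqI: "c' \<in> cls c \<Longrightarrow> cls c' = cls c"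
proof -
  interpret Z: comm_group "Z2 G Cstar triv_act" by (rule comm_group_Z2) (rule G.is_group)
  have B: "subgroup (B2 G Cstar triv_act) (Z2 G Cstar triv_act)" by (rule B2_subgroup_Z2) (rule G.is_group)
  show "c \<in> cls c" by (rule Z.rcos_self[OF c B])
  show "c' \<in> GZ" if "c' \<in> cls c"
    using Z.r_coset_subset_G[OF subgroup.subset[OF B] c] that by blast
  show "cls c' = cls c" if "c' \<in> cls c"
    by (rule Z.repr_independence[OF that c B, symmetric])
qed

lemma associated_cls:
  assumes "associated \<pi> c" "c' \<in> cls c"
  shows "associated \<pi> c'"
proof -
  obtain f where f: "\<forall>x\<in>carrier G. f x \<noteq> 0"
    "c' = (\<lambda>(x, y)\<in>carrier G \<times> carrier G. f x * f y / f (x \<odot> y) * c (x, y))"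
    using assms(2) unfolding mem_cls by blast
  show ?thesis
    \<comment> \<open>A change within the class is a rescaling with trivial inflated part.\<close>
    by (rule associated_times_inflation[OF assms(1) f(1), of "\<lambda>_\<in>carrier Q \<times> carrier Q. 1"])
       (simp_all add: Z2_Cstar_iff[OF Q.is_group] f(2))
qed

section \<open>The kernel of restriction and the cosets of inflation\<close>

lemma splits_iff: "(\<exists>\<chi>. splits \<chi> c) \<longleftrightarrow> pullback2 A \<iota> c \<in> B2 A Cstar triv_act"
proof -
  have "splits \<chi> c \<longleftrightarrow> (\<forall>a\<in>carrier A. \<chi> a \<noteq> 0) \<and>
      pullback2 A \<iota> c = (\<lambda>(a, b)\<in>carrier A \<times> carrier A. \<chi> a * \<chi> b / \<chi> (a \<oplus> b))" for \<chi>
    unfolding splits_def pullback2_def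
    by (auto simp: fun_eq_iff restrict_def eq_divide_eq mult.commute)
  then show ?thesis unfolding B2_Cstar_iff[OF A.is_group] by blast
qed

text \<open>On representatives, restriction is pullback along \<iota>, and its coset is trivial
  exactly when the pulled-back cocycle is a coboundary. A potential for it is a splitting
  \<chi>.\<close>

lemma mem_ker_res: "W \<in> ker_res A G \<iota> \<longleftrightarrow> (\<exists>c\<in>GZ. W = cls c \<and> (\<exists>\<chi>. splits \<chi> c))"
proof -
  have "H2_map A \<iota> (cls c) = \<one>\<^bsub>H2 A Cstar triv_act\<^esub> \<longleftrightarrow> pullback2 A \<iota> c \<in> B2 A Cstar triv_act"
    if c: "c \<in> GZ" for c
  proof -
    interpret Z: comm_group "Z2 A Cstar triv_act" by (rule comm_group_Z2) (rule A.is_group)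
    have B: "subgroup (B2 A Cstar triv_act) (Z2 A Cstar triv_act)" by (rule B2_subgroup_Z2) (rule A.is_group)
    have pc: "pullback2 A \<iota> c \<in> carrier (Z2 A Cstar triv_act)"
      by (rule pullback2_Z2[OF A.is_group G.is_group \<iota>_hom c])
    have "H2_map A \<iota> (cls c) = \<one>\<^bsub>H2 A Cstar triv_act\<^esub>
      \<longleftrightarrow> B2 A Cstar triv_act #>\<^bsub>Z2 A Cstar triv_act\<^esub> pullback2 A \<iota> c = B2 A Cstar triv_act"
      by (simp add: H2_map_coset[OF A.is_group G.is_group \<iota>_hom c] H2_def)
    also have "\<dots> \<longleftrightarrow> pullback2 A \<iota> c \<in> B2 A Cstar triv_act"
      using Z.coset_join1[OF _ pc B] Z.coset_join2[OF pc B] subgroup.subset[OF B] by blast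
    finally show ?thesis .
  qed
  then show ?thesis
    unfolding ker_res_def kernel_def carrier_H2 splits_iff by auto
qed

text \<open>Inflation preserves association with \<pi>, and any two cocycles associated with \<pi>
  differ by inflation up to a coboundary. Hence \<pi> alone determines an element of the
  quotient.\<close>

lemma inflation_coset:
  assumes "associated \<pi> c" and c: "c \<in> GZ"
  shows "im_inf G Q p #>\<^bsub>H2 G Cstar triv_act\<^esub> cls c = {cls c' | c'. c' \<in> GZ \<and> associated \<pi> c'}"
proof -
  interpret Z: comm_group "Z2 G Cstar triv_act" by (rule comm_group_Z2) (rule G.is_group)
  have B: "subgroup (B2 G Cstar triv_act) (Z2 G Cstar triv_act)" by (rule B2_subgroup_Z2) (rule G.is_group)
  interpret N: normal "B2 G Cstar triv_act" "Z2 G Cstar triv_act" by (rule Z.subgroup_imp_normal[OF B])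
  let ?i = "pullback2 G p"
  let ?ZQ = "carrier (Z2 Q Cstar triv_act)"
  have i: "?i z \<in> GZ" if "z \<in> ?ZQ" for z
    by (rule pullback2_Z2[OF G.is_group Q.is_group p_hom that])
  have "im_inf G Q p = {cls (?i z) | z. z \<in> ?ZQ}"
    unfolding im_inf_def carrier_H2
    using H2_map_coset[OF G.is_group Q.is_group p_hom] by (auto simp: image_iff)
  then have "im_inf G Q p #>\<^bsub>H2 G Cstar triv_act\<^esub> cls c = {cls (?i z) <#>\<^bsub>Z2 G Cstar triv_act\<^esub> cls c | z. z \<in> ?ZQ}"
    unfolding r_coset_def[of "H2 G Cstar triv_act"] by (auto simp: H2_def FactGroup_def)
  also have "\<dots> = {cls (?i z \<otimes>\<^bsub>Z2 G Cstar triv_act\<^esub> c) | z. z \<in> ?ZQ}"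
    using N.rcos_sum[OF i c] by (metis (no_types, lifting))
  also have "\<dots> = {cls c' | c'. c' \<in> GZ \<and> associated \<pi> c'}"
  proof (intro equalityI subsetI)
    fix Y assume "Y \<in> {cls (?i z \<otimes>\<^bsub>Z2 G Cstar triv_act\<^esub> c) | z. z \<in> ?ZQ}"
    then obtain z where z: "z \<in> ?ZQ" "Y = cls (?i z \<otimes>\<^bsub>Z2 G Cstar triv_act\<^esub> c)" by blast
    have "associated \<pi> (?i z \<otimes>\<^bsub>Z2 G Cstar triv_act\<^esub> c)"
      by (rule associated_times_inflation[OF assms(1) _ z(1), of "\<lambda>_. 1"]) (simp_all add: pullback2_def)
    moreover have "?i z \<otimes>\<^bsub>Z2 G Cstar triv_act\<^esub> c \<in> GZ" by (rule Z.m_closed[OF i[OF z(1)] c])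
    ultimately show "Y \<in> {cls c' | c'. c' \<in> GZ \<and> associated \<pi> c'}" using z(2) by blast
  next
    fix Y assume "Y \<in> {cls c' | c'. c' \<in> GZ \<and> associated \<pi> c'}"
    then obtain c' where c': "c' \<in> GZ" "associated \<pi> c'" "Y = cls c'" by blast
    obtain f z where fz: "\<forall>x\<in>carrier G. f x \<noteq> 0" "z \<in> ?ZQ"
      "\<And>x y. x \<in> carrier G \<Longrightarrow> y \<in> carrier G \<Longrightarrow> c' (x, y) = f x * f y / f (x \<odot> y) * z (p x, p y) * c (x, y)"
      using associated_differ_by_inflation[OF assms(1) c'(2) c c'(1)] by blast
    have ext: "c' \<in> extensional (carrier G \<times> carrier G)"
      using c'(1) by (simp add: Z2_Cstar_iff[OF G.is_group])
    have "c' = (\<lambda>(x, y)\<in>carrier G \<times> carrier G. f x * f y / f (x \<odot> y) * (?i z \<otimes>\<^bsub>Z2 G Cstar triv_act\<^esub> c) (x, y))"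
      by (rule extensionalityI[OF ext]) (auto simp: fz(3) pullback2_def)
    then have "c' \<in> cls (?i z \<otimes>\<^bsub>Z2 G Cstar triv_act\<^esub> c)" unfolding mem_cls using fz(1) by blast
    then have "cls c' = cls (?i z \<otimes>\<^bsub>Z2 G Cstar triv_act\<^esub> c)"
      by (rule cls_eqI[rotated]) (rule Z.m_closed[OF i[OF fz(2)] c])
    then show "Y \<in> {cls (?i z \<otimes>\<^bsub>Z2 G Cstar triv_act\<^esub> c) | z. z \<in> ?ZQ}" using fz(2) c'(3) by blast
  qed
  finally show ?thesis .
qed

section \<open>Classes in the first cohomology of the dual module\<close>

abbreviation "H1_carrier \<equiv> carrier (H1 Q (dual_group A) dact)"

lemma B1_coset: "B1 Q (dual_group A) dact #>\<^bsub>Z1 Q (dual_group A) dact\<^esub> \<pi>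
  = {(\<lambda>g\<in>carrier Q. \<lambda>a\<in>carrier A. \<psi> ((inv\<^bsub>Q\<^esub> g) \<triangleright> a) / \<psi> a * \<pi> g a) | \<psi>. \<psi> \<in> carrier (dual_group A)}"
proof -
  have "(\<lambda>g\<in>carrier Q. \<lambda>a\<in>carrier A. \<psi> ((inv\<^bsub>Q\<^esub> g) \<triangleright> a) / \<psi> a) \<otimes>\<^bsub>Z1 Q (dual_group A) dact\<^esub> \<pi>
    = (\<lambda>g\<in>carrier Q. \<lambda>a\<in>carrier A. \<psi> ((inv\<^bsub>Q\<^esub> g) \<triangleright> a) / \<psi> a * \<pi> g a)" for \<psi>
    by (auto simp: Z1_def cochains_def dual_group_mult fun_eq_iff restrict_def)
  note * = this
  show ?thesis
  proof (intro equalityI subsetI)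
    fix t assume "t \<in> B1 Q (dual_group A) dact #>\<^bsub>Z1 Q (dual_group A) dact\<^esub> \<pi>"
    then obtain b where "b \<in> B1 Q (dual_group A) dact" and b: "t = b \<otimes>\<^bsub>Z1 Q (dual_group A) dact\<^esub> \<pi>"
      unfolding r_coset_def by blast
    then obtain \<psi> where \<psi>: "\<psi> \<in> carrier (dual_group A)"
      "b = (\<lambda>g\<in>carrier Q. \<lambda>a\<in>carrier A. \<psi> ((inv\<^bsub>Q\<^esub> g) \<triangleright> a) / \<psi> a)"
      unfolding mem_B1 by blast
    show "t \<in> {(\<lambda>g\<in>carrier Q. \<lambda>a\<in>carrier A. \<psi> ((inv\<^bsub>Q\<^esub> g) \<triangleright> a) / \<psi> a * \<pi> g a) | \<psi>.
        \<psi> \<in> carrier (dual_group A)}"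
      using \<psi>(1) unfolding b \<psi>(2) * by blast
  next
    fix t assume "t \<in> {(\<lambda>g\<in>carrier Q. \<lambda>a\<in>carrier A. \<psi> ((inv\<^bsub>Q\<^esub> g) \<triangleright> a) / \<psi> a * \<pi> g a) | \<psi>.
        \<psi> \<in> carrier (dual_group A)}"
    then obtain \<psi> where \<psi>: "\<psi> \<in> carrier (dual_group A)"
      "t = (\<lambda>g\<in>carrier Q. \<lambda>a\<in>carrier A. \<psi> ((inv\<^bsub>Q\<^esub> g) \<triangleright> a) / \<psi> a * \<pi> g a)" by blast
    then have "(\<lambda>g\<in>carrier Q. \<lambda>a\<in>carrier A. \<psi> ((inv\<^bsub>Q\<^esub> g) \<triangleright> a) / \<psi> a) \<in> B1 Q (dual_group A) dact"
      unfolding mem_B1 by blast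
    then show "t \<in> B1 Q (dual_group A) dact #>\<^bsub>Z1 Q (dual_group A) dact\<^esub> \<pi>"
      unfolding r_coset_def \<psi>(2) *[symmetric] by blast
  qed
qed

lemma mem_H1_carrier: "P \<in> H1_carrier \<longleftrightarrow> (\<exists>\<pi>\<in>cocyc. P = B1 Q (dual_group A) dact #>\<^bsub>Z1 Q (dual_group A) dact\<^esub> \<pi>)"
  by (auto simp: H1_def FactGroup_def RCOSETS_def)

lemma trivial_character: "(\<lambda>a\<in>carrier A. 1) \<in> carrier (dual_group A)"
  by (simp add: mem_dual_group)

lemma B1_coset_self:
  assumes "\<pi> \<in> cocyc"
  shows "\<pi> \<in> B1 Q (dual_group A) dact #>\<^bsub>Z1 Q (dual_group A) dact\<^esub> \<pi>"
proof -
  have "\<pi> \<in> extensional (carrier Q)" "\<And>g. g \<in> carrier Q \<Longrightarrow> \<pi> g \<in> extensional (carrier A)"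
    using assms by (auto simp: mem_cocyc mem_dual_group PiE_def Pi_def)
  then have "\<pi> = (\<lambda>g\<in>carrier Q. \<lambda>a\<in>carrier A. (\<lambda>a\<in>carrier A. 1) ((inv\<^bsub>Q\<^esub> g) \<triangleright> a) / (\<lambda>a\<in>carrier A. 1) a * \<pi> g a)"
    by (intro extensionalityI[of _ "carrier Q"]) (auto intro!: extensionalityI[of _ "carrier A"])
  then show ?thesis unfolding B1_coset using trivial_character by blast
qed

text \<open>Association with \<open>c\<close> is stable under coboundaries and determines \<pi> up
  to a coboundary, so one associated member fixes the whole class. This is the source of
  injectivity.\<close>

lemma H1_class_eq:
  assumes P: "P \<in> H1_carrier" and \<pi>: "\<pi> \<in> P" "associated \<pi> c" and c: "c \<in> GZ"
  shows "P = {\<pi>'. associated \<pi>' c}"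
proof -
  obtain \<pi>0 where \<pi>0: "\<pi>0 \<in> cocyc" "P = B1 Q (dual_group A) dact #>\<^bsub>Z1 Q (dual_group A) dact\<^esub> \<pi>0"
    using P mem_H1_carrier by blast
  obtain \<psi> where \<psi>: "\<psi> \<in> carrier (dual_group A)"
    "\<pi> = (\<lambda>g\<in>carrier Q. \<lambda>a\<in>carrier A. \<psi> ((inv\<^bsub>Q\<^esub> g) \<triangleright> a) / \<psi> a * \<pi>0 g a)"
    using \<pi>(1) unfolding \<pi>0 B1_coset by blast
  \<comment> \<open>The inverse character leads back from \<pi> to the representative
    \<open>\<pi>0\<close>.\<close>
  define \<psi>' where "\<psi>' = (\<lambda>a\<in>carrier A. inverse (\<psi> a))"
  have \<psi>': "\<psi>' \<in> carrier (dual_group A)" using \<psi>(1) by (simp add: \<psi>'_def mem_dual_group)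
  have "\<pi>0 \<in> extensional (carrier Q)" "\<And>g. g \<in> carrier Q \<Longrightarrow> \<pi>0 g \<in> extensional (carrier A)"
    using \<pi>0 by (auto simp: mem_cocyc mem_dual_group PiE_def Pi_def)
  moreover have "\<psi> a \<noteq> 0" if "a \<in> carrier A" for a using that \<psi>(1) by (simp add: mem_dual_group)
  ultimately have "\<pi>0 = (\<lambda>g\<in>carrier Q. \<lambda>a\<in>carrier A. \<psi>' ((inv\<^bsub>Q\<^esub> g) \<triangleright> a) / \<psi>' a * \<pi> g a)"
    by (intro extensionalityI[of _ "carrier Q"]) (auto simp: \<psi>(2) \<psi>'_def intro!: extensionalityI[of _ "carrier A"])
  from associated_times_coboundary[OF \<pi>(2) \<psi>' this] have a0: "associated \<pi>0 c" .
  show ?thesis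
    unfolding \<pi>0 B1_coset
    using associated_times_coboundary[OF a0] associated_differ_by_coboundary[OF a0 _ c] by blast
qed

lemma H1_class_subset:
  assumes P: "P \<in> H1_carrier" and \<pi>: "\<pi> \<in> P"
  shows "\<pi> \<in> cocyc"
proof -
  obtain \<pi>0 \<psi> where "\<pi>0 \<in> cocyc" "\<psi> \<in> carrier (dual_group A)"
    "\<pi> = (\<lambda>g\<in>carrier Q. \<lambda>a\<in>carrier A. \<psi> ((inv\<^bsub>Q\<^esub> g) \<triangleright> a) / \<psi> a * \<pi>0 g a)"
    using P \<pi> unfolding mem_H1_carrier B1_coset by blast
  then show ?thesis using cocyc_times_coboundary by blast
qed

section \<open>The class of the extension and its sections\<close>

abbreviation "ext_class \<beta> \<equiv> B2 Q A (conj_act A G \<iota> p) #>\<^bsub>Z2 Q A (conj_act A G \<iota> p)\<^esub> \<beta>"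

lemma mult_Z2A: "b \<otimes>\<^bsub>Z2 Q A (conj_act A G \<iota> p)\<^esub> b' = (\<lambda>x\<in>carrier Q \<times> carrier Q. b x \<oplus> b' x)"
  by (simp add: Z2_def cochains_def)

lemma ext_class_self:
  assumes "\<beta> \<in> carrier (Z2 Q A (conj_act A G \<iota> p))"
  shows "\<beta> \<in> ext_class \<beta>"
proof -
  have \<beta>: "\<beta> \<in> carrier Q \<times> carrier Q \<rightarrow>\<^sub>E carrier A"
    using assms by (simp add: Z2_def kernel_def cochains_def)
  \<comment> \<open>The coboundary of the constant cochain 1 serves as the neutral element of the
    coset.\<close>
  let ?b = "cobdry1 Q A (conj_act A G \<iota> p) (\<lambda>_\<in>carrier Q. \<one>\<^bsub>A\<^esub>)"
  have "?b \<in> B2 Q A (conj_act A G \<iota> p)" by (auto simp: B2_def cochains_def)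
  moreover have "\<beta> = ?b \<otimes>\<^bsub>Z2 Q A (conj_act A G \<iota> p)\<^esub> \<beta>"
    unfolding mult_Z2A
    by (rule extensionalityI[of _ "carrier Q \<times> carrier Q"]) (use \<beta> in \<open>auto simp: cobdry1_def PiE_def Pi_def\<close>)
  ultimately show ?thesis unfolding r_coset_def by blast
qed

text \<open>Multiplying a factor set by the coboundary of \<open>a\<close> amounts to replacing the
  section \<open>s\<close> by \<open>\<iota> (a g) \<odot> s g\<close>. So each representative of
  the class is again the factor set of a section.\<close>

lemma ext_class_section:
  assumes s: "\<And>g. g \<in> carrier Q \<Longrightarrow> s g \<in> carrier G" "\<And>g. g \<in> carrier Q \<Longrightarrow> p (s g) = g"
    and \<beta>: "\<And>g h. g \<in> carrier Q \<Longrightarrow> h \<in> carrier Q \<Longrightarrow> \<beta> (g, h) \<in> carrier A"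
    "\<And>g h. g \<in> carrier Q \<Longrightarrow> h \<in> carrier Q \<Longrightarrow> \<iota> (\<beta> (g, h)) \<odot> s (g \<cdot> h) = s g \<odot> s h"
    and \<beta>': "\<beta>' \<in> ext_class \<beta>"
  obtains s' where "\<And>g. g \<in> carrier Q \<Longrightarrow> s' g \<in> carrier G" "\<And>g. g \<in> carrier Q \<Longrightarrow> p (s' g) = g"
    "\<And>g h. g \<in> carrier Q \<Longrightarrow> h \<in> carrier Q \<Longrightarrow> \<beta>' (g, h) \<in> carrier A"
    "\<And>g h. g \<in> carrier Q \<Longrightarrow> h \<in> carrier Q \<Longrightarrow> \<iota> (\<beta>' (g, h)) \<odot> s' (g \<cdot> h) = s' g \<odot> s' h"
proof -
  obtain a where a: "\<And>g. g \<in> carrier Q \<Longrightarrow> a g \<in> carrier A"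
    and \<beta>'_def: "\<beta>' = cobdry1 Q A (conj_act A G \<iota> p) a \<otimes>\<^bsub>Z2 Q A (conj_act A G \<iota> p)\<^esub> \<beta>"
    using \<beta>' unfolding r_coset_def B2_def by (auto simp: cochains_def PiE_def Pi_def)
  have \<beta>': "\<beta>' (g, h) = (g \<triangleright> a h) \<oplus> inv\<^bsub>A\<^esub> (a (g \<cdot> h)) \<oplus> a g \<oplus> \<beta> (g, h)"
    if "g \<in> carrier Q" "h \<in> carrier Q" for g h
    using that by (simp add: \<beta>'_def mult_Z2A cobdry1_def)
  show ?thesis
  proof (rule that[of "\<lambda>g. \<iota> (a g) \<odot> s g"])
    fix g h assume [simp]: "g \<in> carrier Q" "h \<in> carrier Q"
    note [simp] = a s \<beta>(1)
    show "\<beta>' (g, h) \<in> carrier A" by (simp add: \<beta>')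
    have "\<beta>' (g, h) \<oplus> a (g \<cdot> h) = a g \<oplus> (g \<triangleright> a h) \<oplus> \<beta> (g, h) \<oplus> (inv\<^bsub>A\<^esub> (a (g \<cdot> h)) \<oplus> a (g \<cdot> h))"
      by (simp add: \<beta>' A.m_ac del: A.l_inv A.r_inv) (simp flip: A.m_assoc)
    then have 1: "\<beta>' (g, h) \<oplus> a (g \<cdot> h) = a g \<oplus> (g \<triangleright> a h) \<oplus> \<beta> (g, h)" by simp
    have "\<iota> (\<beta>' (g, h)) \<odot> (\<iota> (a (g \<cdot> h)) \<odot> s (g \<cdot> h)) = \<iota> (\<beta>' (g, h) \<oplus> a (g \<cdot> h)) \<odot> s (g \<cdot> h)"
      by (simp add: \<beta>' G.m_assoc)
    also have "\<dots> = \<iota> (a g) \<odot> \<iota> (g \<triangleright> a h) \<odot> (s g \<odot> s h)"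
      unfolding 1 by (simp add: G.m_assoc \<beta>(2))
    also have "\<dots> = \<iota> (a g) \<odot> (\<iota> (g \<triangleright> a h) \<odot> s g) \<odot> s h" by (simp add: G.m_assoc)
    also have "\<iota> (g \<triangleright> a h) \<odot> s g = s g \<odot> \<iota> (a h)" using act_comm[of "s g" "a h"] by simp
    also have "\<iota> (a g) \<odot> (s g \<odot> \<iota> (a h)) \<odot> s h = \<iota> (a g) \<odot> s g \<odot> (\<iota> (a h) \<odot> s h)"
      by (simp add: G.m_assoc)
    finally show "\<iota> (\<beta>' (g, h)) \<odot> (\<iota> (a (g \<cdot> h)) \<odot> s (g \<cdot> h)) = \<iota> (a g) \<odot> s g \<odot> (\<iota> (a h) \<odot> s h)" .
  qed (simp_all add: a s)
qed

section \<open>Triviality of the cup product class\<close>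

lemma mult_Z3 [simp]:
  "b \<otimes>\<^bsub>Z3 Q Cstar triv_act\<^esub> b' = (\<lambda>x\<in>carrier Q \<times> carrier Q \<times> carrier Q. b x * b' x)"
  by (simp add: Z3_def cochains_def)

lemma B3_mult_div:
  assumes "b \<in> B3 Q Cstar triv_act" "b' \<in> B3 Q Cstar triv_act"
  shows "(\<lambda>x\<in>carrier Q \<times> carrier Q \<times> carrier Q. b x * b' x) \<in> B3 Q Cstar triv_act"
    and "(\<lambda>x\<in>carrier Q \<times> carrier Q \<times> carrier Q. b x / b' x) \<in> B3 Q Cstar triv_act"
proof -
  let ?d = "\<lambda>\<omega>. \<lambda>(x, y, z)\<in>carrier Q \<times> carrier Q \<times> carrier Q.
           \<omega> x (y \<cdot> z) * \<omega> y z / (\<omega> x y * \<omega> (x \<cdot> y) z)"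
  obtain \<omega> where \<omega>: "\<forall>x\<in>carrier Q. \<forall>y\<in>carrier Q. \<omega> x y \<noteq> 0" "b = ?d \<omega>"
    using assms(1) unfolding B3_Cstar_iff[OF Q.is_group] by blast
  obtain \<omega>' where \<omega>': "\<forall>x\<in>carrier Q. \<forall>y\<in>carrier Q. \<omega>' x y \<noteq> 0" "b' = ?d \<omega>'"
    using assms(2) unfolding B3_Cstar_iff[OF Q.is_group] by blast
  have "(\<lambda>x\<in>carrier Q \<times> carrier Q \<times> carrier Q. b x * b' x) = ?d (\<lambda>x y. \<omega> x y * \<omega>' x y)"
    unfolding \<omega>(2) \<omega>'(2) by (rule restrict_ext) (auto simp: mult_ac)
  moreover have "\<forall>x\<in>carrier Q. \<forall>y\<in>carrier Q. \<omega> x y * \<omega>' x y \<noteq> 0" using \<omega>(1) \<omega>'(1) by simp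
  ultimately show "(\<lambda>x\<in>carrier Q \<times> carrier Q \<times> carrier Q. b x * b' x) \<in> B3 Q Cstar triv_act"
    unfolding B3_Cstar_iff[OF Q.is_group] by (intro exI[of _ "\<lambda>x y. \<omega> x y * \<omega>' x y"]) blast
  have "(\<lambda>x\<in>carrier Q \<times> carrier Q \<times> carrier Q. b x / b' x) = ?d (\<lambda>x y. \<omega> x y / \<omega>' x y)"
    unfolding \<omega>(2) \<omega>'(2) by (rule restrict_ext) (auto simp: mult_ac)
  moreover have "\<forall>x\<in>carrier Q. \<forall>y\<in>carrier Q. \<omega> x y / \<omega>' x y \<noteq> 0" using \<omega>(1) \<omega>'(1) by simp
  ultimately show "(\<lambda>x\<in>carrier Q \<times> carrier Q \<times> carrier Q. b x / b' x) \<in> B3 Q Cstar triv_act"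
    unfolding B3_Cstar_iff[OF Q.is_group] by (intro exI[of _ "\<lambda>x y. \<omega> x y / \<omega>' x y"]) blast
qed

lemma B3_ext_nonzero:
  assumes "b \<in> B3 Q Cstar triv_act"
  shows "b \<in> extensional (carrier Q \<times> carrier Q \<times> carrier Q)"
    and "x \<in> carrier Q \<times> carrier Q \<times> carrier Q \<Longrightarrow> b x \<noteq> 0"
  using assms unfolding B3_Cstar_iff[OF Q.is_group] by auto

text \<open>\<open>cup_class\<close> multiplies the group of coboundaries by the cup cochains of all
  pairs of representatives, so it equals that group precisely when each of these is a coboundary.
  The given representatives make the set of cup cochains nonempty; any coboundary is then a quotient
  by one of them times it.\<close>

lemma cup_class_trivial_iff:
  assumes "\<beta> \<in> W" "\<pi> \<in> P"
  shows "cup_class Q (conj_act A G \<iota> p) W P = \<one>\<^bsub>H3 Q Cstar triv_act\<^esub> \<longleftrightarrow>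
    (\<forall>\<beta>\<in>W. \<forall>\<pi>\<in>P. cup_cochain Q (conj_act A G \<iota> p) \<beta> \<pi> \<in> B3 Q Cstar triv_act)"
proof -
  let ?S = "{cup_cochain Q (conj_act A G \<iota> p) \<beta> \<pi> | \<beta> \<pi>. \<beta> \<in> W \<and> \<pi> \<in> P}"
  let ?B = "B3 Q Cstar triv_act"
  have S: "t \<in> extensional (carrier Q \<times> carrier Q \<times> carrier Q)" if "t \<in> ?S" for t
    using that by (auto simp: cup_cochain_def)
  have one: "(\<lambda>x\<in>carrier Q \<times> carrier Q \<times> carrier Q. 1) \<in> ?B"
    unfolding B3_Cstar_iff[OF Q.is_group] by (intro exI[of _ "\<lambda>_ _. 1"]) (auto simp: fun_eq_iff restrict_def)
  have "?B <#>\<^bsub>Z3 Q Cstar triv_act\<^esub> ?S = ?B \<longleftrightarrow> ?S \<subseteq> ?B"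
  proof
    assume eq: "?B <#>\<^bsub>Z3 Q Cstar triv_act\<^esub> ?S = ?B"
    show "?S \<subseteq> ?B"
    proof
      fix t assume t: "t \<in> ?S"
      have "t = (\<lambda>x\<in>carrier Q \<times> carrier Q \<times> carrier Q. 1) \<otimes>\<^bsub>Z3 Q Cstar triv_act\<^esub> t"
        by (rule extensionalityI[OF S[OF t]]) auto
      then have "t \<in> ?B <#>\<^bsub>Z3 Q Cstar triv_act\<^esub> ?S" unfolding set_mult_def using one t by blast
      then show "t \<in> ?B" using eq by simp
    qed
  next
    assume sub: "?S \<subseteq> ?B"
    show "?B <#>\<^bsub>Z3 Q Cstar triv_act\<^esub> ?S = ?B"
    proof (intro equalityI subsetI)
      fix b assume "b \<in> ?B <#>\<^bsub>Z3 Q Cstar triv_act\<^esub> ?S"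
      then obtain b' t where "b' \<in> ?B" "t \<in> ?S" "b = b' \<otimes>\<^bsub>Z3 Q Cstar triv_act\<^esub> t"
        unfolding set_mult_def by blast
      then show "b \<in> ?B" using B3_mult_div(1)[of b' t] sub unfolding mult_Z3 by blast
    next
      fix b assume b: "b \<in> ?B"
      obtain t where t: "t \<in> ?S" using assms by blast
      let ?q = "\<lambda>x\<in>carrier Q \<times> carrier Q \<times> carrier Q. b x / t x"
      have "?q \<in> ?B" using b t sub by (intro B3_mult_div(2)) blast+
      moreover have "b = ?q \<otimes>\<^bsub>Z3 Q Cstar triv_act\<^esub> t"
        by (rule extensionalityI[OF B3_ext_nonzero(1)[OF b]])
           (use B3_ext_nonzero(2)[OF subsetD[OF sub t]] in auto)
      ultimately show "b \<in> ?B <#>\<^bsub>Z3 Q Cstar triv_act\<^esub> ?S" unfolding set_mult_def using t by blast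
    qed
  qed
  then show ?thesis unfolding cup_class_def H3_def by auto
qed

section \<open>The correspondence\<close>

lemma associated_nondegenerate_iff:
  assumes "associated \<pi> c" "c \<in> GZ"
    and "finite (carrier A)" "finite (carrier Q)" "order A = order Q"
  shows "nondegenerate_cocycle G c \<longleftrightarrow> bij_betw \<pi> (carrier Q) (carrier (dual_group A))"
proof -
  obtain s where "\<And>g. g \<in> carrier Q \<Longrightarrow> s g \<in> carrier G" "\<And>g. g \<in> carrier Q \<Longrightarrow> p (s g) = g"
    using section_exists by blast
  moreover obtain \<chi> where "\<pi> \<in> cocyc" "splits \<chi> c" "commutes \<chi> \<pi> c"
    using assms(1) by (auto simp: associated_def)
  ultimately show ?thesis using nondegenerate_iff_bij assms by blast
qed

text \<open>Collecting all associated classes avoids choosing representatives. The result is empty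
  if no member of \<open>P\<close> is associated with a cocycle, and otherwise is a full coset of
  the image of inflation.\<close>

definition correspondence :: "('q \<Rightarrow> 'a \<Rightarrow> complex) set \<Rightarrow> ('g \<times> 'g \<Rightarrow> complex) set set" where
  "correspondence P = {cls c | c. c \<in> GZ \<and> (\<exists>\<pi>\<in>P. associated \<pi> c)}"

lemma correspondence_eq:
  assumes P: "P \<in> H1_carrier" and \<pi>: "\<pi> \<in> P" "associated \<pi> c" and c: "c \<in> GZ"
  shows "correspondence P = im_inf G Q p #>\<^bsub>H2 G Cstar triv_act\<^esub> cls c"
proof -
  have "(\<exists>\<pi>'\<in>P. associated \<pi>' c') \<longleftrightarrow> associated \<pi> c'" if "c' \<in> GZ" for c'
    using H1_class_eq[OF P _ _ that] \<pi>(1) by blast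
  then show ?thesis
    unfolding inflation_coset[OF \<pi>(2) c] correspondence_def by blast
qed

lemma mem_quotient: "Y \<in> carrier (ker_res_mod_im_inf A G Q \<iota> p) \<longleftrightarrow>
    (\<exists>c\<in>GZ. (\<exists>\<chi>. splits \<chi> c) \<and> Y = im_inf G Q p #>\<^bsub>H2 G Cstar triv_act\<^esub> cls c)"
proof -
  have "X #>\<^bsub>(H2 G Cstar triv_act)\<lparr>carrier := K\<rparr>\<^esub> W = X #>\<^bsub>H2 G Cstar triv_act\<^esub> W" for X K W
    by (simp add: r_coset_def)
  then have "Y \<in> carrier (ker_res_mod_im_inf A G Q \<iota> p) \<longleftrightarrow>
      (\<exists>W\<in>ker_res A G \<iota>. Y = im_inf G Q p #>\<^bsub>H2 G Cstar triv_act\<^esub> W)"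
    by (auto simp: ker_res_mod_im_inf_def FactGroup_def RCOSETS_def)
  then show ?thesis unfolding Bex_def mem_ker_res by blast
qed

lemma correspondence_bij:
  assumes fin: "finite (carrier A)" "finite (carrier Q)" and ord: "order A = order Q"
    and ext: "extension_cocycle A G Q \<iota> p \<beta>"
  shows "bij_betw correspondence
    {P \<in> H1_carrier. bijective_class Q (dual_group A) P \<and>
       cup_class Q (conj_act A G \<iota> p) (ext_class \<beta>) P = \<one>\<^bsub>H3 Q Cstar triv_act\<^esub>}
    {Y \<in> carrier (ker_res_mod_im_inf A G Q \<iota> p). nondegenerate_element G Y}"
    (is "bij_betw _ ?D ?E")
proof -
  note iff = associated_nondegenerate_iff[OF _ _ fin ord]
  have \<beta>Z: "\<beta> \<in> carrier (Z2 Q A (conj_act A G \<iota> p))" using ext by (simp add: extension_cocycle_def)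
  obtain s where s: "\<And>g. g \<in> carrier Q \<Longrightarrow> s g \<in> carrier G" "\<And>g. g \<in> carrier Q \<Longrightarrow> p (s g) = g"
    and \<beta>s: "\<And>g h. g \<in> carrier Q \<Longrightarrow> h \<in> carrier Q \<Longrightarrow> \<iota> (\<beta> (g, h)) = s g \<odot> s h \<odot> inv\<^bsub>G\<^esub> (s (g \<cdot> h))"
    using ext by (auto simp: extension_cocycle_def)
  have \<beta>: "\<beta> (g, h) \<in> carrier A" "\<iota> (\<beta> (g, h)) \<odot> s (g \<cdot> h) = s g \<odot> s h"
    if "g \<in> carrier Q" "h \<in> carrier Q" for g h
    using that \<beta>Z by (auto simp: Z2_def kernel_def cochains_def \<beta>s s G.m_assoc)
  \<comment> \<open>Existence: the vanishing cup product yields a cocycle associated with a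
    bijective representative.\<close>
  have D: "\<exists>\<pi> c. \<pi> \<in> P \<and> bij_betw \<pi> (carrier Q) (carrier (dual_group A)) \<and> c \<in> GZ \<and> associated \<pi> c"
    if P: "P \<in> ?D" for P
  proof -
    obtain \<pi> where \<pi>: "\<pi> \<in> P" "bij_betw \<pi> (carrier Q) (carrier (dual_group A))"
      using P by (auto simp: bijective_class_def)
    have "cup_cochain Q (conj_act A G \<iota> p) \<beta> \<pi> \<in> B3 Q Cstar triv_act"
      using P cup_class_trivial_iff[OF ext_class_self[OF \<beta>Z] \<pi>(1)] \<pi>(1) ext_class_self[OF \<beta>Z] by blast
    moreover have "\<pi> \<in> cocyc" using H1_class_subset[OF _ \<pi>(1)] P by simp
    ultimately have "\<exists>c\<in>GZ. associated \<pi> c"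
      by (intro associated_cocycle_exists[where s = s and \<beta> = \<beta>] s \<beta>)
    with \<pi> show ?thesis by blast
  qed
  show ?thesis
    unfolding bij_betw_def
  proof
    show "inj_on correspondence ?D"
    proof (rule inj_onI)
      fix P P' assume P: "P \<in> ?D" and P': "P' \<in> ?D" and eq: "correspondence P = correspondence P'"
      obtain \<pi> c where \<pi>: "\<pi> \<in> P" "c \<in> GZ" "associated \<pi> c" using D[OF P] by blast
      then have "cls c \<in> correspondence P" unfolding correspondence_def by (intro CollectI exI conjI bexI) simp_all
      then have "cls c \<in> correspondence P'" by (simp only: eq)
      then obtain c' \<pi>' where c': "cls c = cls c'" "c' \<in> GZ" "\<pi>' \<in> P'" "associated \<pi>' c'"
        unfolding correspondence_def by blast
      \<comment> \<open>A common class gives one cocycle \<open>c\<close> associated with members of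
        both \<open>P\<close> and \<open>P'\<close>, and each of them is the set of all 1-cocycles
        associated with \<open>c\<close>.\<close>
      have "associated \<pi>' c" using associated_cls[OF c'(4)] cls_self[OF \<pi>(2)] c'(1) by simp
      then show "P = P'"
        using H1_class_eq[OF _ \<pi>(1,3,2)] H1_class_eq[OF _ c'(3) _ \<pi>(2)] P P' by simp
    qed
    show "correspondence ` ?D = ?E"
    proof (intro equalityI subsetI)
      fix Y assume "Y \<in> correspondence ` ?D"
      then obtain P where P: "P \<in> ?D" "Y = correspondence P" by blast
      obtain \<pi> c where \<pi>: "\<pi> \<in> P" "bij_betw \<pi> (carrier Q) (carrier (dual_group A))" "c \<in> GZ" "associated \<pi> c"
        using D[OF P(1)] by blast
      have Y: "Y = im_inf G Q p #>\<^bsub>H2 G Cstar triv_act\<^esub> cls c"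
        using correspondence_eq[OF _ \<pi>(1,4,3)] P by simp
      have "\<exists>\<chi>. splits \<chi> c" using \<pi>(4) by (auto simp: associated_def)
      then have "Y \<in> carrier (ker_res_mod_im_inf A G Q \<iota> p)" using mem_quotient Y \<pi>(3) by blast
      moreover have "cls c \<in> Y" unfolding Y inflation_coset[OF \<pi>(4,3)] using \<pi>(3,4) by blast
      then have "nondegenerate_element G Y"
        unfolding nondegenerate_element_def nondegenerate_class_def
        using iff[OF \<pi>(4,3)] \<pi>(2) cls_self[OF \<pi>(3)] by blast
      ultimately show "Y \<in> ?E" by blast
    next
      fix Y assume Y: "Y \<in> ?E"
      then obtain c \<chi> where c: "c \<in> GZ" "splits \<chi> c" and Yc: "Y = im_inf G Q p #>\<^bsub>H2 G Cstar triv_act\<^esub> cls c"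
        using mem_quotient by blast
      \<comment> \<open>Surjectivity: the splitting of \<open>c\<close> produces the required
        1-cocycle, and \<open>P\<close> is its class.\<close>
      obtain \<pi> where \<pi>: "associated \<pi> c" using associated_exists[OF c] by blast
      then have \<pi>Z: "\<pi> \<in> cocyc" by (simp add: associated_def)
      define P where "P = B1 Q (dual_group A) dact #>\<^bsub>Z1 Q (dual_group A) dact\<^esub> \<pi>"
      have P: "P \<in> H1_carrier" "\<pi> \<in> P"
        using \<pi>Z B1_coset_self[OF \<pi>Z] mem_H1_carrier unfolding P_def by blast+
      have Peq: "P = {\<pi>'. associated \<pi>' c}" by (rule H1_class_eq[OF P \<pi> c(1)])
      obtain W c' where W: "W \<in> Y" "c' \<in> W" "nondegenerate_cocycle G c'"
        using Y by (auto simp: nondegenerate_element_def nondegenerate_class_def)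
      \<comment> \<open>The non-degenerate cocycle \<open>c'\<close> may lie in another class of the
        coset, but all these classes are associated with the same \<pi>, so bijectivity can be read
        off from \<open>c'\<close>.\<close>
      obtain c'' where c'': "W = cls c''" "c'' \<in> GZ" "associated \<pi> c''"
        using W(1) unfolding Yc inflation_coset[OF \<pi> c(1)] by blast
      have "associated \<pi> c'" "c' \<in> GZ"
        using associated_cls[OF c''(3)] cls_subset[OF c''(2)] W(2) c''(1) by blast+
      then have "bij_betw \<pi> (carrier Q) (carrier (dual_group A))" using iff W(3) by blast
      then have "bijective_class Q (dual_group A) P" using P(2) by (auto simp: bijective_class_def)
      \<comment> \<open>All representatives are covered: \<open>\<beta>'\<close> belongs to some
        section, and \<open>\<pi>'\<close> is still associated with \<open>c\<close>.\<close>
      moreover have "cup_cochain Q (conj_act A G \<iota> p) \<beta>' \<pi>' \<in> B3 Q Cstar triv_act"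
        if "\<beta>' \<in> ext_class \<beta>" "\<pi>' \<in> P" for \<beta>' \<pi>'
      proof (rule ext_class_section[OF s \<beta> that(1)])
        fix s' assume s': "\<And>g. g \<in> carrier Q \<Longrightarrow> s' g \<in> carrier G" "\<And>g. g \<in> carrier Q \<Longrightarrow> p (s' g) = g"
          "\<And>g h. g \<in> carrier Q \<Longrightarrow> h \<in> carrier Q \<Longrightarrow> \<beta>' (g, h) \<in> carrier A"
          "\<And>g h. g \<in> carrier Q \<Longrightarrow> h \<in> carrier Q \<Longrightarrow> \<iota> (\<beta>' (g, h)) \<odot> s' (g \<cdot> h) = s' g \<odot> s' h"
        have "associated \<pi>' c" using that(2) unfolding Peq by simp
        then show ?thesis by (rule cup_cochain_in_B3[OF _ c(1), where s = s' and \<beta> = \<beta>']) (fact s')+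
      qed
      then have "cup_class Q (conj_act A G \<iota> p) (ext_class \<beta>) P = \<one>\<^bsub>H3 Q Cstar triv_act\<^esub>"
        using cup_class_trivial_iff[OF ext_class_self[OF \<beta>Z] P(2)] by blast
      moreover have "correspondence P = Y" unfolding Yc by (rule correspondence_eq[OF P \<pi> c(1)])
      ultimately show "Y \<in> correspondence ` ?D" using P(1) by blast
    qed
  qed
qed

end

theorem theoremA:
  fixes A :: "('a, 'r) monoid_scheme" and G :: "('g, 's) monoid_scheme"
    and Q :: "('q, 't) monoid_scheme" and \<iota> :: "'a \<Rightarrow> 'g" and p :: "'g \<Rightarrow> 'q"
    and \<beta> :: "'q \<times> 'q \<Rightarrow> 'a"
  defines "act \<equiv> conj_act A G \<iota> p"
  assumes "abelian_extension A G Q \<iota> p"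
    and "finite (carrier A)" and "finite (carrier Q)" and "order A = order Q"
    and "extension_cocycle A G Q \<iota> p \<beta>"
  shows "\<exists>\<Phi>. bij_betw \<Phi>
    {P \<in> carrier (H1 Q (dual_group A) (dual_act Q A act)).
       bijective_class Q (dual_group A) P \<and>
       cup_class Q act (B2 Q A act #>\<^bsub>Z2 Q A act\<^esub> \<beta>) P = \<one>\<^bsub>H3 Q Cstar triv_act\<^esub>}
    {Y \<in> carrier (ker_res_mod_im_inf A G Q \<iota> p). nondegenerate_element G Y}"
  unfolding act_def
  by (rule exI, rule abelian_extension.correspondence_bij[OF assms(2-6)])

end
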